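(* Let $q,r\geq 2$ be integers with $q$ even. Then there exists $n_0=n_0(q,r)$ such that for all $n\geq n_0$, up to isomorphism, $${\rm EX}_{3}(n,\theta(1,q,r))=\begin{cases} \mathcal{G}(n) & \text{if } q=r=2,\\ \{K_{\lceil\frac{n-1}{2}\rceil,\lfloor\frac{n-1}{2}\rfloor}\bullet K_3\} & \text{if } r\geq 4 \text{ is even},\\ \mathcal{H}(n) & \text{if } q=2 \text{ and } r \text{ is odd},\\ \{K_{\lceil\frac{n-2}{2}\rceil,\lfloor\frac{n-2}{2}\rfloor}\circ K_3,\ K_{\lfloor\frac{n-2}{2}\rfloor,\lceil\frac{n-2}{2}\rceil}\circ K_3\} & \text{if } q\geq 4 \text{ and } r \text{ is odd}. \end{cases}$$
   Context: All graphs are finite and simple. A graph is $H$-free if it contains no subgraph isomorphic to $H$. The generalized theta graph $\theta(\ell_1,\ell_2,\dots,\ell_t)$ is the graph formed by $t$ internally vertex-disjoint paths of lengths $\ell_1,\dots,\ell_t$ sharing the same two endpoints; in particular $\theta(1,q,r)$ consists of an edge $uv$ together with two further internally disjoint $(u,v)$-paths of lengths $q$ and $r$. ${\rm EX}_3(n,H)$ denotes the family of all $n$-vertex $H$-free non-bipartite graphs having the maximum number of edges among all $n$-vertex $H$-free non-bipartite graphs. $K_{a,b}$ is the complete bipartite graph with parts of sizes $a$ and $b$. $K_{a,b}\circ K_3$ is the graph obtained by identifying a vertex of $K_{a,b}$ lying in the part of size $b$ with a vertex of a triangle $K_3$. $K_{a,b}\bullet K_3$ is the graph obtained by identifying an edge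 of $K_{a,b}$ with an edge of a triangle $K_3$. $T_{m,2}$ is the complete bipartite graph on $m$ vertices with part sizes $\lceil m/2\rceil,\lfloor m/2\rfloor$. $\mathcal{H}(n)$: let $b=0$ if $n$ is odd and $b\in\{0,1\}$ if $n$ is even; let $X,Y$ be the parts of $K_{\lceil n/2\rceil+b,\lfloor n/2\rfloor-b}$ with $|Y|=\lceil n/2\rceil+b$, and let $u_1,u_2\in Y$ be distinct. $\mathcal{H}(n)$ is the family of all graphs obtained from this complete bipartite graph by adding the edge $u_1u_2$, deleting all edges from $u_1$ to $X\setminus X_1$ and all edges from $u_2$ to $X_1$, where $X_1$ ranges over non-empty proper subsets of $X$ (and $b$ over its allowed values). $\mathcal{G}(n)$: let $X,Y$ be the two parts of $T_{n-3,2}$ and let $w_1w_2w_3$ be a triangle on three new vertices. $\mathcal{G}(n)$ is the family of all graphs obtained from $T_{n-3,2}$ and this triangle by joining $w_1$ to every vertex of $X\setminus X_1$, $w_2$ to every vertex of $Y\setminus Y_1$, and $w_3$ to every vertex of $X_1\cup Y_1$, where $X_1\subseteq X$, $Y_1\subseteq Y$ range over subsets with $|X_1|\cdot|Y_1|\leq 1$. *)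

theory Defs
  imports Complex_Main
begin

text \<open>The record itself carries no constraints; \<open>simple_graph\<close> selects the finite simple graphs.\<close>

record 'a ugraph =
  verts :: "'a set"
  edges :: "'a set set"

definition simple_graph :: "'a ugraph \<Rightarrow> bool" where
  "simple_graph G \<longleftrightarrow>
     finite (verts G) \<and>
     edges G \<subseteq> {{u, v} | u v. u \<in> verts G \<and> v \<in> verts G \<and> u \<noteq> v}"

definition is_subgraph :: "'a ugraph \<Rightarrow> 'a ugraph \<Rightarrow> bool" where
  "is_subgraph S G \<longleftrightarrow> simple_graph S \<and> verts S \<subseteq> verts G \<and> edges S \<subseteq> edges G"

definition isomorphic :: "'a ugraph \<Rightarrow> 'b ugraph \<Rightarrow> bool" where
  "isomorphic G H \<longleftrightarrow>
     (\<exists>f. bij_betw f (verts G) (verts H) \<and>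
          (\<forall>u \<in> verts G. \<forall>v \<in> verts G. {u, v} \<in> edges G \<longleftrightarrow> {f u, f v} \<in> edges H))"

definition graph_free :: "'b ugraph \<Rightarrow> 'a ugraph \<Rightarrow> bool" where
  "graph_free H G \<longleftrightarrow> \<not> (\<exists>S. is_subgraph S G \<and> isomorphic S H)"

definition bipartite :: "'a ugraph \<Rightarrow> bool" where
  "bipartite G \<longleftrightarrow>
     (\<exists>A B. A \<union> B = verts G \<and> A \<inter> B = {} \<and>
            (\<forall>e \<in> edges G. \<exists>a \<in> A. \<exists>b \<in> B. e = {a, b}))"

definition free_nonbipartite :: "nat \<Rightarrow> 'b ugraph \<Rightarrow> 'a ugraph \<Rightarrow> bool" where
  "free_nonbipartite n H G \<longleftrightarrow>
     simple_graph G \<and> card (verts G) = n \<and> graph_free H G \<and> \<not> bipartite G"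

text \<open>Vertices are natural numbers: every finite graph is isomorphic to such a graph, and
  extremal families are only compared up to isomorphism.\<close>

definition EX3 :: "nat \<Rightarrow> 'b ugraph \<Rightarrow> nat ugraph set" where
  "EX3 n H =
     {G. free_nonbipartite n H G \<and>
         (\<forall>G'::nat ugraph. free_nonbipartite n H G' \<longrightarrow> card (edges G') \<le> card (edges G))}"

definition equal_up_to_iso :: "'a ugraph set \<Rightarrow> 'b ugraph set \<Rightarrow> bool" where
  "equal_up_to_iso \<A> \<B> \<longleftrightarrow>
     (\<forall>G \<in> \<A>. \<exists>H \<in> \<B>. isomorphic G H) \<and> (\<forall>H \<in> \<B>. \<exists>G \<in> \<A>. isomorphic G H)"

text \<open>\<open>theta_at ls i j\<close> is the vertex at distance \<open>j\<close> from \<open>Source\<close> along the \<open>i\<close>-th path, which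
  has length \<open>ls ! i\<close>. The definition is meaningful when all lengths are positive and at most one
  of them is 1 (two paths of length 1 would collapse into a single edge).\<close>

datatype theta_vertex = Source | Sink | Inner nat nat

definition theta_at :: "nat list \<Rightarrow> nat \<Rightarrow> nat \<Rightarrow> theta_vertex" where
  "theta_at ls i j = (if j = 0 then Source else if j = ls ! i then Sink else Inner i j)"

definition theta :: "nat list \<Rightarrow> theta_vertex ugraph" where
  "theta ls =
     \<lparr>verts = {theta_at ls i j | i j. i < length ls \<and> j \<le> ls ! i},
      edges = {{theta_at ls i j, theta_at ls i (Suc j)} | i j. i < length ls \<and> j < ls ! i}\<rparr>"

definition complete_bipartite :: "'a set \<Rightarrow> 'a set \<Rightarrow> 'a ugraph" where
  "complete_bipartite X Y = \<lparr>verts = X \<union> Y, edges = {{x, y} | x y. x \<in> X \<and> y \<in> Y}\<rparr>"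

definition triangle :: "'a \<Rightarrow> 'a \<Rightarrow> 'a \<Rightarrow> 'a ugraph" where
  "triangle x y z = \<lparr>verts = {x, y, z}, edges = {{x, y}, {y, z}, {x, z}}\<rparr>"

definition graph_union :: "'a ugraph \<Rightarrow> 'a ugraph \<Rightarrow> 'a ugraph" where
  "graph_union G H = \<lparr>verts = verts G \<union> verts H, edges = edges G \<union> edges H\<rparr>"

text \<open>In the next two definitions \<open>K\<^bsub>a,b\<^esub>\<close> has parts \<open>{..<a}\<close> and \<open>{a..<a + b}\<close>. Identification is
  rendered as the union with a triangle that shares just the vertex \<open>a\<close>, which lies in the part of
  size \<open>b\<close> (\<open>K\<^bsub>a,b\<^esub> \<circ> K\<^sub>3\<close>, for \<open>b \<ge> 1\<close>), or just the edge between \<open>0\<close> and \<open>a\<close>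
  (\<open>K\<^bsub>a,b\<^esub> \<bullet> K\<^sub>3\<close>, for \<open>a, b \<ge> 1\<close>).\<close>

definition K_circ_K3 :: "nat \<Rightarrow> nat \<Rightarrow> nat ugraph" where
  "K_circ_K3 a b =
     graph_union (complete_bipartite {..<a} {a..<a + b}) (triangle a (a + b) (a + b + 1))"

definition K_bullet_K3 :: "nat \<Rightarrow> nat \<Rightarrow> nat ugraph" where
  "K_bullet_K3 a b =
     graph_union (complete_bipartite {..<a} {a..<a + b}) (triangle 0 a (a + b))"

definition family_H :: "nat \<Rightarrow> nat ugraph set" where
  "family_H n =
     {\<lparr>verts = X \<union> Y,
       edges = (edges (complete_bipartite X Y) \<union> {{u1, u2}})
                 - ({{u1, x} | x. x \<in> X - X1} \<union> {{u2, x} | x. x \<in> X1})\<rparr>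
      | b X Y X1 u1 u2.
        (b = 0 \<or> even n \<and> b = 1) \<and>
        finite X \<and> finite Y \<and> X \<inter> Y = {} \<and>
        card Y = nat \<lceil>real n / 2\<rceil> + b \<and> card X = nat \<lfloor>real n / 2\<rfloor> - b \<and>
        u1 \<in> Y \<and> u2 \<in> Y \<and> u1 \<noteq> u2 \<and>
        X1 \<noteq> {} \<and> X1 \<subset> X}"

text \<open>It does not matter which part of \<open>T\<^bsub>n-3,2\<^esub>\<close> is called \<open>X\<close>, since exchanging \<open>X\<close> with \<open>Y\<close>
  and \<open>w1\<close> with \<open>w2\<close> preserves the construction.\<close>

definition family_G :: "nat \<Rightarrow> nat ugraph set" where
  "family_G n =
     {\<lparr>verts = X \<union> Y \<union> {w1, w2, w3},
       edges = edges (complete_bipartite X Y) \<union> edges (triangle w1 w2 w3)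
                 \<union> {{w1, x} | x. x \<in> X - X1} \<union> {{w2, y} | y. y \<in> Y - Y1}
                 \<union> {{w3, z} | z. z \<in> X1 \<union> Y1}\<rparr>
      | X Y X1 Y1 w1 w2 w3.
        finite X \<and> finite Y \<and> X \<inter> Y = {} \<and>
        card X = nat \<lceil>(real n - 3) / 2\<rceil> \<and> card Y = nat \<lfloor>(real n - 3) / 2\<rfloor> \<and>
        distinct [w1, w2, w3] \<and> {w1, w2, w3} \<inter> (X \<union> Y) = {} \<and>
        X1 \<subseteq> X \<and> Y1 \<subseteq> Y \<and> card X1 * card Y1 \<le> 1}"

end

theory Submission
  imports Defs "HOL-Library.Ramsey"
begin

text \<open>
  Call two vertices linked if they have many common neighbours. Inside a large set of pairwise
  linked vertices there are paths of every even length avoiding any bounded set, so an edge whose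
  ends have such a set in their common neighbourhood lies in a copy of \<open>\<theta>(1,q,r)\<close> whenever \<open>q\<close> is
  even. In a graph of minimum degree close to \<open>n/2\<close> any three vertices contain a linked pair; by
  Ramsey's theorem, adjacent vertices of a \<open>\<theta>(1,q,r)\<close>-free such graph then have boundedly many
  common neighbours, which makes the graph triangle-free and finally bipartite. Deleting boundedly
  many vertices of low degree turns every \<open>\<theta>(1,q,r)\<close>-free graph with at least \<open>n\<^sup>2/4 - n\<close> edges into
  one of this kind.

  A vertex with linearly many neighbours in the resulting bipartite core attaches to one side of
  it, and counting edges leaves at most one exceptional vertex \<open>z\<close> (two if \<open>q \<ge> 4\<close> and \<open>r\<close> is odd,
  where they form a pendant triangle). If \<open>G - z\<close> has parts \<open>P, Q\<close> and \<open>z\<close> has \<open>i\<close> neighbours in \<open>P\<close>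
  and \<open>j\<close> in \<open>Q\<close> but lies in no triangle, then \<open>e(G) \<le> |P||Q| - ij + i + j = |P||Q| + 1 - (i-1)(j-1)\<close>,
  the bound behind \<open>\<H>(n)\<close>; a vertex \<open>z\<close> in a triangle either creates a theta graph or has
  degree 2. For \<open>q = r = 2\<close> one deletes a triangle instead: every other vertex has at most one
  neighbour in it.
\<close>

text \<open>Detours through common neighbours have even length only, and this parity shapes the
  argument. A linked set inside the common neighbourhood of adjacent \<open>u\<close>,
  \<open>v\<close> yields \<open>u\<close>-\<open>v\<close> paths of every even length, which
  suffices for two even arcs. For odd \<open>r\<close> the chord has to be moved to an edge from
  \<open>u\<close> into the set, and \<open>uv\<close> becomes the first edge of the arc of length
  \<open>q\<close>. A path of length three can replace \<open>uv\<close> there only if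
  \<open>q \<ge> 4\<close>; this excludes every vertex attached to both sides, which is why
  \<open>q = 2\<close> and \<open>q \<ge> 4\<close> have different extremal graphs.

  The constant 12/25 has to lie strictly between 2/5 and 1/2. Above 2/5 a triangle-free graph
  contains no five-cycle (Andrasfai's argument); below 1/2 the deletion of a vertex of smaller
  degree loses fewer edges than \<open>n^2/4\<close> drops, so repeated deletions build up a surplus
  that the extremal number forbids.

  For \<open>q = r = 2\<close> a triangle at \<open>z\<close> is harmless, since a second arc of
  length 2 would need another triangle on the same edge. The triangle that is deleted instead exists
  because a graph free of \<open>\<theta>(1,2,3)\<close> is already too sparse, by the case
  \<open>q = 2\<close>, \<open>r = 3\<close>.\<close>

definition nbr :: "'a ugraph \<Rightarrow> 'a \<Rightarrow> 'a set" where
  "nbr G v = {u. {v, u} \<in> edges G}"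

abbreviation order :: "'a ugraph \<Rightarrow> nat" where
  "order G \<equiv> card (verts G)"

abbreviation esize :: "'a ugraph \<Rightarrow> nat" where
  "esize G \<equiv> card (edges G)"

abbreviation deg :: "'a ugraph \<Rightarrow> 'a \<Rightarrow> nat" where
  "deg G v \<equiv> card (nbr G v)"

definition is_path :: "'a ugraph \<Rightarrow> 'a list \<Rightarrow> bool" where
  "is_path G p \<longleftrightarrow> distinct p \<and> successively (\<lambda>x y. {x, y} \<in> edges G) p"

text \<open>The lists \<open>p\<close> and \<open>p'\<close> hold the inner vertices only, hence the
  \<open>Suc\<close> in the lengths. Further edges among the vertices are allowed: the copy need not
  be induced.\<close>

definition has_theta :: "'a ugraph \<Rightarrow> nat \<Rightarrow> nat \<Rightarrow> bool" where
  "has_theta G q r \<longleftrightarrow>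
     (\<exists>u v p p'. {u, v} \<in> edges G \<and> is_path G (u # p @ [v]) \<and> is_path G (u # p' @ [v]) \<and>
        Suc (length p) = q \<and> Suc (length p') = r \<and> set p \<inter> set p' = {})"

lemma nbr_iff: "u \<in> nbr G v \<longleftrightarrow> {v, u} \<in> edges G"
  by (simp add: nbr_def)

lemma nbr_sym: "u \<in> nbr G v \<longleftrightarrow> v \<in> nbr G u"
  by (simp add: nbr_def insert_commute)

lemma is_path_single [simp]: "is_path G [x]"
  by (simp add: is_path_def)

lemma is_path_Cons:
  "is_path G (x # y # p) \<longleftrightarrow> {x, y} \<in> edges G \<and> x \<notin> set (y # p) \<and> is_path G (y # p)"
  by (auto simp: is_path_def)

lemma is_path_Cons_hd:
  "p \<noteq> [] \<Longrightarrow> is_path G (x # p) \<longleftrightarrow> {x, hd p} \<in> edges G \<and> x \<notin> set p \<and> is_path G p"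
  by (cases p) (auto simp: is_path_Cons)

lemma is_path_append:
  "p \<noteq> [] \<Longrightarrow> p' \<noteq> [] \<Longrightarrow> is_path G (p @ p') \<longleftrightarrow>
     is_path G p \<and> is_path G p' \<and> set p \<inter> set p' = {} \<and> {last p, hd p'} \<in> edges G"
  by (auto simp: is_path_def successively_append_iff)

lemma is_path_rev: "is_path G (rev p) \<longleftrightarrow> is_path G p"
  by (simp add: is_path_def insert_commute)

lemma simple_edgeE:
  assumes "simple_graph G" "e \<in> edges G"
  obtains u v where "e = {u, v}" "u \<in> verts G" "v \<in> verts G" "u \<noteq> v"
  using assms unfolding simple_graph_def by blast

lemma edge_subset: "simple_graph G \<Longrightarrow> e \<in> edges G \<Longrightarrow> e \<subseteq> verts G"
  by (auto simp: simple_graph_def)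

lemma simple_edge:
  assumes "simple_graph G" "{u, v} \<in> edges G"
  shows "u \<in> verts G" "v \<in> verts G" "u \<noteq> v"
  using assms by (auto elim!: simple_edgeE[of G "{u, v}"] simp: doubleton_eq_iff)

lemma nbr_subset: "simple_graph G \<Longrightarrow> nbr G v \<subseteq> verts G"
  by (auto simp: nbr_def dest: simple_edge)

lemma nbr_irrefl: "simple_graph G \<Longrightarrow> v \<notin> nbr G v"
  using simple_edge(3)[of G v v] by (auto simp: nbr_def)

lemma simple_finite: "simple_graph G \<Longrightarrow> finite (verts G)"
  by (simp add: simple_graph_def)

lemma finite_nbr: "simple_graph G \<Longrightarrow> finite (nbr G v)"
  using nbr_subset simple_finite finite_subset by metis

lemma finite_edges: "simple_graph G \<Longrightarrow> finite (edges G)"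
  using finite_subset[of "edges G" "Pow (verts G)"]
  by (fastforce simp: simple_graph_def)

section \<open>Theta graphs as pairs of paths\<close>

text \<open>The inverse of an isomorphism onto \<open>H\<close> is an injective edge-preserving map
  \<open>h\<close>; conversely the image of \<open>H\<close> under \<open>h\<close> is the required
  subgraph. By \<open>cov\<close> every vertex lies on an edge, and this is what places the image
  inside \<open>verts G\<close>.\<close>

lemma subgraph_iso_iff_hom:
  assumes H: "simple_graph H"
    and cov: "verts H \<subseteq> \<Union> (edges H)" and G: "simple_graph G"
  shows "(\<exists>S. is_subgraph S G \<and> isomorphic S H) \<longleftrightarrow>
         (\<exists>h. inj_on h (verts H) \<and> (\<forall>e \<in> edges H. h ` e \<in> edges G))" (is "?L \<longleftrightarrow> ?R")
proof
  assume ?L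
  then obtain S f where S: "is_subgraph S G" and f: "bij_betw f (verts S) (verts H)"
    and e: "\<And>u v. u \<in> verts S \<Longrightarrow> v \<in> verts S \<Longrightarrow> {u, v} \<in> edges S \<longleftrightarrow> {f u, f v} \<in> edges H"
    unfolding isomorphic_def by blast
  let ?h = "inv_into (verts S) f"
  have "inj_on ?h (verts H)"
    using bij_betw_inv_into[OF f] by (simp add: bij_betw_def)
  moreover have "?h ` d \<in> edges G" if d: "d \<in> edges H" for d
  proof -
    from simple_edgeE[OF H d] obtain x y where xy: "d = {x, y}" "x \<in> verts H" "y \<in> verts H" by metis
    have "?h x \<in> verts S" "?h y \<in> verts S" "f (?h x) = x" "f (?h y) = y"
      using f xy by (auto simp: bij_betw_def inv_into_into f_inv_into_f)
    then have "{?h x, ?h y} \<in> edges S" using e[of "?h x" "?h y"] d xy by simp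
    then show ?thesis using S xy by (auto simp: is_subgraph_def)
  qed
  ultimately show ?R by blast
next
  assume ?R
  then obtain h where inj: "inj_on h (verts H)" and h: "\<And>e. e \<in> edges H \<Longrightarrow> h ` e \<in> edges G" by blast
  let ?S = "\<lparr>verts = h ` verts H, edges = (`) h ` edges H\<rparr>"
  have Hs: "\<And>e. e \<in> edges H \<Longrightarrow> e \<subseteq> verts H" using simple_edgeE[OF H] by blast
  have "h ` verts H \<subseteq> verts G"
  proof
    fix x assume "x \<in> h ` verts H"
    then obtain y e where "x = h y" "y \<in> e" "e \<in> edges H" using cov by blast
    then have "x \<in> h ` e" "h ` e \<in> edges G" using h by auto
    then show "x \<in> verts G" using edge_subset[OF G] by blast
  qed
  moreover have "(`) h ` edges H \<subseteq> {{u, v} |u v. u \<in> h ` verts H \<and> v \<in> h ` verts H \<and> u \<noteq> v}"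
  proof
    fix d assume "d \<in> (`) h ` edges H"
    then obtain e where e: "e \<in> edges H" "d = h ` e" by blast
    from simple_edgeE[OF H e(1)] obtain x y where "e = {x, y}" "x \<in> verts H" "y \<in> verts H" "x \<noteq> y" by metis
    then show "d \<in> {{u, v} |u v. u \<in> h ` verts H \<and> v \<in> h ` verts H \<and> u \<noteq> v}"
      using e inj by (auto simp: inj_on_def)
  qed
  ultimately have "is_subgraph ?S G"
    using h simple_finite[OF H] by (auto simp: is_subgraph_def simple_graph_def)
  moreover have "isomorphic ?S H"
    unfolding isomorphic_def
  proof (intro exI conjI ballI)
    let ?f = "inv_into (verts H) h"
    show "bij_betw ?f (verts ?S) (verts H)"
      using bij_betw_inv_into[of h "verts H" "h ` verts H"] inj by (simp add: bij_betw_def)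
    fix u v assume "u \<in> verts ?S" "v \<in> verts ?S"
    then obtain x y where xy: "u = h x" "v = h y" "x \<in> verts H" "y \<in> verts H" by auto
    have "{h x, h y} = h ` {x, y}" by simp
    then have "{h x, h y} \<in> (`) h ` edges H \<longleftrightarrow> {x, y} \<in> edges H"
      using inj_on_image_eq_iff[OF inj, of "{x, y}"] Hs xy
      by (metis (no_types, lifting) empty_subsetI image_iff insert_subset)
    then show "{u, v} \<in> edges ?S \<longleftrightarrow> {?f u, ?f v} \<in> edges H"
      using xy inj by simp
  qed
  ultimately show ?L by blast
qed

lemma theta_verts:
  assumes "q \<ge> 1" "r \<ge> 1"
  shows "verts (theta [1, q, r]) = {Source, Sink} \<union> Inner 1 ` {1..<q} \<union> Inner 2 ` {1..<r}" (is "_ = ?R")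
proof -
  have im: "theta_at [1, q, r] i ` {..l} = {Source, Sink} \<union> Inner i ` {1..<l}"
    if "l = [1, q, r] ! i" "l \<ge> 1" for i l
  proof -
    have "{..l} = {0, l} \<union> {1..<l}" using that(2) by auto
    moreover have "theta_at [1, q, r] i ` {1..<l} = Inner i ` {1..<l}"
      using that by (intro image_cong) (auto simp: theta_at_def)
    ultimately show ?thesis using that by (auto simp: theta_at_def image_Un)
  qed
  have "verts (theta ls) = (\<Union>i<length ls. theta_at ls i ` {..ls ! i})" for ls
    by (auto simp: theta_def)
  moreover have "{..<length [1, q, r]} = {0, 1, 2}" by auto
  ultimately have "verts (theta [1, q, r]) = (\<Union>i\<in>{0,1,2}. theta_at [1,q,r] i ` {..[1,q,r] ! i})" by metis
  also have "\<dots> = theta_at [1,q,r] 0 ` {..1} \<union> theta_at [1,q,r] 1 ` {..q} \<union> theta_at [1,q,r] 2 ` {..r}"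
    by auto
  also have "\<dots> = ?R" using im[of 1 0] im[of q 1] im[of r 2] assms by auto
  finally show ?thesis .
qed

lemma theta_edges:
  "edges (theta [1, q, r]) = {{Source, Sink}} \<union>
     (\<lambda>j. {theta_at [1,q,r] 1 j, theta_at [1,q,r] 1 (Suc j)}) ` {..<q} \<union>
     (\<lambda>j. {theta_at [1,q,r] 2 j, theta_at [1,q,r] 2 (Suc j)}) ` {..<r}" (is "_ = ?R")
proof -
  have "edges (theta ls) = (\<Union>i<length ls. (\<lambda>j. {theta_at ls i j, theta_at ls i (Suc j)}) ` {..<ls ! i})" for ls
    by (auto simp: theta_def)
  moreover have "{..<length [1, q, r]} = {0, 1, 2}" by auto
  ultimately show ?thesis by (simp add: theta_at_def[of _ 0] Un_assoc lessThan_Suc)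
qed

lemma theta_simple:
  assumes "q \<ge> 2" "r \<ge> 2"
  shows "simple_graph (theta [1, q, r])" "verts (theta [1, q, r]) \<subseteq> \<Union> (edges (theta [1, q, r]))"
proof -
  let ?V = "verts (theta [1, q, r])"
  have v: "?V = {Source, Sink} \<union> Inner 1 ` {1..<q} \<union> Inner 2 ` {1..<r}"
    using theta_verts assms by simp
  have m1: "theta_at [1,q,r] 1 j \<in> ?V" if "j \<le> q" for j
    using that unfolding v by (auto simp: theta_at_def)
  have m2: "theta_at [1,q,r] 2 j \<in> ?V" if "j \<le> r" for j
    using that unfolding v by (auto simp: theta_at_def)
  have n1: "theta_at [1,q,r] 1 j \<noteq> theta_at [1,q,r] 1 (Suc j)"
    and n2: "theta_at [1,q,r] 2 j \<noteq> theta_at [1,q,r] 2 (Suc j)" for j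
    using assms by (auto simp: theta_at_def)
  have pair: "{x, y} \<in> {{u, v} |u v. u \<in> ?V \<and> v \<in> ?V \<and> u \<noteq> v}"
    if "x \<in> ?V" "y \<in> ?V" "x \<noteq> y" for x y
    using that by blast
  have "edges (theta [1, q, r]) \<subseteq> {{u, v} |u v. u \<in> ?V \<and> v \<in> ?V \<and> u \<noteq> v}"
    unfolding theta_edges
    by (intro Un_least image_subsetI insert_subsetI empty_subsetI pair m1 m2 n1 n2) (auto simp: v simp del: One_nat_def)
  moreover have "finite ?V" unfolding v by simp
  ultimately show "simple_graph (theta [1, q, r])" unfolding simple_graph_def by blast
  show "?V \<subseteq> \<Union> (edges (theta [1, q, r]))"
    unfolding v
  proof (intro Un_least image_subsetI)
    show "{Source, Sink} \<subseteq> \<Union> (edges (theta [1, q, r]))" unfolding theta_edges by auto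
    fix j assume "j \<in> {1..<q}"
    then have "Inner 1 j \<in> {theta_at [1,q,r] 1 j, theta_at [1,q,r] 1 (Suc j)}" "j \<in> {..<q}"
      by (auto simp: theta_at_def)
    then show "Inner 1 j \<in> \<Union> (edges (theta [1, q, r]))" unfolding theta_edges by blast
  next
    fix j assume "j \<in> {1..<r}"
    then have "Inner 2 j \<in> {theta_at [1,q,r] 2 j, theta_at [1,q,r] 2 (Suc j)}" "j \<in> {..<r}"
      by (auto simp: theta_at_def)
    then show "Inner 2 j \<in> \<Union> (edges (theta [1, q, r]))" unfolding theta_edges by blast
  qed
qed

text \<open>Brings a branch into the shape \<open>u # p @ [v]\<close> used by
  \<open>has_theta\<close>; both directions of \<open>graph_free_theta_iff\<close> rest on
  it.\<close>

lemma theta_path_image: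
  assumes "l = [1,q,r] ! i" "l \<ge> 2"
  shows "map (\<lambda>j. h (theta_at [1,q,r] i j)) [0..<Suc l] = h Source # map (\<lambda>j. h (Inner i j)) [1..<l] @ [h Sink]"
proof -
  have "[0..<Suc l] = 0 # [1..<l] @ [l]" using assms(2) by (simp add: upt_rec[of 0])
  then show ?thesis using assms by (auto simp: theta_at_def)
qed

lemma graph_free_theta_iff:
  assumes G: "simple_graph G" and q: "q \<ge> 2" and r: "r \<ge> 2"
  shows "graph_free (theta [1, q, r]) G \<longleftrightarrow> \<not> has_theta G q r"
proof -
  have "(\<exists>h. inj_on h (verts (theta [1,q,r])) \<and> (\<forall>e \<in> edges (theta [1,q,r]). h ` e \<in> edges G)) \<longleftrightarrow> has_theta G q r"
    (is "?L \<longleftrightarrow> ?R")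
  proof
    assume ?L
    then obtain h where inj: "inj_on h (verts (theta [1,q,r]))"
      and h: "\<And>e. e \<in> edges (theta [1,q,r]) \<Longrightarrow> h ` e \<in> edges G" by blast
    have inj: "inj_on h ({Source, Sink} \<union> Inner 1 ` {1..<q} \<union> Inner 2 ` {1..<r})"
      using inj theta_verts q r by simp
    let ?p = "\<lambda>i l. map (\<lambda>j. h (Inner i j)) [1..<l]"
    have path: "is_path G (h Source # ?p i l @ [h Sink])"
      if l: "l = [1,q,r] ! i" "l \<ge> 2" and sub: "Inner i ` {1..<l} \<subseteq> Inner 1 ` {1..<q} \<union> Inner 2 ` {1..<r}"
        and e: "\<And>j. j < l \<Longrightarrow> {theta_at [1,q,r] i j, theta_at [1,q,r] i (Suc j)} \<in> edges (theta [1,q,r])" for i l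
      unfolding is_path_def
    proof
      have "distinct (map h (Source # map (Inner i) [1..<l] @ [Sink]))"
        unfolding distinct_map by (intro conjI inj_on_subset[OF inj]) (use sub in \<open>auto simp: distinct_map inj_on_def\<close>)
      then show "distinct (h Source # ?p i l @ [h Sink])" by (simp add: comp_def)
      have "{h (theta_at [1,q,r] i j), h (theta_at [1,q,r] i (Suc j))} \<in> edges G" if "j < l" for j
        using h[OF e[OF that]] by simp
      then show "successively (\<lambda>x y. {x, y} \<in> edges G) (h Source # ?p i l @ [h Sink])"
        unfolding theta_path_image[OF l, symmetric] successively_conv_nth by (simp del: upt_Suc)
    qed
    have a: "is_path G (h Source # ?p 1 q @ [h Sink])"
      by (rule path) (use q in \<open>auto simp: theta_edges simp del: One_nat_def\<close>)
    have b: "is_path G (h Source # ?p 2 r @ [h Sink])"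
      by (rule path) (use r in \<open>auto simp: theta_edges simp del: One_nat_def\<close>)
    have "{Source, Sink} \<in> edges (theta [1,q,r])" unfolding theta_edges by simp
    from h[OF this] have c: "{h Source, h Sink} \<in> edges G" by simp
    have "h ` (Inner 1 ` {1..<q} \<inter> Inner 2 ` {1..<r}) = h ` Inner 1 ` {1..<q} \<inter> h ` Inner 2 ` {1..<r}"
      by (rule inj_on_image_Int[OF inj]) auto
    then have d: "set (?p 1 q) \<inter> set (?p 2 r) = {}"
      by (auto simp: image_image)
    show ?R unfolding has_theta_def
    proof (intro exI conjI)
      show "Suc (length (?p 1 q)) = q" "Suc (length (?p 2 r)) = r" using q r by auto
    qed (fact a b c d)+
  next
    assume ?R
    then obtain u v p p' where uv: "{u, v} \<in> edges G" and p: "is_path G (u # p @ [v])" "Suc (length p) = q"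
      and p': "is_path G (u # p' @ [v])" "Suc (length p') = r" and d: "set p \<inter> set p' = {}"
      unfolding has_theta_def by blast
    \<comment> \<open>Inner vertices are numbered from 1, list positions from 0; hence
      \<open>j - 1\<close>.\<close>
    define h where "h x = (case x of Source \<Rightarrow> u | Sink \<Rightarrow> v | Inner i j \<Rightarrow> (if i = 1 then p else p') ! (j - 1))" for x
    have hs: "h Source = u" "h Sink = v" "\<And>j. h (Inner 1 j) = p ! (j - 1)" "\<And>j. h (Inner 2 j) = p' ! (j - 1)"
      by (simp_all add: h_def)
    have i1: "inj_on (\<lambda>j. p ! (j - 1)) {1..<q}" and i2: "inj_on (\<lambda>j. p' ! (j - 1)) {1..<r}"
      using p p' by (auto simp: is_path_def inj_on_def nth_eq_iff_index_eq)
    have s1: "p ! (j - 1) \<in> set p" if "j \<in> {1..<q}" for j using that p by auto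
    have s2: "p' ! (j - 1) \<in> set p'" if "j \<in> {1..<r}" for j using that p' by auto
    have "inj_on h (Inner 1 ` {1..<q})" "inj_on h (Inner 2 ` {1..<r})"
      using i1 i2 by (auto simp: inj_on_def hs simp del: One_nat_def)
    note i = this
    have i0: "inj_on h {Source, Sink}" using p(1) by (auto simp: is_path_def hs)
    have im: "h ` Inner 1 ` {1..<q} \<subseteq> set p" "h ` Inner 2 ` {1..<r} \<subseteq> set p'"
      using s1 s2 by (auto simp: hs simp del: One_nat_def)
    have im0: "h ` {Source, Sink} \<inter> (set p \<union> set p') = {}"
      using p(1) p'(1) by (auto simp: is_path_def hs)
    have un: "inj_on h (A \<union> B)" if "inj_on h A" "inj_on h B" "h ` A \<inter> h ` B = {}" for A B
      using that by (auto simp: inj_on_Un)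
    have "inj_on h ({Source, Sink} \<union> Inner 1 ` {1..<q})"
      using im im0 by (intro un i0 i) blast
    moreover have "h ` ({Source, Sink} \<union> Inner 1 ` {1..<q}) \<inter> h ` Inner 2 ` {1..<r} = {}"
      using im im0 d unfolding image_Un by blast
    ultimately have "inj_on h (({Source, Sink} \<union> Inner 1 ` {1..<q}) \<union> Inner 2 ` {1..<r})"
      by (rule un[OF _ i(2)])
    then have "inj_on h (verts (theta [1,q,r]))" using theta_verts[of q r] q r by simp
    moreover have 1: "map (\<lambda>j. h (theta_at [1,q,r] 1 j)) [0..<Suc q] = u # p @ [v]"
      using p(2) q by (subst theta_path_image) (auto simp: hs simp del: upt_Suc One_nat_def intro!: nth_equalityI)
    have 2: "map (\<lambda>j. h (theta_at [1,q,r] 2 j)) [0..<Suc r] = u # p' @ [v]"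
      using p'(2) r by (subst theta_path_image) (auto simp: hs simp del: upt_Suc One_nat_def intro!: nth_equalityI)
    have "{h (theta_at [1,q,r] 1 j), h (theta_at [1,q,r] 1 (Suc j))} \<in> edges G" if "j < q" for j
      using p(1) that unfolding 1[symmetric] is_path_def successively_conv_nth
      by (auto simp del: upt_Suc)
    moreover have "{h (theta_at [1,q,r] 2 j), h (theta_at [1,q,r] 2 (Suc j))} \<in> edges G" if "j < r" for j
      using p'(1) that unfolding 2[symmetric] is_path_def successively_conv_nth
      by (auto simp del: upt_Suc)
    moreover have "h Source = u" "h Sink = v" by (simp_all add: h_def)
    ultimately show ?L using uv unfolding theta_edges by (intro exI[of _ h]) (auto simp del: One_nat_def)
  qed
  then show ?thesis unfolding graph_free_def subgraph_iso_iff_hom[OF theta_simple[OF q r] G] by simp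
qed

section \<open>Paths between vertices with many common neighbours\<close>

definition linked :: "'a ugraph \<Rightarrow> nat \<Rightarrow> 'a \<Rightarrow> 'a \<Rightarrow> bool" where
  "linked G c x y \<longleftrightarrow> c \<le> card (nbr G x \<inter> nbr G y)"

text \<open>One parameter \<open>c\<close> bounds both the size of the set and the common
  neighbourhoods, so a new member and a new common neighbour can be chosen against the same avoided
  set.\<close>

definition linked_set :: "'a ugraph \<Rightarrow> nat \<Rightarrow> 'a set \<Rightarrow> bool" where
  "linked_set G c U \<longleftrightarrow> c \<le> card U \<and> (\<forall>x\<in>U. \<forall>y\<in>U. x \<noteq> y \<longrightarrow> linked G c x y)"

lemma pick_outside:
  assumes "c \<le> card S" "finite F" "card F < c"
  obtains x where "x \<in> S" "x \<notin> F"
proof -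
  have "\<not> S \<subseteq> F" using card_mono[of F S] assms by auto
  then show ?thesis using that by blast
qed

lemma even_ge_2E: "even (q::nat) \<Longrightarrow> q \<ge> 2 \<Longrightarrow> (\<And>j. q = 2 * j + 2 \<Longrightarrow> thesis) \<Longrightarrow> thesis"
  by (metis add.commute dvd_add_right_iff dvd_refl evenE le_Suc_ex)

lemma odd_ge_2E:
  assumes "odd (r::nat)" "r \<ge> 2"
  obtains j where "r = 2 * j + 1" "j \<ge> 1"
proof -
  from assms(1) obtain j where "r = 2 * j + 1" by (elim oddE)
  then show ?thesis using that[of j] assms(2) by simp
qed

text \<open>Each induction step walks two edges, through a fresh common neighbour \<open>a\<close>
  to a fresh \<open>u\<close> in \<open>U\<close>. Then \<open>x\<close> and \<open>a\<close> join
  the avoided set while \<open>4 * j\<close> drops by 4, so the bound on \<open>card F\<close>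
  survives. Asking only that the start be linked to \<open>U\<close> later admits vertices outside
  the core.\<close>

lemma even_path:
  assumes G: "simple_graph G" and U: "linked_set G c U"
  shows "j \<ge> 1 \<Longrightarrow> \<forall>u\<in>U. x \<noteq> u \<longrightarrow> linked G c x u \<Longrightarrow> x' \<in> U \<Longrightarrow> x \<noteq> x' \<Longrightarrow> finite F \<Longrightarrow> card F + 4 * j \<le> c
    \<Longrightarrow> \<exists>p. Suc (length p) = 2 * j \<and> is_path G (x # p @ [x']) \<and> set p \<inter> F = {}"
proof (induction j arbitrary: x F rule: nat_induct_at_least)
  case base
  have "c \<le> card (nbr G x \<inter> nbr G x')" using base by (auto simp: linked_def)
  then obtain a where a: "a \<in> nbr G x \<inter> nbr G x'" "a \<notin> F"
    by (rule pick_outside[of c _ F]) (use base in auto)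
  then have "is_path G (x # [a] @ [x'])"
    using base nbr_irrefl[OF G] by (auto simp: is_path_Cons nbr_def insert_commute)
  then show ?case using a by (intro exI[of _ "[a]"]) auto
next
  case (Suc j)
  have "c \<le> card U" using U by (simp add: linked_set_def)
  moreover have "card (F \<union> {x, x'}) < c"
    using Suc.prems card_Un_le[of F "{x,x'}"] card_insert_le_m1[of 2 "{x'}" x] by (simp add: card_insert_if split: if_splits)
  ultimately obtain u where u: "u \<in> U" "u \<notin> F \<union> {x, x'}"
    using pick_outside[of c U "F \<union> {x,x'}"] Suc.prems by blast
  then have "c \<le> card (nbr G x \<inter> nbr G u)" using Suc.prems by (auto simp: linked_def)
  moreover have "card (F \<union> {x, x', u}) < c"
    using Suc.prems card_Un_le[of F "{x,x',u}"] by (simp add: card_insert_if split: if_splits)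
  ultimately obtain a where a: "a \<in> nbr G x \<inter> nbr G u" "a \<notin> F \<union> {x, x', u}"
    using pick_outside[of c _ "F \<union> {x,x',u}"] Suc.prems by blast
  have "card (F \<union> {x, a}) + 4 * j \<le> c"
    using Suc.prems card_Un_le[of F "{x,a}"] by (simp add: card_insert_if split: if_splits)
  then obtain p where p: "Suc (length p) = 2 * j" "is_path G (u # p @ [x'])" "set p \<inter> (F \<union> {x, a}) = {}"
    using Suc.IH[of u "F \<union> {x, a}"] U u Suc.prems by (auto simp: linked_set_def)
  have "is_path G (x # (a # u # p) @ [x'])"
    using a u p Suc.prems nbr_irrefl[OF G] by (auto simp: is_path_Cons nbr_def insert_commute)
  then show ?case using p a u by (intro exI[of _ "a # u # p"]) auto
qed

text \<open>An even path leads to one of the many neighbours of \<open>y\<close> in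
  \<open>U\<close>; the last edge enters \<open>y\<close>.\<close>

lemma odd_path:
  assumes G: "simple_graph G" and U: "linked_set G c U" and j: "j \<ge> 1"
    and x: "\<forall>u\<in>U. x \<noteq> u \<longrightarrow> linked G c x u" and y: "c \<le> card (nbr G y \<inter> U)" and "x \<noteq> y"
    and F: "finite F" "card F + 4 * j + 4 \<le> c"
  shows "\<exists>p. length p = 2 * j \<and> is_path G (x # p @ [y]) \<and> set p \<inter> F = {}"
proof -
  have "card (F \<union> {x, y}) < c"
    using F card_Un_le[of F "{x,y}"] by (simp add: card_insert_if split: if_splits)
  then obtain u where u: "u \<in> nbr G y \<inter> U" "u \<notin> F \<union> {x, y}"
    using pick_outside[OF y, of "F \<union> {x,y}"] F by blast
  have "card (F \<union> {y}) + 4 * j \<le> c"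
    using F card_Un_le[of F "{y}"] by simp
  then obtain p where p: "Suc (length p) = 2 * j" "is_path G (x # p @ [u])" "set p \<inter> (F \<union> {y}) = {}"
    using even_path[OF G U j x, of u "F \<union> {y}"] u F by auto
  have "is_path G ((x # p @ [u]) @ [y])"
    using p u \<open>x \<noteq> y\<close> by (subst is_path_append) (auto simp: nbr_def insert_commute)
  then show ?thesis using p u by (intro exI[of _ "p @ [u]"]) auto
qed

text \<open>The case \<open>j = 0\<close> is a single vertex, which serves for an arc of length
  2.\<close>

lemma even_path_within:
  assumes G: "simple_graph G" and U: "linked_set G c U" and F: "finite F" "card F + 4 * j + 4 \<le> c"
  shows "\<exists>w. length w = Suc (2 * j) \<and> is_path G w \<and> set w \<inter> F = {} \<and> hd w \<in> U \<and> last w \<in> U"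
proof -
  have cU: "c \<le> card U" using U by (simp add: linked_set_def)
  obtain a where a: "a \<in> U" "a \<notin> F" using pick_outside[OF cU F(1)] F by auto
  show ?thesis
  proof (cases "j = 0")
    case True then show ?thesis using a by (intro exI[of _ "[a]"]) auto
  next
    case False
    have "card (insert a F) < c" using F by (simp add: card_insert_if)
    then obtain b where b: "b \<in> U" "b \<notin> insert a F" using pick_outside[OF cU, of "insert a F"] F by auto
    then obtain p where "Suc (length p) = 2 * j" "is_path G (a # p @ [b])" "set p \<inter> F = {}"
      using even_path[OF G U, of j a b F] U a F False by (auto simp: linked_set_def)
    then show ?thesis using a b by (intro exI[of _ "a # p @ [b]"]) auto
  qed
qed

text \<open>A path of length \<open>2 * j\<close> with both ends in \<open>U\<close>, extended to
  \<open>u\<close> and \<open>v\<close>, is an arc of length \<open>2 * j + 2\<close>. The second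
  arc is chosen to avoid the first.\<close>

lemma theta_of_edge_even:
  assumes G: "simple_graph G" and U: "linked_set G c U" "U \<subseteq> nbr G u \<inter> nbr G v"
    and c: "4 * (q + r) + 20 \<le> c" and q: "even q" "q \<ge> 2" and r: "even r" "r \<ge> 2"
    and uv: "{u, v} \<in> edges G"
  shows "has_theta G q r"
proof -
  from q obtain j where j: "q = 2 * j + 2" by (elim even_ge_2E)
  from r obtain k where k: "r = 2 * k + 2" by (elim even_ge_2E)
  have "card {u, v} \<le> 2" by (simp add: card_insert_if)
  then obtain p where p: "length p = Suc (2 * j)" "is_path G p" "set p \<inter> {u, v} = {}" "hd p \<in> U" "last p \<in> U"
    using even_path_within[OF G U(1), of "{u,v}" j] c j by auto
  have "card ({u, v} \<union> set p) \<le> 2 + q"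
    using card_Un_le[of "{u,v}" "set p"] card_length[of p] p(1) j \<open>card {u, v} \<le> 2\<close> by linarith
  then obtain p' where p': "length p' = Suc (2 * k)" "is_path G p'" "set p' \<inter> ({u, v} \<union> set p) = {}" "hd p' \<in> U" "last p' \<in> U"
    using even_path_within[OF G U(1), of "{u,v} \<union> set p" k] c k by auto
  have "is_path G (u # w @ [v])" if w: "length w = Suc i" "is_path G w" "set w \<inter> {u, v} = {}" "hd w \<in> U" "last w \<in> U" for w i
  proof -
    have "w \<noteq> []" using w by auto
    moreover have "{u, hd w} \<in> edges G" "{last w, v} \<in> edges G" using w U(2) by (auto simp: nbr_def insert_commute)
    ultimately show ?thesis using w simple_edge(3)[OF G uv]
      by (auto simp: is_path_Cons_hd is_path_append)
  qed
  from this[OF p] this[of p' "2 * k"] p' have "is_path G (u # p @ [v])" "is_path G (u # p' @ [v])" by auto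
  then show ?thesis unfolding has_theta_def using uv p p' j k by (intro exI[of _ u] exI[of _ v] exI[of _ p] exI[of _ p']) auto
qed

text \<open>The chord is \<open>{u, a}\<close> with \<open>a \<in> U\<close>; the path \<open>u w v\<close> is the beginning of the path of length \<open>q\<close>.\<close>
lemma theta_of_path_odd:
  assumes G: "simple_graph G" and U: "linked_set G c U" "U \<subseteq> nbr G u \<inter> nbr G v"
    and c: "4 * (q + r) + 20 \<le> c" and q: "even q" and r: "odd r" "r \<ge> 2"
    and w: "is_path G (u # w @ [v])" "even (length w)" "length w + 2 \<le> q"
  shows "has_theta G q r"
proof -
  have cU: "c \<le> card U" using U by (simp add: linked_set_def)
  have lU: "\<forall>u\<in>U. a \<noteq> u \<longrightarrow> linked G c a u" if "a \<in> U" for a using U that by (auto simp: linked_set_def)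
  have uU: "u \<notin> U" "v \<notin> U" using U nbr_irrefl[OF G] by auto
  from r obtain j where j: "r = 2 * j + 1" "j \<ge> 1" by (elim odd_ge_2E)
  define F where "F = {u, v} \<union> set w"
  have F: "finite F" "card F \<le> q"
    using card_Un_le[of "{u,v}" "set w"] card_length[of w] w(3) by (auto simp: F_def card_insert_if split: if_splits)
  obtain a where a: "a \<in> U" "a \<notin> F" using pick_outside[OF cU F(1)] F c by auto
  have "card (insert a F) < c" using F c by (simp add: card_insert_if)
  then obtain b where b: "b \<in> U" "b \<notin> insert a F" using pick_outside[OF cU, of "insert a F"] F by auto
  obtain p where p: "Suc (length p) = 2 * j" "is_path G (b # p @ [a])" "set p \<inter> F = {}"
    using even_path[OF G U(1) j(2) lU[OF b(1)] a(1), of F] F b c j by auto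
  have pu: "is_path G (u # (b # p) @ [a])"
    using p b a uU U w(1) by (auto simp: is_path_Cons F_def nbr_def)
  have ua: "{u, a} \<in> edges G" using a U by (auto simp: nbr_def)
  have uwv: "is_path G ((u # w @ [v]) @ x)" if "is_path G x" "x \<noteq> []" "set x \<inter> F = {}" "hd x \<in> U" for x
    using that w(1) U by (subst is_path_append) (auto simp: F_def nbr_def)
  show ?thesis
  \<comment> \<open>The path \<open>u w v\<close> has odd length at most \<open>q - 1\<close>.
    Either one edge from \<open>v\<close> to \<open>a\<close> completes the arc, or it enters
    \<open>U\<close> at a new vertex \<open>d\<close> and continues to \<open>a\<close> by an even
    path.\<close>
  proof (cases "length w + 2 = q")
    case True
    have "is_path G (u # (w @ [v]) @ [a])" using uwv[of "[a]"] a by simp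
    then show ?thesis unfolding has_theta_def using pu ua p b j True
      by (intro exI[of _ u] exI[of _ a] exI[of _ "w @ [v]"] exI[of _ "b # p"]) (auto simp: F_def)
  next
    case False
    moreover have "even (q - (length w + 2))" using q w by simp
    then obtain k where "q - (length w + 2) = 2 * k" by (elim evenE)
    ultimately have k: "q = length w + 2 + 2 * k" "k \<ge> 1" using w(3) by auto
    define F' where "F' = F \<union> set (a # b # p)"
    have "card (set (a # b # p)) \<le> r + 2" using card_length[of "a # b # p"] p j by simp
    then have F': "finite F'" "card F' \<le> q + r + 2"
      using card_Un_le[of F "set (a # b # p)"] F by (auto simp: F'_def)
    obtain d where d: "d \<in> U" "d \<notin> F'" using pick_outside[OF cU F'(1)] F' c by auto
    obtain p' where p': "Suc (length p') = 2 * k" "is_path G (d # p' @ [a])" "set p' \<inter> F' = {}"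
      using even_path[OF G U(1) k(2) lU[OF d(1)] a(1), of F'] F' d c k by (auto simp: F'_def)
    have "is_path G (u # (w @ v # d # p') @ [a])" using uwv[of "d # p' @ [a]"] p' d a by (auto simp: F'_def)
    then show ?thesis unfolding has_theta_def using pu ua p b j k p' d
      by (intro exI[of _ u] exI[of _ a] exI[of _ "w @ v # d # p'"] exI[of _ "b # p"]) (auto simp: F_def F'_def)
  qed
qed

lemma theta_of_edge:
  assumes "simple_graph G" "linked_set G c U" "U \<subseteq> nbr G u \<inter> nbr G v"
    "4 * (q + r) + 20 \<le> c" "even q" "q \<ge> 2" "r \<ge> 2" "{u, v} \<in> edges G"
  shows "has_theta G q r"
proof (cases "even r")
  case True then show ?thesis using theta_of_edge_even assms by metis
next
  case False
  have "is_path G (u # [] @ [v])" using assms simple_edge(3) by (fastforce simp: is_path_Cons)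
  then show ?thesis using theta_of_path_odd[OF assms(1-5) False, where w = "[]"] assms by simp
qed

text \<open>The chord is \<open>{z, x}\<close>. The arcs leave \<open>z\<close> through
  \<open>y\<close> and \<open>y'\<close> and reach \<open>x\<close> by odd paths. The first may have
  length 2 because \<open>y\<close> is adjacent to \<open>x\<close>; nothing of the kind is known
  for \<open>y'\<close>, hence \<open>r \<ge> 4\<close>.\<close>

lemma theta_of_triangle_even:
  assumes G: "simple_graph G" and U: "linked_set G c U" and x: "\<forall>u\<in>U. x \<noteq> u \<longrightarrow> linked G c x u"
    and y: "c \<le> card (nbr G y \<inter> U)" and y': "c \<le> card (nbr G y' \<inter> U)"
    and c: "4 * (q + r) + 20 \<le> c" and q: "even q" "q \<ge> 2" and r: "even r" "r \<ge> 4"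
    and e: "{z, x} \<in> edges G" "{z, y} \<in> edges G" "{z, y'} \<in> edges G" "{x, y} \<in> edges G" and "y \<noteq> y'" "x \<noteq> y'"
  shows "has_theta G q r"
proof -
  have ne: "z \<noteq> x" "z \<noteq> y" "z \<noteq> y'" "x \<noteq> y" using e simple_edge(3)[OF G] by auto
  have odd: "\<exists>p. length p = 2 * j \<and> is_path G (z # t # p @ [x]) \<and> set p \<inter> F = {}"
    if "j \<ge> 1" "c \<le> card (nbr G t \<inter> U)" "x \<noteq> t" "{z, t} \<in> edges G" "finite F" "card F + 4 * j + 5 \<le> c" for t j F
  proof -
    note prems = that
    have "card (insert z F) + 4 * j + 4 \<le> c" using that by (simp add: card_insert_if)
    then obtain p where p: "length p = 2 * j" "is_path G (x # p @ [t])" "set p \<inter> insert z F = {}"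
      using odd_path[OF G U prems(1) x prems(2,3), of "insert z F"] prems(5) by auto
    have "is_path G (t # rev p @ [x])" using is_path_rev[of G "x # p @ [t]"] p by simp
    then have "is_path G (z # t # rev p @ [x])"
      using p prems(4) ne simple_edge(3)[OF G prems(4)] by (auto simp: is_path_Cons)
    then show ?thesis using p by (intro exI[of _ "rev p"]) auto
  qed
  obtain p where p: "length p + 2 = q" "is_path G (z # y # p @ [x])" "set p \<inter> {y'} = {}"
  proof (cases "q = 2")
    case True
    have "is_path G (z # y # [] @ [x])" using e ne by (auto simp: is_path_Cons insert_commute)
    then show ?thesis using that[of "[]"] True by simp
  next
    case False
    moreover obtain j where "q = 2 * j + 2" using q by (elim even_ge_2E)
    ultimately have "q = 2 * j + 2" "j \<ge> 1" by auto
    then show ?thesis using odd[of j y "{y'}"] y ne e c that by auto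
  qed
  have "r \<ge> 2" using r by simp
  then obtain j where "r = 2 * j + 2" using r(1) by (elim even_ge_2E)
  then have j: "r = 2 * j + 2" "j \<ge> 1" using r by auto
  have "card (insert y (set p)) \<le> q" using card_length[of "y # p"] p by simp
  then obtain p' where p': "length p' = 2 * j" "is_path G (z # y' # p' @ [x])" "set p' \<inter> insert y (set p) = {}"
    using odd[of j y' "insert y (set p)"] j y' e c \<open>x \<noteq> y'\<close> by auto
  show ?thesis unfolding has_theta_def
    using e p p' j \<open>y \<noteq> y'\<close> by (intro exI[of _ z] exI[of _ x] exI[of _ "y # p"] exI[of _ "y' # p'"]) auto
qed

text \<open>The chord is \<open>{x, y}\<close>: \<open>z\<close> provides the arc of length 2, an
  odd path through the linked set the other one.\<close>

lemma theta_of_triangle_odd: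
  assumes G: "simple_graph G" and U: "linked_set G c U" and x: "\<forall>u\<in>U. x \<noteq> u \<longrightarrow> linked G c x u"
    and y: "c \<le> card (nbr G y \<inter> U)"
    and c: "4 * r + 20 \<le> c" and r: "odd r" "r \<ge> 2"
    and e: "{z, x} \<in> edges G" "{z, y} \<in> edges G" "{x, y} \<in> edges G"
  shows "has_theta G 2 r"
proof -
  have ne: "z \<noteq> x" "z \<noteq> y" "x \<noteq> y" using e simple_edge(3)[OF G] by auto
  from r obtain j where j: "r = 2 * j + 1" "j \<ge> 1" by (elim odd_ge_2E)
  obtain p where p: "length p = 2 * j" "is_path G (x # p @ [y])" "set p \<inter> {z} = {}"
    using odd_path[OF G U j(2) x y ne(3), of "{z}"] c j by fastforce
  have "is_path G (x # [z] @ [y])" using e ne by (auto simp: is_path_Cons insert_commute)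
  then show ?thesis unfolding has_theta_def using p j e
    by (intro exI[of _ x] exI[of _ y] exI[of _ "[z]"] exI[of _ p]) auto
qed

section \<open>Deleting vertices and counting edges\<close>

definition del :: "'a ugraph \<Rightarrow> 'a set \<Rightarrow> 'a ugraph" where
  "del G R = \<lparr>verts = verts G - R, edges = {e \<in> edges G. e \<inter> R = {}}\<rparr>"

lemma verts_del [simp]: "verts (del G R) = verts G - R"
  by (simp add: del_def)

lemma simple_del: "simple_graph G \<Longrightarrow> simple_graph (del G R)"
proof (unfold simple_graph_def, intro conjI subsetI)
  assume G: "finite (verts G) \<and> edges G \<subseteq> {{u, v} |u v. u \<in> verts G \<and> v \<in> verts G \<and> u \<noteq> v}"
  show "finite (verts (del G R))" using G by simp
  fix e assume e: "e \<in> edges (del G R)"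
  then obtain u v where "e = {u, v}" "u \<in> verts G" "v \<in> verts G" "u \<noteq> v" using G by (auto simp: del_def)
  then show "e \<in> {{u, v} |u v. u \<in> verts (del G R) \<and> v \<in> verts (del G R) \<and> u \<noteq> v}"
    using e by (auto simp: del_def)
qed

lemma nbr_del: "v \<notin> R \<Longrightarrow> nbr (del G R) v = nbr G v - R"
  by (auto simp: nbr_def del_def)

lemma del_del: "del (del G R) S = del G (R \<union> S)"
  by (auto simp: del_def)

lemma del_empty [simp]: "del G {} = G"
  by (simp add: del_def)

lemma edges_del_subset: "edges (del G R) \<subseteq> edges G"
  by (auto simp: del_def)

lemma is_path_mono: "edges G \<subseteq> edges H \<Longrightarrow> is_path G p \<Longrightarrow> is_path H p"
  unfolding is_path_def by (auto elim!: successively_mono)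

lemma has_theta_mono:
  assumes "edges G \<subseteq> edges H" "has_theta G q r"
  shows "has_theta H q r"
proof -
  obtain u v p p' where "{u, v} \<in> edges G" "is_path G (u # p @ [v])" "is_path G (u # p' @ [v])"
    "Suc (length p) = q" "Suc (length p') = r" "set p \<inter> set p' = {}"
    using assms(2) unfolding has_theta_def by blast
  moreover from this have "is_path H (u # p @ [v])" "is_path H (u # p' @ [v])"
    using is_path_mono[OF assms(1)] by blast+
  ultimately show ?thesis unfolding has_theta_def using assms(1) by blast
qed

lemma card_edges_del_vertex:
  assumes G: "simple_graph G"
  shows "esize G = esize (del G {v}) + deg G v"
proof -
  have "edges G = edges (del G {v}) \<union> (\<lambda>u. {v, u}) ` nbr G v"
  proof
    show "edges G \<subseteq> edges (del G {v}) \<union> (\<lambda>u. {v, u}) ` nbr G v"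
    proof
      fix e assume e: "e \<in> edges G"
      then obtain x y where "e = {x, y}" using simple_edgeE[OF G] by metis
      then show "e \<in> edges (del G {v}) \<union> (\<lambda>u. {v, u}) ` nbr G v"
        using e by (auto simp: del_def nbr_def insert_commute image_iff)
    qed
  qed (auto simp: del_def nbr_def)
  moreover have "edges (del G {v}) \<inter> (\<lambda>u. {v, u}) ` nbr G v = {}"
    by (auto simp: del_def)
  moreover have "card ((\<lambda>u. {v, u}) ` nbr G v) = deg G v"
    by (rule card_image) (auto simp: inj_on_def doubleton_eq_iff)
  ultimately show ?thesis
    using card_Un_disjoint[of "edges (del G {v})" "(\<lambda>u. {v, u}) ` nbr G v"]
      finite_edges[OF simple_del[OF G]] finite_nbr[OF G] by simp
qed

lemma card_nbr_del_le: "simple_graph G \<Longrightarrow> deg (del G R) v \<le> deg G v"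
  by (rule card_mono[OF finite_nbr]) (auto simp: nbr_def del_def)

lemma card_edges_del_le:
  assumes "simple_graph G" "finite R"
  shows "esize G \<le> esize (del G R) + (\<Sum>v\<in>R. deg G v)"
  using assms(2)
proof (induction R)
  case (insert v R)
  have "esize (del G R) = card (edges (del G (insert v R))) + deg (del G R) v"
    using card_edges_del_vertex[OF simple_del[OF assms(1)], of R v] by (simp add: del_del)
  then show ?case using insert card_nbr_del_le[OF assms(1), of R v] by simp
qed simp

text \<open>Unlike \<open>bipartite\<close>, this names the two parts and speaks of neighbourhoods,
  the form in which parts are modified and counted below.\<close>

definition parts :: "'a ugraph \<Rightarrow> 'a set \<Rightarrow> 'a set \<Rightarrow> bool" where
  "parts G A B \<longleftrightarrow> A \<union> B = verts G \<and> A \<inter> B = {} \<and> (\<forall>v\<in>A. nbr G v \<inter> A = {}) \<and> (\<forall>v\<in>B. nbr G v \<inter> B = {})"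

lemma parts_edge:
  assumes G: "simple_graph G" and AB: "parts G A B" and e: "{u, v} \<in> edges G"
  shows "u \<in> A \<and> v \<in> B \<or> u \<in> B \<and> v \<in> A"
proof -
  have "u \<in> A \<union> B" "v \<in> A \<union> B" using AB simple_edge[OF G e] by (auto simp: parts_def)
  moreover have "v \<in> nbr G u" using e by (simp add: nbr_def)
  then have "\<not> (u \<in> A \<and> v \<in> A)" "\<not> (u \<in> B \<and> v \<in> B)" using AB by (auto simp: parts_def)
  ultimately show ?thesis by blast
qed

lemma bipartite_iff_parts:
  assumes G: "simple_graph G"
  shows "bipartite G \<longleftrightarrow> (\<exists>A B. parts G A B)"
proof
  assume "bipartite G"
  then obtain A B where AB: "A \<union> B = verts G" "A \<inter> B = {}" and e: "\<And>e. e \<in> edges G \<Longrightarrow> \<exists>a\<in>A. \<exists>b\<in>B. e = {a, b}"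
    unfolding bipartite_def by metis
  have "u \<in> A \<longleftrightarrow> v \<notin> A" if "{u, v} \<in> edges G" for u v
    using e[OF that] AB by (auto simp: doubleton_eq_iff)
  then have "v \<in> A \<Longrightarrow> nbr G v \<inter> A = {}" "v \<in> B \<Longrightarrow> nbr G v \<inter> B = {}" for v
    using AB by (auto simp: nbr_def)
  then have "parts G A B" using AB by (auto simp: parts_def)
  then show "\<exists>A B. parts G A B" by blast
next
  assume "\<exists>A B. parts G A B"
  then obtain A B where AB: "parts G A B" by blast
  have "\<exists>a\<in>A. \<exists>b\<in>B. e = {a, b}" if e: "e \<in> edges G" for e
  proof -
    obtain u v where uv: "e = {u, v}" "u \<in> verts G" "v \<in> verts G" using simple_edgeE[OF G e] by metis
    then have "u \<in> A \<and> v \<in> B \<or> u \<in> B \<and> v \<in> A" using parts_edge[OF G AB] e by blast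
    then show ?thesis using uv by (auto simp: insert_commute)
  qed
  then show "bipartite G" using AB unfolding bipartite_def parts_def by blast
qed

lemma parts_sym: "parts G A B \<longleftrightarrow> parts G B A"
  by (auto simp: parts_def)

lemma card_edges_parts:
  assumes G: "simple_graph G" and AB: "parts G A B"
  shows "esize G = card {(a, b). a \<in> A \<and> b \<in> B \<and> {a, b} \<in> edges G}" (is "_ = card ?E")
proof -
  have "bij_betw (\<lambda>(a, b). {a, b}) ?E (edges G)"
    unfolding bij_betw_def
  proof
    show "inj_on (\<lambda>(a, b). {a, b}) ?E" using AB by (auto simp: inj_on_def doubleton_eq_iff parts_def)
    have "e \<in> (\<lambda>(a, b). {a, b}) ` ?E" if e: "e \<in> edges G" for e
    proof -
      obtain u v where uv: "e = {u, v}" "u \<in> verts G" "v \<in> verts G" using simple_edgeE[OF G e] by metis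
      then have "u \<in> A \<and> v \<in> B \<or> u \<in> B \<and> v \<in> A" using parts_edge[OF G AB] e by blast
      then obtain a b where "a \<in> A" "b \<in> B" "e = {a, b}" using uv by (auto simp: insert_commute)
      then have "(a, b) \<in> ?E" "e = (\<lambda>(a, b). {a, b}) (a, b)" using e by auto
      then show ?thesis by (rule rev_image_eqI)
    qed
    then show "(\<lambda>(a, b). {a, b}) ` ?E = edges G" by auto
  qed
  from bij_betw_same_card[OF this] show ?thesis by simp
qed

lemma four_mult_le: "4 * (a * b) \<le> (a + b) * (a + b)" for a b :: nat
proof -
  have "0 \<le> (int a - int b) * (int a - int b)" by simp
  then have "4 * (int a * int b) \<le> (int a + int b) * (int a + int b)" by (simp add: algebra_simps)
  then show ?thesis by (metis (mono_tags, lifting) of_nat_add of_nat_le_iff of_nat_mult of_nat_numeral)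
qed

lemma parts_finite: "simple_graph G \<Longrightarrow> parts G A B \<Longrightarrow> finite A \<and> finite B"
  using simple_finite[of G] finite_Un[of A B] by (simp add: parts_def)

lemma parts_card: "simple_graph G \<Longrightarrow> parts G A B \<Longrightarrow> order G = card A + card B"
  using parts_finite[of G A B] card_Un_disjoint[of A B] by (simp add: parts_def)

lemma card_edges_parts_le:
  assumes "simple_graph G" "parts G A B"
  shows "esize G \<le> card A * card B"
proof -
  have "card {(a, b). a \<in> A \<and> b \<in> B \<and> {a, b} \<in> edges G} \<le> card (A \<times> B)"
    by (rule card_mono) (use parts_finite[OF assms] in auto)
  then show ?thesis using card_edges_parts[OF assms] by (simp add: card_cartesian_product)
qed

lemma bipartite_card_edges:
  assumes "simple_graph G" "bipartite G"
  shows "4 * esize G \<le> order G * order G"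
proof -
  obtain A B where AB: "parts G A B" using assms bipartite_iff_parts by blast
  show ?thesis
    using card_edges_parts_le[OF assms(1) AB] four_mult_le[of "card A" "card B"] parts_card[OF assms(1) AB]
    by simp
qed

lemma edges_eq_of_card:
  assumes G: "simple_graph G" and AB: "parts G A B" and c: "card A * card B \<le> esize G" and ab: "a \<in> A" "b \<in> B"
  shows "{a, b} \<in> edges G"
proof -
  have "{(a, b). a \<in> A \<and> b \<in> B \<and> {a, b} \<in> edges G} = A \<times> B"
    by (rule card_seteq) (use parts_finite[OF G AB] c card_edges_parts[OF G AB] in \<open>auto simp: card_cartesian_product\<close>)
  then show ?thesis using ab by blast
qed

text \<open>Inclusion-exclusion without the term for the triple intersection.\<close>

lemma card_three_sets:
  assumes "finite V" "A \<subseteq> V" "B \<subseteq> V" "C \<subseteq> V"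
  shows "card A + card B + card C \<le> card V + card (A \<inter> B) + card (A \<inter> C) + card (B \<inter> C)"
proof -
  have fin: "finite A" "finite B" "finite C" using finite_subset[OF _ assms(1)] assms by auto
  have "card A + card B = card (A \<union> B) + card (A \<inter> B)" by (rule card_Un_Int[OF fin(1,2)])
  moreover have "card (A \<union> B) + card C = card (A \<union> B \<union> C) + card ((A \<union> B) \<inter> C)"
    by (rule card_Un_Int) (use fin in auto)
  moreover have "card (A \<union> B \<union> C) \<le> card V" using assms by (intro card_mono) auto
  moreover have "card ((A \<union> B) \<inter> C) \<le> card (A \<inter> C) + card (B \<inter> C)" by (metis Int_Un_distrib2 card_Un_le)
  ultimately show ?thesis by linarith
qed

section \<open>Large minimum degree forces bipartiteness\<close>

text \<open>The fraction \<open>12/25\<close> is a convenient constant below \<open>1/2\<close>.\<close>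
lemma min_degree_bipartite:
  assumes q: "even q" "q \<ge> 2" and r: "r \<ge> 2"
  shows "\<exists>N. \<forall>G :: 'a ugraph. simple_graph G \<and> \<not> has_theta G q r \<and> N \<le> order G \<and>
           (\<forall>v\<in>verts G. 12 * order G \<le> 25 * deg G v) \<longrightarrow> bipartite G"
proof -
  \<comment> \<open>\<open>c\<close> pays for the vertices already used by the two arcs and for the
    \<open>4 * j\<close> demanded by \<open>even_path\<close>; the 20 is slack.\<close>
  define c where "c = 4 * (q + r) + 20"
  \<comment> \<open>Pairs are coloured by being linked: a clique of size \<open>c\<close> is a
    linked set, and an independent triple contradicts \<open>three\<close>.\<close>
  obtain R where R: "\<forall>(V::'a set) E. finite V \<and> R \<le> card V \<longrightarrow>
      (\<exists>S\<subseteq>V. card S = c \<and> clique S E \<or> card S = 3 \<and> indep S E)"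
    using ramsey2[where 'a = 'a, of c 3] by metis
  define t where "t = c + R"
  have "bipartite G" if G: "simple_graph G" and free: "\<not> has_theta G q r" and n: "7 * t + 1 \<le> order G"
    and deg: "\<And>v. v \<in> verts G \<Longrightarrow> 12 * order G \<le> 25 * deg G v" for G :: "'a ugraph"
  proof -
    \<comment> \<open>Three degrees sum to at least \<open>36 n / 25\<close>. If all three
      intersections were below \<open>t\<close>, then \<open>11 n / 25 < 3 t\<close>, impossible for
      \<open>n > 7 t\<close> because \<open>75 / 11 < 7\<close>.\<close>
    have three: "t \<le> card (nbr G x \<inter> nbr G y) \<or> t \<le> card (nbr G x \<inter> nbr G z) \<or> t \<le> card (nbr G y \<inter> nbr G z)"
      if "x \<in> verts G" "y \<in> verts G" "z \<in> verts G" for x y z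
    proof (rule ccontr)
      assume "\<not> ?thesis"
      then have "card (nbr G x \<inter> nbr G y) < t" "card (nbr G x \<inter> nbr G z) < t" "card (nbr G y \<inter> nbr G z) < t"
        by simp_all
      then show False
        using card_three_sets[OF simple_finite[OF G] nbr_subset[OF G] nbr_subset[OF G] nbr_subset[OF G], of x y z]
          deg[OF that(1)] deg[OF that(2)] deg[OF that(3)] n by linarith
    qed
    have adj: "card (nbr G u \<inter> nbr G v) < R" if uv: "{u, v} \<in> edges G" for u v
    proof (rule ccontr)
      assume "\<not> card (nbr G u \<inter> nbr G v) < R"
      then have "R \<le> card (nbr G u \<inter> nbr G v)" by simp
      define E where "E = {{a, b} |a b. linked G c a b}"
      have E: "{a, b} \<in> E \<longleftrightarrow> linked G c a b" for a b
        by (auto simp: E_def doubleton_eq_iff linked_def Int_commute)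
      obtain S where S: "S \<subseteq> nbr G u \<inter> nbr G v"
        "card S = c \<and> clique S E \<or> card S = 3 \<and> indep S E"
        using R[rule_format, of "nbr G u \<inter> nbr G v" E] finite_nbr[OF G] \<open>R \<le> _\<close> by auto
      have "\<not> (card S = 3 \<and> indep S E)"
      proof
        assume i: "card S = 3 \<and> indep S E"
        then obtain x y z where xyz: "S = {x, y, z}" "x \<noteq> y" "x \<noteq> z" "y \<noteq> z"
          by (auto simp: card_3_iff)
        then have "\<not> linked G c x y" "\<not> linked G c x z" "\<not> linked G c y z"
          using i by (auto simp: indep_def E)
        then show False using three[of x y z] xyz S(1) nbr_subset[OF G, of u] by (auto simp: linked_def t_def)
      qed
      then have "card S = c" "clique S E" using S by auto
      then have "linked_set G c S" by (auto simp: linked_set_def clique_def E)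
      then show False using theta_of_edge[OF G _ S(1) _ q r uv, of c] free by (simp add: c_def)
    qed
    \<comment> \<open>In a triangle, \<open>three\<close> would give two adjacent vertices with at
      least \<open>t \<ge> R\<close> common neighbours, against \<open>adj\<close>.\<close>
    have tri: "nbr G u \<inter> nbr G v = {}" if uv: "{u, v} \<in> edges G" for u v
    proof (rule ccontr)
      assume "nbr G u \<inter> nbr G v \<noteq> {}"
      then obtain w where "{u, w} \<in> edges G" "{v, w} \<in> edges G" by (auto simp: nbr_def)
      then show False using three[of u v w] adj[of u v] adj[of u w] adj[of v w] uv simple_edge[OF G]
        by (fastforce simp: t_def)
    qed
    have "verts G \<noteq> {}" using n by auto
    then obtain u where u: "u \<in> verts G" by blast
    then have "deg G u > 0" using deg[OF u] n by (intro gr0I) auto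
    then obtain v where v: "v \<in> nbr G u" by (auto simp: card_gt_0_iff)
    have uv: "{u, v} \<in> edges G" using v by (simp add: nbr_def)
    then have vv: "v \<in> verts G" using simple_edge[OF G] by blast
    have disj: "False" if "x \<in> verts G" "y \<in> verts G" "z \<in> verts G"
       "nbr G x \<inter> nbr G y = {}" "nbr G x \<inter> nbr G z = {}" "nbr G y \<inter> nbr G z = {}" for x y z
      using three[OF that(1-3)] that(4-6) n by (auto simp: t_def c_def)
    \<comment> \<open>Otherwise \<open>u a w b v\<close> is a five-cycle. Without triangles every
      vertex has at most two neighbours on it, so its degrees sum to at most \<open>2 n\<close>; but
      five times \<open>12/25\<close> is \<open>12/5\<close>.\<close>
    have one: "nbr G w \<inter> nbr G v = {}" if w: "nbr G w \<inter> nbr G u \<noteq> {}" for w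
    proof (rule ccontr)
      assume "nbr G w \<inter> nbr G v \<noteq> {}"
      then obtain a b where ab: "{w, a} \<in> edges G" "{u, a} \<in> edges G" "{w, b} \<in> edges G" "{v, b} \<in> edges G"
        using w by (auto simp: nbr_def)
      have V: "w \<in> verts G" "a \<in> verts G" "b \<in> verts G" using ab simple_edge[OF G] by auto
      have d: "nbr G w \<inter> nbr G a = {}" "nbr G u \<inter> nbr G a = {}" "nbr G w \<inter> nbr G b = {}" "nbr G v \<inter> nbr G b = {}" "nbr G u \<inter> nbr G v = {}"
        using tri ab uv by auto
      have e: "(nbr G a \<inter> nbr G b) \<inter> nbr G u = {}" "(nbr G a \<inter> nbr G b) \<inter> nbr G v = {}"
        using d by blast+
      have "card (nbr G a \<inter> nbr G b) + deg G u + deg G v \<le> order G"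
        using card_three_sets[OF simple_finite[OF G], of "nbr G a \<inter> nbr G b" "nbr G u" "nbr G v"] nbr_subset[OF G] e d(5)
        by (simp add: le_infI1)
      moreover have "deg G w + deg G a + deg G b \<le> order G + card (nbr G a \<inter> nbr G b)"
        using card_three_sets[OF simple_finite[OF G], of "nbr G w" "nbr G a" "nbr G b"] d nbr_subset[OF G] by simp
      ultimately show False
        using deg[OF u] deg[OF vv] deg[OF V(1)] deg[OF V(2)] deg[OF V(3)] n by linarith
    qed
    \<comment> \<open>By \<open>one\<close>, a vertex sharing a neighbour with \<open>u\<close>
      shares none with \<open>v\<close>. Two adjacent vertices in one part would thus form, with
      \<open>u\<close> or with \<open>v\<close>, three pairwise disjoint neighbourhoods, against
      \<open>disj\<close>.\<close>
    have "parts G {w \<in> verts G. nbr G w \<inter> nbr G u = {}} {w \<in> verts G. nbr G w \<inter> nbr G u \<noteq> {}}"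
      unfolding parts_def
    proof (intro conjI ballI)
      fix w assume w: "w \<in> {w \<in> verts G. nbr G w \<inter> nbr G u = {}}"
      show "nbr G w \<inter> {w \<in> verts G. nbr G w \<inter> nbr G u = {}} = {}"
      proof -
        have False if "x \<in> nbr G w" "x \<in> verts G" "nbr G x \<inter> nbr G u = {}" for x
          using disj[of w x u] tri[of w x] that w u by (auto simp: nbr_iff)
        then show ?thesis by blast
      qed
    next
      fix w assume w: "w \<in> {w \<in> verts G. nbr G w \<inter> nbr G u \<noteq> {}}"
      show "nbr G w \<inter> {w \<in> verts G. nbr G w \<inter> nbr G u \<noteq> {}} = {}"
      proof -
        have False if "x \<in> nbr G w" "x \<in> verts G" "nbr G x \<inter> nbr G u \<noteq> {}" for x
          using disj[of w x v] tri[of w x] that w vv one[of w] one[of x] by (auto simp: nbr_iff)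
        then show ?thesis by blast
      qed
    qed auto
    then show ?thesis using bipartite_iff_parts[OF G] by blast
  qed
  then show ?thesis by (intro exI[of _ "7 * t + 1"]) blast
qed

section \<open>Extremal number and stability\<close>

lemma card_edges_le_square:
  assumes G: "simple_graph G"
  shows "esize G \<le> order G * order G"
proof -
  have "edges (del G (verts G)) = {}" using simple_del[OF G, of "verts G"] by (auto simp: simple_graph_def)
  then have "esize G \<le> (\<Sum>v\<in>verts G. deg G v)"
    using card_edges_del_le[OF G simple_finite[OF G]] by simp
  also have "\<dots> \<le> (\<Sum>v\<in>verts G. order G)"
    by (intro sum_mono card_mono simple_finite nbr_subset G)
  finally show ?thesis by simp
qed

lemma card_del_vertex: "simple_graph G \<Longrightarrow> v \<in> verts G \<Longrightarrow> Suc (order (del G {v})) = order G"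
  using card_Suc_Diff1[OF simple_finite, of G v] by simp

lemma del_free: "\<not> has_theta G q r \<Longrightarrow> \<not> has_theta (del G R) q r"
  using has_theta_mono[OF edges_del_subset] by blast

definition dense_bipartite :: "'a ugraph \<Rightarrow> bool" where
  "dense_bipartite G \<longleftrightarrow> bipartite G \<and> (\<forall>v\<in>verts G. 12 * order G \<le> 25 * deg G v)"

lemma dense_bipartite_or_low_degree:
  assumes "even q" "q \<ge> 2" "r \<ge> 2"
  shows "\<exists>N. \<forall>G :: 'a ugraph. simple_graph G \<and> \<not> has_theta G q r \<and> N \<le> order G \<longrightarrow>
     dense_bipartite G \<or> (\<exists>v\<in>verts G. 25 * deg G v < 12 * order G)"
proof -
  obtain N where N: "\<And>G :: 'a ugraph. simple_graph G \<Longrightarrow> \<not> has_theta G q r \<Longrightarrow> N \<le> order G \<Longrightarrow>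
      \<forall>v\<in>verts G. 12 * order G \<le> 25 * deg G v \<Longrightarrow> bipartite G"
    using min_degree_bipartite[OF assms, where 'a = 'a] by auto
  show ?thesis
  proof (intro exI[of _ N] allI impI, elim conjE)
    fix G :: "'a ugraph"
    assume G: "simple_graph G" "\<not> has_theta G q r" "N \<le> order G"
    show "dense_bipartite G \<or> (\<exists>v\<in>verts G. 25 * deg G v < 12 * order G)"
    proof (cases "\<forall>v\<in>verts G. 12 * order G \<le> 25 * deg G v")
      case True
      then show ?thesis using N[OF G] by (simp add: dense_bipartite_def)
    next
      case False
      then show ?thesis by (auto simp: not_le)
    qed
  qed
qed

text \<open>A dense bipartite graph satisfies the bound directly. Otherwise deleting a vertex of
  degree below \<open>12 n / 25\<close> lowers \<open>4 * esize G\<close> by less than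
  \<open>n^2\<close> drops, so any excess dies out as the order grows. The condition with
  \<open>+ 1\<close> says that the floor of \<open>n^2/4\<close> is attained.\<close>

lemma extremal_number:
  assumes q: "even q" "q \<ge> 2" and r: "r \<ge> 2"
  shows "\<exists>N. \<forall>G :: 'a ugraph. simple_graph G \<and> \<not> has_theta G q r \<and> N \<le> order G \<longrightarrow>
      4 * esize G \<le> order G * order G \<and>
      (order G * order G \<le> 4 * esize G + 1 \<longrightarrow> bipartite G)"
proof -
  obtain N1 where N1: "\<And>G :: 'a ugraph. simple_graph G \<Longrightarrow> \<not> has_theta G q r \<Longrightarrow> N1 \<le> order G \<Longrightarrow>
     dense_bipartite G \<or> (\<exists>v\<in>verts G. 25 * deg G v < 12 * order G)"
    using dense_bipartite_or_low_degree[OF q r, where 'a = 'a] by auto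
  define N0 where "N0 = N1 + 100"
  \<comment> \<open>The excess starts at the trivial bound \<open>4 * (N0 * N0)\<close> and falls by
    one for each vertex beyond \<open>N0\<close>; the truncated subtraction makes it vanish from
    some order on.\<close>
  have ind: "simple_graph G \<Longrightarrow> \<not> has_theta G q r \<Longrightarrow> order G = N0 + k \<Longrightarrow>
      4 * esize G \<le> order G * order G + (4 * (N0 * N0) - k)" for k and G :: "'a ugraph"
  proof (induction k arbitrary: G)
    case 0
    then show ?case using card_edges_le_square[of G] by simp
  next
    case (Suc k)
    show ?case
    proof (cases "dense_bipartite G")
      case True
      then show ?thesis using bipartite_card_edges[OF Suc.prems(1)] by (simp add: dense_bipartite_def)
    next
      case False
      then obtain v where v: "v \<in> verts G" "25 * deg G v < 12 * order G"
        using N1[of G] Suc.prems by (auto simp: N0_def)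
      define m where "m = order (del G {v})"
      have m: "order G = Suc m" using card_del_vertex[OF Suc.prems(1) v(1)] by (simp add: m_def)
      have mk: "m = N0 + k" using m Suc.prems by simp
      have "4 * esize (del G {v}) \<le> m * m + (4 * (N0 * N0) - k)"
        using Suc.IH[OF simple_del[OF Suc.prems(1)] del_free[OF Suc.prems(2)], of "{v}"] mk by (simp add: m_def)
      moreover have "esize G = esize (del G {v}) + deg G v"
        by (rule card_edges_del_vertex[OF Suc.prems(1)])
      moreover have "100 \<le> m" using mk by (simp add: N0_def)
      ultimately show ?thesis using v(2) unfolding m by simp
    qed
  qed
  define N where "N = N0 + 4 * (N0 * N0)"
  have ex: "4 * esize G \<le> order G * order G"
    if "simple_graph G" "\<not> has_theta G q r" "N \<le> order G" for G :: "'a ugraph"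
    using ind[OF that(1,2), of "order G - N0"] that(3) by (simp add: N_def)
  have "bipartite G" if G: "simple_graph G" "\<not> has_theta G q r" "Suc N \<le> order G"
      and e: "order G * order G \<le> 4 * esize G + 1" for G :: "'a ugraph"
  proof (rule ccontr)
    assume "\<not> bipartite G"
    then have "\<not> dense_bipartite G" by (simp add: dense_bipartite_def)
    then obtain v where v: "v \<in> verts G" "25 * deg G v < 12 * order G"
      using N1[of G] G by (auto simp: N0_def N_def)
    define m where "m = order (del G {v})"
    have m: "order G = Suc m" using card_del_vertex[OF G(1) v(1)] by (simp add: m_def)
    have "4 * esize (del G {v}) \<le> m * m"
      using ex[OF simple_del[OF G(1)] del_free[OF G(2)], of "{v}"] m G(3) by (simp add: m_def)
    moreover have "esize G = esize (del G {v}) + deg G v"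
      by (rule card_edges_del_vertex[OF G(1)])
    moreover have "100 \<le> m" using m G(3) by (simp add: N0_def N_def)
    ultimately show False using v(2) e unfolding m by simp
  qed
  then show ?thesis using ex by (intro exI[of _ "Suc N"]) auto
qed

text \<open>Each deletion of a vertex of low degree gains a linear amount on \<open>n^2/4\<close>.
  The initial deficit is at most \<open>n\<close>, so after boundedly many deletions the extremal
  number would be exceeded.\<close>

lemma stability:
  assumes q: "even q" "q \<ge> 2" and r: "r \<ge> 2"
  shows "\<exists>N. \<forall>G :: 'a ugraph. simple_graph G \<and> \<not> has_theta G q r \<and> N \<le> order G \<and>
      order G * order G \<le> 4 * esize G + 4 * order G \<longrightarrow>
      (\<exists>R\<subseteq>verts G. card R \<le> 201 \<and> dense_bipartite (del G R))"
proof -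
  obtain N1 where N1: "\<And>G :: 'a ugraph. simple_graph G \<Longrightarrow> \<not> has_theta G q r \<Longrightarrow> N1 \<le> order G \<Longrightarrow>
     dense_bipartite G \<or> (\<exists>v\<in>verts G. 25 * deg G v < 12 * order G)"
    using dense_bipartite_or_low_degree[OF q r, where 'a = 'a] by auto
  obtain N2 where N2: "\<And>G :: 'a ugraph. simple_graph G \<Longrightarrow> \<not> has_theta G q r \<Longrightarrow> N2 \<le> order G \<Longrightarrow>
     4 * esize G \<le> order G * order G"
    using extremal_number[OF q r, where 'a = 'a] by auto
  define N0 where "N0 = N1 + N2 + 100"
  \<comment> \<open>\<open>k\<close> is the number of deletions still allowed, each credited with
    the original order \<open>n\<close>. The condition \<open>n + 2 * k \<le> 2 * order G\<close>
    keeps the current order above \<open>n/2\<close>, so the gain of nearly four times the order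
    covers one credit; \<open>k = 0\<close> contradicts \<open>N2\<close>. The start 201 is
    \<open>50 * 4 + 1\<close>: a deficit of \<open>4 n\<close>, scaled by 50, and one more for
    strictness.\<close>
  have ind: "simple_graph G \<Longrightarrow> \<not> has_theta G q r \<Longrightarrow> N0 + k \<le> order G \<Longrightarrow> n + 2 * k \<le> 2 * order G \<Longrightarrow>
      50 * (order G * order G) < 200 * esize G + k * n \<Longrightarrow>
      \<exists>R\<subseteq>verts G. card R \<le> k \<and> dense_bipartite (del G R)" if n: "n \<ge> 50" for k n and G :: "'a ugraph"
  proof (induction k arbitrary: G)
    case 0
    then show ?case using N2[of G] by (simp add: N0_def)
  next
    case (Suc k)
    show ?case
    proof (cases "dense_bipartite G")
      case True
      then show ?thesis by (intro exI[of _ "{}"]) simp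
    next
      case False
      then obtain v where v: "v \<in> verts G" "25 * deg G v < 12 * order G"
        using N1[of G] Suc.prems by (auto simp: N0_def)
      define m where "m = order (del G {v})"
      have m: "order G = Suc m" using card_del_vertex[OF Suc.prems(1) v(1)] by (simp add: m_def)
      have "esize G = esize (del G {v}) + deg G v"
        by (rule card_edges_del_vertex[OF Suc.prems(1)])
      then have "50 * (m * m) < 200 * esize (del G {v}) + k * n"
        using Suc.prems(4,5) v(2) n unfolding m by simp
      then have "\<exists>R\<subseteq>verts (del G {v}). card R \<le> k \<and> dense_bipartite (del (del G {v}) R)"
        using Suc.IH[OF simple_del[OF Suc.prems(1)] del_free[OF Suc.prems(2)], of "{v}"] Suc.prems(3,4) m
        unfolding m_def by simp
      then obtain R where R: "R \<subseteq> verts G - {v}" "card R \<le> k" "dense_bipartite (del G ({v} \<union> R))"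
        by (auto simp: del_del)
      have "card ({v} \<union> R) \<le> Suc k" using R(2) card_Un_le[of "{v}" R] by simp
      then show ?thesis using R v by (intro exI[of _ "{v} \<union> R"]) auto
    qed
  qed
  show ?thesis
  proof (intro exI[of _ "N0 + 402"] allI impI, elim conjE)
    fix G :: "'a ugraph"
    assume G: "simple_graph G" "\<not> has_theta G q r" "N0 + 402 \<le> order G"
      and e: "order G * order G \<le> 4 * esize G + 4 * order G"
    show "\<exists>R\<subseteq>verts G. card R \<le> 201 \<and> dense_bipartite (del G R)"
      using ind[of "order G" G 201] G e by simp
  qed
qed

section \<open>The structure of dense theta-free graphs\<close>

text \<open>\<open>A\<close> and \<open>B\<close> are the parts of a dense bipartite induced subgraph; \<open>side G A B\<close> collects the
  vertices, inside and outside of it, that can be added to \<open>A\<close>.\<close>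
definition side :: "'a ugraph \<Rightarrow> 'a set \<Rightarrow> 'a set \<Rightarrow> 'a set" where
  "side G A B = {v \<in> verts G. nbr G v \<inter> A = {} \<and> card A + card B \<le> 10 * card (nbr G v \<inter> B)}"

text \<open>The core is given by its parts, so that \<open>A\<close> and \<open>B\<close> can be
  exchanged. 201 comes from \<open>stability\<close>; \<open>large\<close> ensures that
  \<open>m/20 - m/25 = m/100\<close> is still at least \<open>c\<close>; \<open>ex\<close> is the
  extremal bound after deleting up to four vertices, as many as
  \<open>common_neighbour_unique\<close> deletes.\<close>

locale near_bipartite =
  fixes G :: "'a ugraph" and q r c :: nat and A B :: "'a set"
  assumes G: "simple_graph G" and free: "\<not> has_theta G q r"
    and q: "even q" "q \<ge> 2" and r: "r \<ge> 2" and c: "c = 4 * (q + r) + 20"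
    and AB: "A \<union> B \<subseteq> verts G" "A \<inter> B = {}" and rest: "card (verts G - (A \<union> B)) \<le> 201"
    and indA: "\<And>a. a \<in> A \<Longrightarrow> nbr G a \<inter> A = {}" and indB: "\<And>b. b \<in> B \<Longrightarrow> nbr G b \<inter> B = {}"
    and degA: "\<And>a. a \<in> A \<Longrightarrow> 12 * (card A + card B) \<le> 25 * card (nbr G a \<inter> B)"
    and degB: "\<And>b. b \<in> B \<Longrightarrow> 12 * (card A + card B) \<le> 25 * card (nbr G b \<inter> A)"
    and large: "100 * c + 20000 \<le> card A + card B"
    and ex: "\<And>R. R \<subseteq> verts G \<Longrightarrow> card R \<le> 4 \<Longrightarrow>
      4 * esize (del G R) \<le> (order G - card R) * (order G - card R)"
begin

text \<open>The assumptions are symmetric in the parts, so every fact about \<open>PA\<close>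
  transfers to \<open>PB\<close>.\<close>

lemma swap: "near_bipartite G q r c B A"
  by (unfold_locales)
     (use G free q r c AB rest indA indB degA degB large ex in \<open>simp_all add: Un_commute Int_commute add.commute\<close>)

section \<open>Neighbourhoods and degrees relative to the core\<close>

lemma fin: "finite A" "finite B" "finite (verts G)"
  using simple_finite[OF G] AB by (auto intro: finite_subset)

lemma finN [simp]: "finite (nbr G v)"
  by (rule finite_nbr[OF G])

abbreviation "m \<equiv> card A + card B"
abbreviation "n \<equiv> order G"
abbreviation "PA \<equiv> side G A B"
abbreviation "PB \<equiv> side G B A"

lemma m_le_n: "m \<le> n"
proof -
  have "card (A \<union> B) = m" using fin AB by (simp add: card_Un_disjoint)
  then show ?thesis using card_mono[OF fin(3) AB(1)] by simp
qed

text \<open>A vertex of \<open>B\<close> has \<open>12 m / 25\<close> neighbours in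
  \<open>A\<close>, which leaves at most \<open>13 m / 25\<close> vertices for
  \<open>B\<close>.\<close>

lemma card_B_le: "25 * card B \<le> 13 * m"
proof -
  have "B \<noteq> {}"
  proof
    assume "B = {}"
    moreover from this have "A \<noteq> {}" using large by auto
    then obtain a where "a \<in> A" by blast
    ultimately show False using degA[of a] large by simp
  qed
  then obtain b where "b \<in> B" by blast
  then have "12 * m \<le> 25 * card A"
    using degB[of b] card_mono[OF fin(1), of "nbr G b \<inter> A"] by simp
  then show ?thesis by simp
qed

text \<open>Since \<open>B\<close> has at most \<open>13 m / 25\<close> vertices and
  \<open>a\<close> sees at least \<open>12 m / 25\<close> of them, \<open>a\<close> misses at most
  \<open>m / 25\<close> vertices of \<open>B\<close>.\<close>

lemma inter_nbr:
  assumes "X \<subseteq> B" "a \<in> A"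
  shows "25 * card X \<le> 25 * card (X \<inter> nbr G a) + m"
proof -
  have "card X + card (nbr G a \<inter> B) = card (X \<union> (nbr G a \<inter> B)) + card (X \<inter> (nbr G a \<inter> B))"
    by (rule card_Un_Int) (use fin assms in \<open>auto intro: finite_subset\<close>)
  moreover have "card (X \<union> (nbr G a \<inter> B)) \<le> card B" by (rule card_mono) (use fin assms in auto)
  moreover have "X \<inter> (nbr G a \<inter> B) = X \<inter> nbr G a" using assms by auto
  ultimately show ?thesis using degA[OF assms(2)] card_B_le by simp
qed

lemma common_nbrs:
  assumes "x \<in> PA" "a \<in> A"
  shows "c \<le> card (nbr G x \<inter> nbr G a \<inter> B)"
proof -
  have "m \<le> 10 * card (nbr G x \<inter> B)" using assms by (simp add: side_def)
  moreover have "25 * card (nbr G x \<inter> B) \<le> 25 * card (nbr G x \<inter> B \<inter> nbr G a) + m"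
    by (rule inter_nbr) (use assms in auto)
  moreover have "nbr G x \<inter> B \<inter> nbr G a = nbr G x \<inter> nbr G a \<inter> B" by blast
  ultimately show ?thesis using large by simp
qed

lemma side_linked: "x \<in> PA \<Longrightarrow> a \<in> A \<Longrightarrow> linked G c x a"
  using common_nbrs[of x a] card_mono[of "nbr G x \<inter> nbr G a" "nbr G x \<inter> nbr G a \<inter> B"]
  by (simp add: linked_def le_infI1)

lemma A_subset_side: "A \<subseteq> PA"
proof
  fix a assume a: "a \<in> A"
  then show "a \<in> PA" using degA[OF a] indA[OF a] AB by (auto simp: side_def)
qed

lemma linked_subset: "U \<subseteq> A \<Longrightarrow> c \<le> card U \<Longrightarrow> linked_set G c U"
  using side_linked A_subset_side unfolding linked_set_def by blast

lemma card_A_ge: "c \<le> card A"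
  using near_bipartite.card_B_le[OF swap] near_bipartite.card_B_le[OF near_bipartite.swap[OF swap]] large by simp

lemma side_nbr: "x \<in> PA \<Longrightarrow> c + 10 \<le> card (nbr G x \<inter> B)"
  using large by (simp add: side_def)

lemma sides_disjoint: "PA \<inter> PB = {}"
  using side_nbr by (fastforce simp: side_def)

lemma deg_split: "deg G v \<le> card (nbr G v \<inter> A) + card (nbr G v \<inter> B) + 201"
proof -
  have "nbr G v = (nbr G v \<inter> A) \<union> (nbr G v \<inter> B) \<union> (nbr G v \<inter> (verts G - (A \<union> B)))"
    using nbr_subset[OF G] by blast
  then have "deg G v \<le> card (nbr G v \<inter> A) + card (nbr G v \<inter> B) + card (nbr G v \<inter> (verts G - (A \<union> B)))"
    by (metis (no_types, lifting) add_le_cancel_right card_Un_le le_trans)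
  moreover have "card (nbr G v \<inter> (verts G - (A \<union> B))) \<le> card (verts G - (A \<union> B))"
    by (rule card_mono) (use fin in auto)
  ultimately show ?thesis using rest by simp
qed

text \<open>With \<open>m/20\<close> neighbours in \<open>B\<close>, \<open>v\<close> would share at
  least \<open>m/20 - m/25 \<ge> c\<close> of them with \<open>x\<close>: a linked set over the edge
  \<open>vx\<close>.\<close>

lemma two_sided:
  assumes "x \<in> nbr G v" "x \<in> A"
  shows "20 * card (nbr G v \<inter> B) < m"
proof (rule ccontr)
  assume "\<not> ?thesis"
  then have "m \<le> 20 * card (nbr G v \<inter> B)" by simp
  moreover have "25 * card (nbr G v \<inter> B) \<le> 25 * card (nbr G v \<inter> B \<inter> nbr G x) + m"
    by (rule inter_nbr) (use assms in auto)
  ultimately have "c \<le> card (nbr G v \<inter> B \<inter> nbr G x)" using large by simp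
  then have "linked_set G c (nbr G v \<inter> B \<inter> nbr G x)"
    by (intro near_bipartite.linked_subset[OF swap]) auto
  then have "has_theta G q r"
    by (rule theta_of_edge[OF G _ _ _ q r]) (use assms c in \<open>auto simp: nbr_def\<close>)
  then show False using free by simp
qed

text \<open>Such a vertex has either neighbours in both parts, then fewer than \<open>m/20\<close>
  in each by \<open>two_sided\<close>, or fewer than \<open>m/10\<close> in a single part. The 2010
  accounts for the 201 vertices off the core.\<close>

lemma leftover_degree:
  assumes "v \<in> verts G" "v \<notin> PA" "v \<notin> PB"
  shows "10 * deg G v \<le> m + 2010"
proof -
  have "nbr G v \<inter> A \<noteq> {} \<or> 10 * card (nbr G v \<inter> B) < m" "nbr G v \<inter> B \<noteq> {} \<or> 10 * card (nbr G v \<inter> A) < m"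
    using assms by (auto simp: side_def)
  moreover have "nbr G v \<inter> A \<noteq> {} \<Longrightarrow> 20 * card (nbr G v \<inter> B) < m"
    using two_sided by blast
  moreover have "nbr G v \<inter> B \<noteq> {} \<Longrightarrow> 20 * card (nbr G v \<inter> A) < m"
    using near_bipartite.two_sided[OF swap] by (auto simp: add.commute)
  ultimately have "10 * (card (nbr G v \<inter> A) + card (nbr G v \<inter> B)) \<le> m"
    by (cases "nbr G v \<inter> A = {}"; cases "nbr G v \<inter> B = {}") auto
  then show ?thesis using deg_split[of v] by simp
qed

text \<open>Inside the core both vertices see only \<open>B\<close>, of size at most
  \<open>13 m / 25\<close>; \<open>10050 = 25 * 402\<close> covers their neighbours off the
  core.\<close>

lemma few_common_degree:
  assumes "x \<in> PA" "x' \<in> PA" "card (nbr G x \<inter> nbr G x' \<inter> B) < c"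
  shows "25 * (deg G x + deg G x') \<le> 13 * m + 25 * c + 10050"
proof -
  have "card (nbr G x \<inter> B) + card (nbr G x' \<inter> B) = card ((nbr G x \<inter> B) \<union> (nbr G x' \<inter> B)) + card ((nbr G x \<inter> B) \<inter> (nbr G x' \<inter> B))"
    by (rule card_Un_Int) auto
  moreover have "card ((nbr G x \<inter> B) \<union> (nbr G x' \<inter> B)) \<le> card B" by (rule card_mono) (use fin in auto)
  moreover have "(nbr G x \<inter> B) \<inter> (nbr G x' \<inter> B) = nbr G x \<inter> nbr G x' \<inter> B" by blast
  moreover have "card (nbr G x \<inter> A) = 0" "card (nbr G x' \<inter> A) = 0" using assms by (auto simp: side_def)
  ultimately show ?thesis using assms(3) card_B_le deg_split[of x] deg_split[of x'] by simp
qed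

lemma adjacent_same_side:
  assumes "s \<in> PA" "s' \<in> PA" "s' \<in> nbr G s"
  shows "25 * (deg G s + deg G s') \<le> 13 * m + 25 * c + 10050"
proof (rule few_common_degree[OF assms(1,2)], rule ccontr)
  assume "\<not> card (nbr G s \<inter> nbr G s' \<inter> B) < c"
  then have "linked_set G c (nbr G s \<inter> nbr G s' \<inter> B)"
    by (intro near_bipartite.linked_subset[OF swap]) auto
  then have "has_theta G q r"
    by (rule theta_of_edge[OF G _ _ _ q r]) (use assms c in \<open>auto simp: nbr_def\<close>)
  then show False using free by simp
qed

section \<open>Forbidden triangles and paths of length three\<close>

lemma no_triangle_even:
  assumes "even r" "r \<ge> 4" "x \<in> PA" "y \<in> PB" "y' \<in> PB" "y \<noteq> y'"
    and "{z, x} \<in> edges G" "{z, y} \<in> edges G" "{z, y'} \<in> edges G" "{x, y} \<in> edges G"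
  shows False
proof -
  have "has_theta G q r"
  proof (rule theta_of_triangle_even[OF G, of c A])
    show "linked_set G c A" using linked_subset card_A_ge by simp
    show "\<forall>u\<in>A. x \<noteq> u \<longrightarrow> linked G c x u" using side_linked assms by blast
    show "c \<le> card (nbr G y \<inter> A)" "c \<le> card (nbr G y' \<inter> A)"
      using near_bipartite.side_nbr[OF swap] assms by (auto intro: add_leD1)
    show "x \<noteq> y'" using sides_disjoint assms by auto
  qed (use assms q c in auto)
  then show False using free by simp
qed

lemma no_triangle_odd:
  assumes "q = 2" "odd r" "x \<in> PA" "y \<in> PB"
    and "{z, x} \<in> edges G" "{z, y} \<in> edges G" "{x, y} \<in> edges G"
  shows False
proof -
  have "has_theta G 2 r"
  proof (rule theta_of_triangle_odd[OF G, of c A])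
    show "linked_set G c A" using linked_subset card_A_ge by simp
    show "\<forall>u\<in>A. x \<noteq> u \<longrightarrow> linked G c x u" using side_linked assms by blast
    show "c \<le> card (nbr G y \<inter> A)"
      using near_bipartite.side_nbr[OF swap] assms by (auto intro: add_leD1)
  qed (use assms r c in auto)
  then show False using free assms by simp
qed

lemma no_three_path:
  assumes "q \<ge> 4" "odd r" "is_path G [u, x, y, v]" "c \<le> card (nbr G u \<inter> nbr G v \<inter> A)"
  shows False
proof -
  have "has_theta G q r"
  proof (rule theta_of_path_odd[OF G, of c _ u v q r "[x, y]"])
    show "linked_set G c (nbr G u \<inter> nbr G v \<inter> A)" using linked_subset assms(4) by simp
  qed (use assms q r c in auto)
  then show False using free by simp
qed

section \<open>Counting edges after deleting exceptional vertices\<close>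

lemma edges_le:
  assumes "R \<subseteq> verts G" "card R = t" "t \<le> 4"
  shows "4 * esize G + 2 * (t * n) \<le> n * n + t * t + 4 * (\<Sum>v\<in>R. deg G v)"
proof -
  have "t \<le> n" using card_mono[OF fin(3) assms(1)] assms(2) by simp
  then obtain k where k: "n = k + t" by (metis le_add_diff_inverse2)
  have "4 * esize (del G R) \<le> k * k" using ex[OF assms(1)] assms(2,3) k by simp
  moreover have "esize G \<le> esize (del G R) + (\<Sum>v\<in>R. deg G v)"
    using card_edges_del_le[OF G finite_subset[OF assms(1) fin(3)]] .
  ultimately show ?thesis unfolding k by (simp add: algebra_simps)
qed

lemma parts_sides:
  assumes Z: "verts G \<subseteq> PA \<union> PB \<union> Z"
    and "\<And>s s'. s \<in> PA - Z \<Longrightarrow> s' \<in> PA - Z \<Longrightarrow> s' \<notin> nbr G s"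
    and "\<And>s s'. s \<in> PB - Z \<Longrightarrow> s' \<in> PB - Z \<Longrightarrow> s' \<notin> nbr G s"
  shows "parts (del G Z) (PA - Z) (PB - Z)"
  unfolding parts_def
proof (intro conjI ballI)
  have "PA \<subseteq> verts G" "PB \<subseteq> verts G" by (auto simp: side_def)
  then show "PA - Z \<union> (PB - Z) = verts (del G Z)" using Z by auto
  show "(PA - Z) \<inter> (PB - Z) = {}" using sides_disjoint by blast
next
  fix v assume "v \<in> PA - Z"
  then show "nbr (del G Z) v \<inter> (PA - Z) = {}" using assms(2)[of v] nbr_del[of v Z G] by auto
next
  fix v assume "v \<in> PB - Z"
  then show "nbr (del G Z) v \<inter> (PB - Z) = {}" using assms(3)[of v] nbr_del[of v Z G] by auto
qed

text \<open>By \<open>edges_le\<close> and the assumption on \<open>esize G\<close>, any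
  \<open>t \<le> 4\<close> vertices have degree sum at least \<open>(t - 1) n / 2\<close> up to a
  constant. A single defect \<open>z\<close> of degree about \<open>13 n / 50\<close> passes this
  test. Together with a further vertex outside the sides (about \<open>n/10\<close>) or with an
  adjacent pair on one side (about \<open>13 n / 25\<close>) it fails.\<close>

lemma one_vertex:
  assumes e: "n * n + 4 \<le> 4 * esize G + 2 * n" and nb: "\<not> bipartite G"
  obtains z where "z \<in> verts G" "parts (del G {z}) (PA - {z}) (PB - {z})"
proof -
  have same: "25 * (deg G s + deg G s') \<le> 13 * m + 25 * c + 10050"
    if "s \<in> PA \<and> s' \<in> PA \<or> s \<in> PB \<and> s' \<in> PB" "s' \<in> nbr G s" for s s'
    using that adjacent_same_side[of s s'] near_bipartite.adjacent_same_side[OF swap, of s s'] by (auto simp: add.commute)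
  \<comment> \<open>Degree at most about \<open>n/4\<close>: of two adjacent vertices on the same side take the smaller degree.
    With any further defect, deleting it together with \<open>z\<close> would cost too many edges.\<close>
  obtain z where z: "z \<in> verts G" "50 * deg G z \<le> 13 * m + 25 * c + 10050"
  proof (cases "verts G \<subseteq> PA \<union> PB")
    case False
    then obtain z where "z \<in> verts G" "z \<notin> PA" "z \<notin> PB" by blast
    then show ?thesis using leftover_degree[of z] that[of z] by simp
  next
    case True
    have "\<not> parts (del G {}) (PA - {}) (PB - {})" using nb bipartite_iff_parts[OF G] by auto
    then obtain s s' where s: "s \<in> PA \<and> s' \<in> PA \<or> s \<in> PB \<and> s' \<in> PB" "s' \<in> nbr G s"
      using parts_sides[of "{}"] True by auto
    then have "s \<in> verts G" "s' \<in> verts G" by (auto simp: side_def)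
    then show ?thesis using same[OF s] that[of s] that[of s']
      by (cases "deg G s \<le> deg G s'") auto
  qed
  have "parts (del G {z}) (PA - {z}) (PB - {z})"
  proof (rule parts_sides)
    show "verts G \<subseteq> PA \<union> PB \<union> {z}"
    proof (rule ccontr)
      assume "\<not> verts G \<subseteq> PA \<union> PB \<union> {z}"
      then obtain y where y: "y \<in> verts G" "y \<notin> PA" "y \<notin> PB" "y \<noteq> z" by blast
      then show False
        using edges_le[of "{y, z}" 2] leftover_degree[of y] z e large m_le_n by simp
    qed
    have no: False if s: "s \<in> PA \<and> s' \<in> PA \<or> s \<in> PB \<and> s' \<in> PB" "s' \<in> nbr G s" "s \<noteq> z" "s' \<noteq> z" for s s'
    proof -
      have "s \<noteq> s'" using s nbr_irrefl[OF G] by auto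
      moreover have "s \<in> verts G" "s' \<in> verts G" using s by (auto simp: side_def)
      ultimately show False
        using edges_le[of "{s, s', z}" 3] same[OF s(1,2)] z e large m_le_n s(3,4) by simp
    qed
    show "s' \<notin> nbr G s" if "s \<in> PA - {z}" "s' \<in> PA - {z}" for s s' using no[of s s'] that by blast
    show "s' \<notin> nbr G s" if "s \<in> PB - {z}" "s' \<in> PB - {z}" for s s' using no[of s s'] that by blast
  qed
  then show ?thesis using that z by blast
qed

section \<open>Exceptional vertices for \<open>q \<ge> 4\<close> and odd \<open>r\<close>\<close>

lemma path4:
  "is_path G [u, x, y, v] \<longleftrightarrow> distinct [u, x, y, v] \<and> {u, x} \<in> edges G \<and> {x, y} \<in> edges G \<and> {y, v} \<in> edges G"
  by (auto simp: is_path_Cons)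

text \<open>Neighbours in \<open>B\<close> extend the edge to a path \<open>y s s' y'\<close> whose
  ends lie in \<open>B\<close> and share many neighbours in \<open>A\<close>.\<close>

lemma no_adjacent_same_side:
  assumes "q \<ge> 4" "odd r" and s: "s \<in> PA" "s' \<in> PA"
  shows "s' \<notin> nbr G s"
proof
  assume adj: "s' \<in> nbr G s"
  have "c + 10 \<le> card (nbr G s \<inter> B)" "c + 10 \<le> card (nbr G s' \<inter> B)" using side_nbr s by auto
  note b = this
  obtain y where y: "y \<in> nbr G s \<inter> B" using pick_outside[OF b(1), of "{}"] by auto
  obtain y' where y': "y' \<in> nbr G s' \<inter> B" "y' \<notin> {y}"
    using pick_outside[OF b(2), of "{y}"] by auto
  have "B \<subseteq> PB" by (rule near_bipartite.A_subset_side[OF swap])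
  then have "is_path G [y, s, s', y']"
    using y y' s adj sides_disjoint simple_edge(3)[OF G, of s s'] by (auto simp: path4 nbr_def insert_commute)
  moreover have "c \<le> card (nbr G y \<inter> nbr G y' \<inter> A)"
    using near_bipartite.common_nbrs[OF swap, of y y'] y y' \<open>B \<subseteq> PB\<close> by auto
  ultimately show False using no_three_path assms by blast
qed

text \<open>A neighbour \<open>y\<close> on the other side gives the path \<open>y z x x'\<close>
  with \<open>x'\<close> in \<open>B\<close>; its ends share many neighbours in
  \<open>A\<close>.\<close>

lemma one_sided:
  assumes "q \<ge> 4" "odd r" and x: "x \<in> PA" "x \<in> nbr G z"
  shows "nbr G z \<inter> PB = {}"
proof (rule ccontr)
  assume "nbr G z \<inter> PB \<noteq> {}"
  then obtain y where y: "y \<in> nbr G z" "y \<in> PB" by blast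
  have "card {y, z} < c + 10" by (simp add: card_insert_if)
  then obtain x' where x': "x' \<in> nbr G x \<inter> B" "x' \<notin> {y, z}"
    using pick_outside[OF side_nbr[OF x(1)], of "{y, z}"] by auto
  have "x' \<in> PB" using near_bipartite.A_subset_side[OF swap] x' by auto
  then have "is_path G [y, z, x, x']"
    using x y x' sides_disjoint simple_edge(3)[OF G, of z x] simple_edge(3)[OF G, of z y]
    by (auto simp: path4 nbr_def insert_commute)
  moreover have "c \<le> card (nbr G y \<inter> nbr G x' \<inter> A)"
    using near_bipartite.common_nbrs[OF swap, of y x'] y x' by auto
  ultimately show False using no_three_path assms by blast
qed

text \<open>If \<open>x \<noteq> y\<close>, the path \<open>x z1 z2 y\<close> leaves
  \<open>x\<close> and \<open>y\<close> few common neighbours, so their degrees sum to about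
  \<open>13 n / 25\<close>. With two leftover degrees of \<open>n/10\<close> this makes
  \<open>18 n / 25\<close> for four deleted vertices, where the edge count demands about
  \<open>n\<close>.\<close>

lemma common_neighbour_unique:
  assumes qr: "q \<ge> 4" "odd r" and e: "n * n + 8 \<le> 4 * esize G + 4 * n"
    and z: "z1 \<in> verts G" "z2 \<in> verts G" "z1 \<notin> PA \<union> PB" "z2 \<notin> PA \<union> PB" "z2 \<in> nbr G z1"
    and x: "x \<in> nbr G z1 \<inter> PA" and y: "y \<in> nbr G z2 \<inter> PA"
  shows "x = y"
proof (rule ccontr)
  assume ne: "x \<noteq> y"
  have "z1 \<noteq> z2" using z nbr_irrefl[OF G] by auto
  then have p: "is_path G [x, z1, z2, y]" using x y z ne by (auto simp: path4 nbr_def insert_commute)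
  then have "\<not> c \<le> card (nbr G x \<inter> nbr G y \<inter> B)"
    using near_bipartite.no_three_path[OF swap qr p] by blast
  then have "25 * (deg G x + deg G y) \<le> 13 * m + 25 * c + 10050"
    using few_common_degree[of x y] x y by simp
  moreover have "x \<in> verts G" "y \<in> verts G" using x y by (auto simp: side_def)
  moreover have "distinct [x, y, z1, z2]" using p by (auto simp: path4)
  ultimately show False
    using edges_le[of "{x, y, z1, z2}" 4] leftover_degree[of z1] leftover_degree[of z2] z e large m_le_n by simp
qed

text \<open>Every set of at least three exceptional vertices costs too many edges, and fewer of them can be
  added to the two sides unless they form a triangle with a single vertex \<open>y\<close>.\<close>
lemma two_vertices:
  assumes qr: "q \<ge> 4" "odd r" and e: "n * n + 8 \<le> 4 * esize G + 4 * n" and nb: "\<not> bipartite G"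
  obtains z1 z2 y where "z1 \<in> verts G" "z2 \<in> verts G" "z1 \<noteq> z2"
    "parts (del G {z1, z2}) (PA - {z1, z2}) (PB - {z1, z2})"
    "y \<in> PA \<union> PB" "y \<noteq> z1" "y \<noteq> z2" "nbr G z1 = {z2, y}" "nbr G z2 = {z1, y}"
proof -
  define Z where "Z = verts G - (PA \<union> PB)"
  have V: "verts G = PA \<union> PB \<union> Z" by (auto simp: Z_def side_def)
  have noA: "s' \<notin> nbr G s" if "s \<in> PA" "s' \<in> PA" for s s' using no_adjacent_same_side[OF qr that] .
  have noB: "s' \<notin> nbr G s" if "s \<in> PB" "s' \<in> PB" for s s'
    using near_bipartite.no_adjacent_same_side[OF swap qr that] .
  have nAB: "nbr G z \<inter> PA = {} \<or> nbr G z \<inter> PB = {}" for z using one_sided[OF qr, of _ z] by blast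
  have "card Z \<le> 2"
  proof (rule ccontr)
    assume "\<not> card Z \<le> 2"
    then have "3 \<le> card Z" by simp
    then obtain T where "T \<subseteq> Z" "card T = 3" by (meson obtain_subset_with_card_n)
    then obtain x y z where "{x, y, z} \<subseteq> Z" "distinct [x, y, z]" by (auto simp: card_3_iff)
    then show False
      using edges_le[of "{x, y, z}" 3] leftover_degree[of x] leftover_degree[of y] leftover_degree[of z] e large m_le_n
      by (simp add: Z_def)
  qed
  \<comment> \<open>Every way of placing the exceptional vertices on the two sides must fail. With
    \<open>nAB\<close> this excludes fewer than two of them, a non-adjacent pair, and a pair without
    neighbours on a common side.\<close>
  have col: "bipartite G" if S: "S \<union> T = Z" "S \<inter> T = {}" "\<And>z. z \<in> S \<Longrightarrow> nbr G z \<inter> (PA \<union> S) = {}"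
     "\<And>z. z \<in> T \<Longrightarrow> nbr G z \<inter> (PB \<union> T) = {}" for S T
  proof -
    have "parts G (PA \<union> S) (PB \<union> T)"
      unfolding parts_def
    proof (intro conjI ballI)
      show "PA \<union> S \<union> (PB \<union> T) = verts G" using V S by blast
      show "(PA \<union> S) \<inter> (PB \<union> T) = {}" using S sides_disjoint by (auto simp: Z_def)
    next
      fix v assume v: "v \<in> PA \<union> S"
      have False if u: "u \<in> nbr G v" "u \<in> PA \<union> S" for u
        using v u noA[of v u] S(3)[of v] S(3)[of u] nbr_sym[of u G v] by blast
      then show "nbr G v \<inter> (PA \<union> S) = {}" by blast
    next
      fix v assume v: "v \<in> PB \<union> T"
      have False if u: "u \<in> nbr G v" "u \<in> PB \<union> T" for u
        using v u noB[of v u] S(4)[of v] S(4)[of u] nbr_sym[of u G v] by blast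
      then show "nbr G v \<inter> (PB \<union> T) = {}" by blast
    qed
    then show ?thesis using bipartite_iff_parts[OF G] by blast
  qed
  have irr: "z \<notin> nbr G z" for z using nbr_irrefl[OF G] .
  have fZ: "finite Z" using fin by (simp add: Z_def)
  have "Z \<noteq> {}" using col[of "{}" "{}"] nb by auto
  moreover have "Z \<noteq> {z}" for z
    using col[of "{z}" "{}"] col[of "{}" "{z}"] nb nAB[of z] irr[of z] by auto
  ultimately have "card Z = 2" using \<open>card Z \<le> 2\<close> fZ
    by (metis One_nat_def card_0_eq card_1_singletonE le_Suc_eq le_zero_eq numeral_2_eq_2)
  then obtain z1 z2 where Z: "Z = {z1, z2}" "z1 \<noteq> z2" by (auto simp: card_2_iff)
  then have zV: "z1 \<in> verts G" "z2 \<in> verts G" "z1 \<notin> PA \<union> PB" "z2 \<notin> PA \<union> PB" by (auto simp: Z_def)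
  have adj: "z2 \<in> nbr G z1"
  proof (rule ccontr)
    assume "z2 \<notin> nbr G z1"
    moreover from this have "z1 \<notin> nbr G z2" using nbr_sym by metis
    ultimately show False
      using col[of "{z1, z2}" "{}"] col[of "{z1}" "{z2}"] col[of "{z2}" "{z1}"] col[of "{}" "{z1, z2}"]
        nb nAB[of z1] nAB[of z2] irr[of z1] irr[of z2] Z by (auto simp: insert_commute)
  qed
  then have adj': "z1 \<in> nbr G z2" using nbr_sym by metis
  have bad: "nbr G z1 \<inter> PA \<noteq> {} \<and> nbr G z2 \<inter> PA \<noteq> {} \<or> nbr G z1 \<inter> PB \<noteq> {} \<and> nbr G z2 \<inter> PB \<noteq> {}"
    using col[of "{z1}" "{z2}"] col[of "{z2}" "{z1}"] nb nAB[of z1] nAB[of z2] irr[of z1] irr[of z2] Z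
    by (auto simp: insert_commute)
  have uA: "x = y" if "x \<in> nbr G z1 \<inter> PA" "y \<in> nbr G z2 \<inter> PA" for x y
    using common_neighbour_unique[OF qr e zV adj that] .
  have uB: "x = y" if "x \<in> nbr G z1 \<inter> PB" "y \<in> nbr G z2 \<inter> PB" for x y
    using near_bipartite.common_neighbour_unique[OF swap qr e zV(1,2) _ _ adj that] zV by blast
  have single: "\<exists>y\<in>C. nbr G z1 \<inter> (C \<union> D) = {y} \<and> nbr G z2 \<inter> (C \<union> D) = {y}"
    if b: "nbr G z1 \<inter> C \<noteq> {} \<and> nbr G z2 \<inter> C \<noteq> {}" and CD: "\<And>z. nbr G z \<inter> C = {} \<or> nbr G z \<inter> D = {}"
      and u: "\<And>x y. x \<in> nbr G z1 \<inter> C \<Longrightarrow> y \<in> nbr G z2 \<inter> C \<Longrightarrow> x = y" for C D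
  proof -
    obtain y where y: "y \<in> nbr G z1 \<inter> C" using b by blast
    then have "\<forall>w\<in>nbr G z2 \<inter> C. w = y" using u[OF y] by simp
    then have z2: "nbr G z2 \<inter> C = {y}" using b by fastforce
    then have "\<forall>w\<in>nbr G z1 \<inter> C. w = y" using u[of _ y] by simp
    then have "nbr G z1 \<inter> C = {y}" using y by fastforce
    then show ?thesis using z2 y CD[of z1] CD[of z2] by (intro bexI[of _ y]) auto
  qed
  have "\<exists>y\<in>PA \<union> PB. nbr G z1 \<inter> (PA \<union> PB) = {y} \<and> nbr G z2 \<inter> (PA \<union> PB) = {y}"
    using bad
  proof
    assume "nbr G z1 \<inter> PA \<noteq> {} \<and> nbr G z2 \<inter> PA \<noteq> {}"
    from single[OF this nAB uA] show ?thesis by auto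
  next
    assume b: "nbr G z1 \<inter> PB \<noteq> {} \<and> nbr G z2 \<inter> PB \<noteq> {}"
    have "nbr G z \<inter> PB = {} \<or> nbr G z \<inter> PA = {}" for z using nAB[of z] by auto
    from single[OF b this uB] show ?thesis unfolding Un_commute[of PA PB] by auto
  qed
  then obtain y where y: "y \<in> PA \<union> PB" "nbr G z1 \<inter> (PA \<union> PB) = {y}" "nbr G z2 \<inter> (PA \<union> PB) = {y}" by blast
  have "nbr G z \<subseteq> PA \<union> PB \<union> {z1, z2}" for z using nbr_subset[OF G, of z] V Z by blast
  then have "nbr G z1 = {z2, y}" "nbr G z2 = {z1, y}" using y adj adj' irr[of z1] irr[of z2] by blast+
  moreover have "parts (del G {z1, z2}) (PA - {z1, z2}) (PB - {z1, z2})"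
    by (rule parts_sides) (use V Z noA noB in blast)+
  moreover have "y \<noteq> z1" "y \<noteq> z2" using y zV by auto
  ultimately show ?thesis using that zV Z y by blast
qed

end

lemma near_bipartite_exists:
  assumes q: "even q" "q \<ge> 2" and r: "r \<ge> 2"
  shows "\<exists>N. \<forall>G :: 'a ugraph. simple_graph G \<and> \<not> has_theta G q r \<and> N \<le> order G \<and>
      order G * order G \<le> 4 * esize G + 4 * order G \<longrightarrow>
      (\<exists>A B. near_bipartite G q r (4 * (q + r) + 20) A B)"
proof -
  define c where "c = 4 * (q + r) + 20"
  obtain N1 where N1: "\<And>G :: 'a ugraph. simple_graph G \<Longrightarrow> \<not> has_theta G q r \<Longrightarrow> N1 \<le> order G \<Longrightarrow>
      order G * order G \<le> 4 * esize G + 4 * order G \<Longrightarrow>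
      \<exists>R\<subseteq>verts G. card R \<le> 201 \<and> dense_bipartite (del G R)"
    using stability[OF q r, where 'a = 'a] by auto
  obtain N2 where N2: "\<And>G :: 'a ugraph. simple_graph G \<Longrightarrow> \<not> has_theta G q r \<Longrightarrow> N2 \<le> order G \<Longrightarrow>
     4 * esize G \<le> order G * order G"
    using extremal_number[OF q r, where 'a = 'a] by auto
  show ?thesis
  proof (intro exI[of _ "N1 + N2 + 100 * c + 21000"] allI impI, elim conjE)
    fix G :: "'a ugraph"
    assume G: "simple_graph G" "\<not> has_theta G q r" "N1 + N2 + 100 * c + 21000 \<le> order G"
      and e: "order G * order G \<le> 4 * esize G + 4 * order G"
    obtain R where R: "R \<subseteq> verts G" "card R \<le> 201" "dense_bipartite (del G R)"
      using N1[OF G(1,2) _ e] G(3) by auto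
    obtain A B where p: "parts (del G R) A B"
      using R(3) bipartite_iff_parts[OF simple_del[OF G(1)]] by (auto simp: dense_bipartite_def)
    have AB: "A \<union> B = verts G - R" "A \<inter> B = {}" using p by (auto simp: parts_def)
    have m: "card A + card B = order (del G R)" using parts_card[OF simple_del[OF G(1)] p] by simp
    have fR: "finite R" using R(1) simple_finite[OF G(1)] finite_subset by auto
    have mn: "order (del G R) = order G - card R"
      using card_Diff_subset[OF fR R(1)] by simp
    have core: "nbr G a \<inter> C = {}" "nbr (del G R) a = nbr G a \<inter> D"
      if p: "parts (del G R) C D" and a: "a \<in> C" for a C D
    proof -
      have CD: "C \<union> D = verts G - R" and e: "nbr (del G R) a \<inter> C = {}" using a p by (auto simp: parts_def)
      have d: "nbr (del G R) a = nbr G a - R" using a CD by (intro nbr_del) auto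
      show "nbr G a \<inter> C = {}" using d e CD by blast
      show "nbr (del G R) a = nbr G a \<inter> D" using d e CD nbr_subset[OF G(1), of a] by blast
    qed
    note nA = core[OF p] and nB = core[OF p[unfolded parts_sym[of _ A B]]]
    have deg: "12 * (card A + card B) \<le> 25 * deg (del G R) a" if "a \<in> A \<union> B" for a
      using R(3) that AB m by (simp add: dense_bipartite_def)
    have "near_bipartite G q r c A B"
    proof
      show "simple_graph G" "\<not> has_theta G q r" "even q" "2 \<le> q" "2 \<le> r" "c = 4 * (q + r) + 20"
        using G q r c_def by auto
      show "A \<union> B \<subseteq> verts G" "A \<inter> B = {}" using AB by auto
      have "verts G - (A \<union> B) = R" using AB R(1) by blast
      then show "card (verts G - (A \<union> B)) \<le> 201" using R(2) by simp
      show "nbr G a \<inter> A = {}" if "a \<in> A" for a using nA that by blast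
      show "nbr G b \<inter> B = {}" if "b \<in> B" for b using nB that by blast
      show "12 * (card A + card B) \<le> 25 * card (nbr G a \<inter> B)" if "a \<in> A" for a using deg[of a] nA[OF that] that by simp
      show "12 * (card A + card B) \<le> 25 * card (nbr G b \<inter> A)" if "b \<in> B" for b using deg[of b] nB[OF that] that by simp
      show "100 * c + 20000 \<le> card A + card B" using m mn R(2) G(3) by simp
      fix S assume S: "S \<subseteq> verts G" "card S \<le> 4"
      have fS: "finite S" using S(1) simple_finite[OF G(1)] finite_subset by auto
      have "order (del G S) = order G - card S"
        using card_Diff_subset[OF fS S(1)] by simp
      then show "4 * esize (del G S) \<le> (order G - card S) * (order G - card S)"
        using N2[OF simple_del[OF G(1)] del_free[OF G(2)], of S] S(2) G(3) by simp
    qed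
    then show "\<exists>A B. near_bipartite G q r (4 * (q + r) + 20) A B" unfolding c_def by blast
  qed
qed

section \<open>Bipartite graphs with one additional vertex\<close>

lemma apex_nbr:
  assumes "simple_graph G" "parts (del G {z}) P Q"
  shows "nbr G z = (nbr G z \<inter> P) \<union> (nbr G z \<inter> Q)" "z \<notin> P" "z \<notin> Q"
proof -
  have "P \<union> Q = verts G - {z}" using assms by (simp add: parts_def)
  then show "nbr G z = (nbr G z \<inter> P) \<union> (nbr G z \<inter> Q)" "z \<notin> P" "z \<notin> Q"
    using nbr_subset[OF assms(1), of z] nbr_irrefl[OF assms(1), of z] by blast+
qed

lemma apex_card_edges:
  assumes G: "simple_graph G" and p: "parts (del G {z}) P Q"
  shows "esize G = esize (del G {z}) + card (nbr G z \<inter> P) + card (nbr G z \<inter> Q)"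
proof -
  have "deg G z = card (nbr G z \<inter> P) + card (nbr G z \<inter> Q)"
    by (subst apex_nbr(1)[OF G p], rule card_Un_disjoint)
       (use p finite_nbr[OF G] in \<open>auto simp: parts_def\<close>)
  then show ?thesis using card_edges_del_vertex[OF G, of z] by simp
qed

lemma apex_card_verts:
  assumes "simple_graph G" "parts (del G {z}) P Q" "z \<in> verts G"
  shows "order G = card P + card Q + 1"
  using parts_card[OF simple_del[OF assms(1)] assms(2)] card_del_vertex[OF assms(1,3)] by simp

text \<open>Otherwise \<open>z\<close> could be added to \<open>P\<close>. Exchanging the parts
  gives the claim for \<open>Q\<close>.\<close>

lemma apex_not_bipartite:
  assumes G: "simple_graph G" and p: "parts (del G {z}) P Q" and z: "z \<in> verts G" and nb: "\<not> bipartite G"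
  shows "nbr G z \<inter> P \<noteq> {}"
proof
  assume e: "nbr G z \<inter> P = {}"
  have n: "nbr (del G {z}) v = nbr G v - {z}" if "v \<noteq> z" for v using that by (simp add: nbr_del)
  have "parts G (insert z P) Q"
    unfolding parts_def
  proof (intro conjI ballI)
    show "insert z P \<union> Q = verts G" "insert z P \<inter> Q = {}" using p z by (auto simp: parts_def)
    fix v assume v: "v \<in> insert z P"
    have "z \<notin> nbr G v" using v e nbr_sym[of z G v] nbr_irrefl[OF G, of z] by auto
    moreover have "nbr G v \<inter> P \<subseteq> {z}"
    proof (cases "v = z")
      case False
      then have "nbr (del G {z}) v \<inter> P = {}" using v p by (auto simp: parts_def)
      then show ?thesis using n[OF False] by blast
    qed (use e in simp)
    ultimately show "nbr G v \<inter> insert z P = {}" by blast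
  next
    fix v assume v: "v \<in> Q"
    then have "v \<noteq> z" "nbr (del G {z}) v \<inter> Q = {}" using p apex_nbr[OF G p] by (auto simp: parts_def)
    then show "nbr G v \<inter> Q = {}" using n[of v] apex_nbr(3)[OF G p] by blast
  qed
  then show False using nb bipartite_iff_parts[OF G] by blast
qed

text \<open>Edges and pairs of neighbours of \<open>z\<close> are disjoint subsets of
  \<open>P \<times> Q\<close>. Equality in the count makes them complementary, which determines
  \<open>del G {z}\<close>.\<close>

lemma apex_no_triangle:
  assumes G: "simple_graph G" and p: "parts (del G {z}) P Q"
    and tf: "\<And>x y. x \<in> nbr G z \<inter> P \<Longrightarrow> y \<in> nbr G z \<inter> Q \<Longrightarrow> {x, y} \<notin> edges G"
  shows "esize (del G {z}) + card (nbr G z \<inter> P) * card (nbr G z \<inter> Q) \<le> card P * card Q"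
    and "x \<in> P \<Longrightarrow> y \<in> Q \<Longrightarrow> card P * card Q \<le> esize (del G {z}) + card (nbr G z \<inter> P) * card (nbr G z \<inter> Q) \<Longrightarrow>
      {x, y} \<in> edges G \<longleftrightarrow> \<not> (x \<in> nbr G z \<and> y \<in> nbr G z)"
proof -
  let ?E = "{(a, b). a \<in> P \<and> b \<in> Q \<and> {a, b} \<in> edges (del G {z})}"
  let ?N = "(nbr G z \<inter> P) \<times> (nbr G z \<inter> Q)"
  have fin: "finite P" "finite Q" using parts_finite[OF simple_del[OF G] p] by auto
  have E: "esize (del G {z}) = card ?E" by (rule card_edges_parts[OF simple_del[OF G] p])
  have sub: "?E \<union> ?N \<subseteq> P \<times> Q" by auto
  have disj: "?E \<inter> ?N = {}" using tf by (auto simp: del_def)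
  have fE: "finite ?E" by (rule finite_subset[of _ "P \<times> Q"]) (use fin in auto)
  have cu: "card (?E \<union> ?N) = esize (del G {z}) + card (nbr G z \<inter> P) * card (nbr G z \<inter> Q)"
    unfolding E using fE fin disj by (subst card_Un_disjoint) (auto simp: card_cartesian_product)
  show "esize (del G {z}) + card (nbr G z \<inter> P) * card (nbr G z \<inter> Q) \<le> card P * card Q"
    using card_mono[OF _ sub] fin cu by (simp add: card_cartesian_product)
  assume xy: "x \<in> P" "y \<in> Q" and c: "card P * card Q \<le> esize (del G {z}) + card (nbr G z \<inter> P) * card (nbr G z \<inter> Q)"
  have "?E \<union> ?N = P \<times> Q"
    by (rule card_seteq[OF _ sub]) (use fin c cu in \<open>auto simp: card_cartesian_product\<close>)
  then have "(x, y) \<in> ?E \<union> ?N" using xy by blast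
  then show "{x, y} \<in> edges G \<longleftrightarrow> \<not> (x \<in> nbr G z \<and> y \<in> nbr G z)"
    using tf[of x y] xy by (auto simp: del_def)
qed

text \<open>The assumption is \<open>(a - b)^2 \<le> 1\<close>.\<close>

lemma balanced:
  fixes a b :: nat
  assumes "(a + b) * (a + b) \<le> 4 * (a * b) + 1"
  shows "a = b \<or> a = Suc b \<or> b = Suc a"
proof -
  have "(int a - int b) * (int a - int b) \<le> 1"
    using assms by (auto simp: algebra_simps simp flip: of_nat_mult of_nat_add)
  then have "\<not> 2 \<le> int a - int b" "\<not> int a - int b \<le> -2"
    using mult_mono[of 2 "int a - int b" 2 "int a - int b"] mult_mono[of 2 "int b - int a" 2 "int b - int a"]
    by (auto simp: algebra_simps)
  then show ?thesis by linarith
qed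

lemma nat_half: "nat \<lceil>real n / 2\<rceil> = (n + 1) div 2" "nat \<lfloor>real n / 2\<rfloor> = n div 2"
proof -
  show "nat \<lfloor>real n / 2\<rfloor> = n div 2" by (simp add: floor_divide_of_nat_eq[of n 2, simplified])
  have "\<lceil>real n / 2\<rceil> = int ((n + 1) div 2)"
    by (rule ceiling_unique) (auto simp: field_simps; linarith)+
  then show "nat \<lceil>real n / 2\<rceil> = (n + 1) div 2" by simp
qed

lemma sum_le_mult: "a \<ge> 1 \<Longrightarrow> b \<ge> 1 \<Longrightarrow> a + b \<le> a * b + (1::nat)"
  by (cases a; cases b) auto

lemma apex_triangle_free_le:
  assumes G: "simple_graph G" and p: "parts (del G {z}) P Q" and z: "z \<in> verts G" and nb: "\<not> bipartite G"
    and tf: "\<And>x y. x \<in> nbr G z \<inter> P \<Longrightarrow> y \<in> nbr G z \<inter> Q \<Longrightarrow> {x, y} \<notin> edges G"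
  shows "esize G \<le> card P * card Q + 1"
proof -
  have "nbr G z \<inter> P \<noteq> {}" "nbr G z \<inter> Q \<noteq> {}"
    using apex_not_bipartite[OF G p z nb] apex_not_bipartite[OF G _ z nb, of Q P] p parts_sym by blast+
  then have "card (nbr G z \<inter> P) \<ge> 1" "card (nbr G z \<inter> Q) \<ge> 1"
    using finite_nbr[OF G] by (auto simp: Suc_le_eq card_gt_0_iff)
  then show ?thesis
    using apex_no_triangle(1)[OF G p tf] apex_card_edges[OF G p] sum_le_mult by fastforce
qed

lemma family_H_I:
  assumes "b = 0 \<or> even n \<and> b = 1" "finite X" "finite Y" "X \<inter> Y = {}"
    "card Y = nat \<lceil>real n / 2\<rceil> + b" "card X = nat \<lfloor>real n / 2\<rfloor> - b"
    "u1 \<in> Y" "u2 \<in> Y" "u1 \<noteq> u2" "X1 \<noteq> {}" "X1 \<subset> X"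
  shows "\<lparr>verts = X \<union> Y,
       edges = (edges (complete_bipartite X Y) \<union> {{u1, u2}})
                 - ({{u1, x} | x. x \<in> X - X1} \<union> {{u2, x} | x. x \<in> X1})\<rparr> \<in> family_H n"
  unfolding family_H_def mem_Collect_eq
  by (rule exI[of _ b], rule exI[of _ X], rule exI[of _ Y], rule exI[of _ X1], rule exI[of _ u1], rule exI[of _ u2])
    (use assms in simp)

text \<open>In the notation of \<open>family_H\<close>, \<open>X\<close> is \<open>Q\<close>,
  \<open>Y\<close> is \<open>insert z P\<close>, the added edge is \<open>{z, s}\<close>, and
  \<open>X1\<close> consists of the neighbours of \<open>z\<close> in \<open>Q\<close>.\<close>

lemma family_H_intro:
  fixes G :: "nat ugraph"
  assumes G: "simple_graph G" and p: "parts (del G {z}) P Q" and z: "z \<in> verts G"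
    and s: "nbr G z \<inter> P = {s}" and N: "nbr G z \<inter> Q \<noteq> {}" and nb: "nbr G s \<inter> Q \<noteq> {}"
    and e: "\<And>x y. x \<in> P \<Longrightarrow> y \<in> Q \<Longrightarrow> {x, y} \<in> edges G \<longleftrightarrow> \<not> (x \<in> nbr G z \<and> y \<in> nbr G z)"
    and bal: "card P = card Q \<or> card P = Suc (card Q) \<or> card Q = Suc (card P)"
  shows "G \<in> family_H (order G)"
proof -
  let ?N = "nbr G z \<inter> Q"
  note zn = apex_nbr[OF G p]
  have PQ: "P \<inter> Q = {}" "P \<union> Q = verts G - {z}" using p by (auto simp: parts_def)
  have sP: "s \<in> P" "s \<in> nbr G z" "s \<noteq> z" using s zn by auto
  let ?E = "(edges (complete_bipartite Q (insert z P)) \<union> {{z, s}}) - ({{z, x} | x. x \<in> Q - ?N} \<union> {{s, x} | x. x \<in> ?N})"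
  have "edges G = ?E"
  proof (intro subset_antisym subsetI)
    fix d assume d: "d \<in> edges G"
    show "d \<in> ?E"
    proof (cases "z \<in> d")
      case True
      then obtain x where x: "d = {z, x}" using simple_edgeE[OF G d] by (metis doubleton_eq_iff insertE singletonD)
      then have "x \<in> nbr G z" using d by (simp add: nbr_def)
      then have "x = s \<or> x \<in> ?N" using zn s by blast
      then show ?thesis using x sP zn(2,3) PQ by (auto simp: complete_bipartite_def doubleton_eq_iff)
    next
      case False
      obtain u v where uv: "d = {u, v}" using simple_edgeE[OF G d] by metis
      have "d \<in> edges (del G {z})" using d False by (simp add: del_def)
      then have "u \<in> P \<and> v \<in> Q \<or> u \<in> Q \<and> v \<in> P" using parts_edge[OF simple_del[OF G] p] uv by blast
      then obtain x y where xy: "d = {x, y}" "x \<in> P" "y \<in> Q" using uv by (auto simp: insert_commute)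
      then have "\<not> (x = s \<and> y \<in> ?N)" using d e sP by auto
      then show ?thesis using xy zn(2,3) PQ sP by (auto simp: complete_bipartite_def doubleton_eq_iff)
    qed
  next
    fix d assume d: "d \<in> ?E"
    then consider "d = {z, s}" | x y where "d = {x, y}" "x \<in> Q" "y \<in> insert z P"
      by (auto simp: complete_bipartite_def)
    then show "d \<in> edges G"
    proof cases
      case 1 then show ?thesis using sP by (simp add: nbr_def)
    next
      case (2 x y)
      show ?thesis
      proof (cases "y = z")
        case True
        then have "x \<in> ?N" using d 2 by (auto simp: insert_commute)
        then show ?thesis using 2 True by (simp add: nbr_def insert_commute)
      next
        case False
        then have "\<not> (y = s \<and> x \<in> ?N)" using d 2 by (auto simp: insert_commute)
        then have "\<not> (y \<in> nbr G z \<and> x \<in> nbr G z)" using s 2 False by blast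
        then show ?thesis using e[of y x] 2 False by (simp add: insert_commute)
      qed
    qed
  qed
  moreover have "verts G = Q \<union> insert z P" using PQ z by blast
  ultimately have eq: "G = \<lparr>verts = Q \<union> insert z P, edges = ?E\<rparr>"
    by (intro ugraph.equality) simp_all
  have fin: "finite P" "finite Q" using parts_finite[OF simple_del[OF G] p] by auto
  let ?n = "order G"
  have n: "?n = card P + card Q + 1" by (rule apex_card_verts[OF G p z])
  \<comment> \<open>The excess of \<open>card (insert z P)\<close> over the upper half of the order.
    It is 1 just when \<open>card P = Suc (card Q)\<close>, and then the order is even.\<close>
  define b where "b = card P + 1 - (?n + 1) div 2"
  have "b = 0 \<or> even ?n \<and> b = 1" "card (insert z P) = nat \<lceil>real ?n / 2\<rceil> + b" "card Q = nat \<lfloor>real ?n / 2\<rfloor> - b"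
    using bal zn(2,3) fin n unfolding nat_half b_def by auto
  note b = this
  obtain y where "y \<in> nbr G s \<inter> Q" using nb by blast
  then have "y \<in> Q" "y \<notin> nbr G z" using e[of s y] sP by (auto simp: nbr_def)
  then have "?N \<subset> Q" by blast
  then have "\<lparr>verts = Q \<union> insert z P, edges = ?E\<rparr> \<in> family_H ?n"
    by (intro family_H_I[OF b(1) _ _ _ b(2,3)]) (use fin PQ zn(2,3) sP N in auto)
  then show ?thesis by (rule back_subst[OF _ eq[symmetric]])
qed

lemma apex_extremal_family_H:
  fixes G :: "nat ugraph"
  assumes G: "simple_graph G" and p: "parts (del G {z}) P Q" and z: "z \<in> verts G" and nb: "\<not> bipartite G"
    and tf: "\<And>x y. x \<in> nbr G z \<inter> P \<Longrightarrow> y \<in> nbr G z \<inter> Q \<Longrightarrow> {x, y} \<notin> edges G"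
    and e: "order G * order G + 4 \<le> 4 * esize G + 2 * order G"
  shows "G \<in> family_H (order G)"
proof -
  have main: "G \<in> family_H (order G)"
    if p: "parts (del G {z}) P Q" and i: "card (nbr G z \<inter> P) = 1"
      and tf: "\<And>x y. x \<in> nbr G z \<inter> P \<Longrightarrow> y \<in> nbr G z \<inter> Q \<Longrightarrow> {x, y} \<notin> edges G" for P Q
  proof -
    obtain s where s: "nbr G z \<inter> P = {s}" using i by (auto simp: card_1_singleton_iff)
    have n: "order G = card P + card Q + 1" by (rule apex_card_verts[OF G p z])
    have le: "esize G \<le> card P * card Q + 1" by (rule apex_triangle_free_le[OF G p z nb tf])
    have e': "(card P + card Q) * (card P + card Q) + 3 \<le> 4 * esize G"
      using e unfolding n by (simp add: algebra_simps)
    have full: "card P * card Q \<le> esize (del G {z}) + card (nbr G z \<inter> P) * card (nbr G z \<inter> Q)"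
      using e' apex_card_edges[OF G p] four_mult_le[of "card P" "card Q"] i by simp
    have bal: "card P = card Q \<or> card P = Suc (card Q) \<or> card Q = Suc (card P)"
      using balanced[of "card P" "card Q"] e' le by simp
    have "nbr G s \<inter> Q \<noteq> {}"
    proof
      assume em: "nbr G s \<inter> Q = {}"
      have "s \<in> P" using s by blast
      then have sz: "s \<noteq> z" using apex_nbr(2)[OF G p] by auto
      \<comment> \<open>otherwise \<open>s\<close> could change sides, and \<open>G\<close> would be bipartite\<close>
      have "parts (del G {z}) (P - {s}) (insert s Q)"
        unfolding parts_def
      proof (intro conjI ballI)
        show "P - {s} \<union> insert s Q = verts (del G {z})" "(P - {s}) \<inter> insert s Q = {}"
          using p \<open>s \<in> P\<close> by (auto simp: parts_def)
        show "nbr (del G {z}) v \<inter> (P - {s}) = {}" if "v \<in> P - {s}" for v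
          using p that by (auto simp: parts_def)
        fix v assume v: "v \<in> insert s Q"
        have "nbr (del G {z}) s \<inter> insert s Q = {}"
          using em sz nbr_irrefl[OF G, of s] by (auto simp: nbr_del)
        moreover have "nbr (del G {z}) v \<inter> insert s Q = {}" if v: "v \<in> Q"
        proof -
          have "nbr (del G {z}) v \<inter> Q = {}" using p v by (auto simp: parts_def)
          moreover have "s \<notin> nbr (del G {z}) v"
            using em v nbr_sym[of s G v] by (auto simp: nbr_def del_def)
          ultimately show ?thesis by blast
        qed
        ultimately show "nbr (del G {z}) v \<inter> insert s Q = {}" using v by blast
      qed
      from apex_not_bipartite[OF G this z nb] show False using s by blast
    qed
    moreover have "nbr G z \<inter> Q \<noteq> {}"
      using apex_not_bipartite[OF G _ z nb, of Q P] p parts_sym by blast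
    ultimately show ?thesis
      by (intro family_H_intro[OF G p z s]) (use apex_no_triangle(2)[OF G p tf _ _ full] bal in auto)
  qed
  have "nbr G z \<inter> P \<noteq> {}" "nbr G z \<inter> Q \<noteq> {}"
    using apex_not_bipartite[OF G p z nb] apex_not_bipartite[OF G _ z nb, of Q P] p parts_sym by blast+
  then have ij: "card (nbr G z \<inter> P) \<ge> 1" "card (nbr G z \<inter> Q) \<ge> 1"
    using finite_nbr[OF G] by (auto simp: Suc_le_eq card_gt_0_iff)
  have n: "order G = card P + card Q + 1" by (rule apex_card_verts[OF G p z])
  have "(card P + card Q) * (card P + card Q) + 3 \<le> 4 * esize G"
    using e unfolding n by (simp add: algebra_simps)
  \<comment> \<open>For the two cardinalities \<open>i\<close>, \<open>j\<close> the edge count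
    gives \<open>4 (i + j - ij) \<ge> 3\<close>, hence \<open>i + j - ij \<ge> 1\<close> by
    integrality, that is \<open>(i - 1)(j - 1) \<le> 0\<close>.\<close>
  then have "card (nbr G z \<inter> P) * card (nbr G z \<inter> Q) + 1 \<le> card (nbr G z \<inter> P) + card (nbr G z \<inter> Q)"
    using apex_card_edges[OF G p] apex_no_triangle(1)[OF G p tf] four_mult_le[of "card P" "card Q"] by linarith
  then have "card (nbr G z \<inter> P) = 1 \<or> card (nbr G z \<inter> Q) = 1"
  proof -
    have "i = 1 \<or> j = 1" if "i * j + 1 \<le> i + j" "i \<ge> 1" "j \<ge> 1" for i j :: nat
      using that by (cases i; cases j) (auto)
    then show ?thesis using ij \<open>_ \<le> card (nbr G z \<inter> P) + _\<close> by blast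
  qed
  then show ?thesis
  proof
    assume "card (nbr G z \<inter> P) = 1" then show ?thesis using main[OF p _ tf] by blast
  next
    assume "card (nbr G z \<inter> Q) = 1"
    moreover have "parts (del G {z}) Q P" using p parts_sym by blast
    moreover have "{x, y} \<notin> edges G" if "x \<in> nbr G z \<inter> Q" "y \<in> nbr G z \<inter> P" for x y
      using tf[OF that(2,1)] by (simp add: insert_commute)
    ultimately show ?thesis using main by blast
  qed
qed

section \<open>Common form of the upper bounds\<close>

lemma edge_bound_of_parts:
  fixes a b e n :: nat
  assumes "n = a + b + 1" "e \<le> a * b + k"
  shows "4 * e + 2 * n \<le> n * n + 4 * k + 1"
proof -
  have "4 * e \<le> (a + b) * (a + b) + 4 * k" using four_mult_le[of a b] assms(2) by linarith
  then show ?thesis unfolding assms(1) by (simp add: algebra_simps)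
qed

text \<open>Everything is stated for \<open>4 e\<close>: the floor in the extremal numbers becomes a slack of 1, and
  the terms \<open>k n\<close> and \<open>l\<close> avoid subtraction.\<close>
definition eventually_extremal :: "nat \<Rightarrow> nat \<Rightarrow> nat \<Rightarrow> nat \<Rightarrow> (nat \<Rightarrow> nat ugraph set) \<Rightarrow> bool" where
  "eventually_extremal q r k l \<F> \<longleftrightarrow> (\<exists>N. \<forall>G :: nat ugraph. \<forall>n.
     simple_graph G \<and> order G = n \<and> \<not> has_theta G q r \<and> \<not> bipartite G \<and> N \<le> n \<longrightarrow>
       4 * esize G + k * n \<le> n * n + l + 1 \<and>
       (n * n + l \<le> 4 * esize G + k * n \<longrightarrow> (\<exists>H\<in>\<F> n. isomorphic G H)))"

text \<open>Below the lower bound in \<open>step\<close> both claims of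
  \<open>eventually_extremal\<close> are immediate, so \<open>step\<close> may assume it;
  \<open>k \<le> 4\<close> then puts \<open>G\<close> in the range of
  \<open>near_bipartite_exists\<close>.\<close>

lemma eventually_extremalI:
  assumes q: "even q" "q \<ge> 2" and r: "r \<ge> 2" and k: "k \<le> 4"
    and step: "\<And>(G :: nat ugraph) A B n. near_bipartite G q r (4 * (q + r) + 20) A B \<Longrightarrow> \<not> bipartite G \<Longrightarrow>
      order G = n \<Longrightarrow> n * n + l \<le> 4 * esize G + k * n \<Longrightarrow>
      4 * esize G + k * n \<le> n * n + l + 1 \<and> (\<exists>H\<in>\<F> n. isomorphic G H)"
  shows "eventually_extremal q r k l \<F>"
proof -
  obtain N where N: "\<And>G :: nat ugraph. simple_graph G \<Longrightarrow> \<not> has_theta G q r \<Longrightarrow> N \<le> order G \<Longrightarrow>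
      order G * order G \<le> 4 * esize G + 4 * order G \<Longrightarrow>
      \<exists>A B. near_bipartite G q r (4 * (q + r) + 20) A B"
    using near_bipartite_exists[OF q r, where 'a = nat] by auto
  show ?thesis
    unfolding eventually_extremal_def
  proof (intro exI[of _ N] allI impI, elim conjE)
    fix G :: "nat ugraph" and n
    assume G: "simple_graph G" "order G = n" "\<not> has_theta G q r" "\<not> bipartite G" "N \<le> n"
    show "4 * esize G + k * n \<le> n * n + l + 1 \<and>
      (n * n + l \<le> 4 * esize G + k * n \<longrightarrow> (\<exists>H\<in>\<F> n. isomorphic G H))"
    proof (cases "n * n + l \<le> 4 * esize G + k * n")
      case True
      then have "n * n \<le> 4 * esize G + 4 * n" using mult_le_mono1[OF k, of n] by linarith
      then obtain A B where "near_bipartite G q r (4 * (q + r) + 20) A B" using N[OF G(1,3)] G(2,5) by auto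
      from step[OF this G(4,2) True] show ?thesis by blast
    qed simp
  qed
qed

lemma eventually_extremalD:
  assumes "eventually_extremal q r k l \<F>"
  obtains N where "\<And>G :: nat ugraph. simple_graph G \<Longrightarrow> \<not> has_theta G q r \<Longrightarrow> \<not> bipartite G \<Longrightarrow>
    N \<le> order G \<Longrightarrow> 4 * esize G + k * order G \<le> order G * order G + l + 1"
  using assms unfolding eventually_extremal_def by metis

lemma isomorphic_refl: "isomorphic G G"
  unfolding isomorphic_def by (rule exI[of _ id]) simp

text \<open>A triangle formed by \<open>z\<close> and one vertex of each side would complete to
  \<open>\<theta>(1,2,r)\<close>, so the bounds for a triangle-free additional vertex apply.\<close>

lemma eventually_extremal_two_odd:
  assumes r: "odd r" "r \<ge> 2"
  shows "eventually_extremal 2 r 2 4 family_H"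
proof (rule eventually_extremalI[OF _ _ r(2)])
  fix G :: "nat ugraph" and A B n
  assume "near_bipartite G 2 r (4 * (2 + r) + 20) A B" and nb: "\<not> bipartite G" and n: "order G = n"
    and e: "n * n + 4 \<le> 4 * esize G + 2 * n"
  then interpret nb: near_bipartite G 2 r "4 * (2 + r) + 20" A B by blast
  obtain z where z: "z \<in> verts G" "parts (del G {z}) (side G A B - {z}) (side G B A - {z})"
    using nb.one_vertex[OF e[folded n] nb] by metis
  have tf: "{x, y} \<notin> edges G" if "x \<in> nbr G z \<inter> (side G A B - {z})" "y \<in> nbr G z \<inter> (side G B A - {z})" for x y
    using nb.no_triangle_odd[of x y z] r that by (auto simp: nbr_def)
  have "G \<in> family_H n" using apex_extremal_family_H[OF nb.G z(2,1) nb tf] e n by simp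
  moreover have "4 * esize G + 2 * n \<le> n * n + 4 * 1 + 1" unfolding n[symmetric]
    by (rule edge_bound_of_parts[OF apex_card_verts[OF nb.G z(2,1)] apex_triangle_free_le[OF nb.G z(2,1) nb tf]])
  ultimately show "4 * esize G + 2 * n \<le> n * n + 4 + 1 \<and> (\<exists>H\<in>family_H n. isomorphic G H)"
    using isomorphic_refl by auto
qed simp_all

section \<open>Isomorphisms onto the extremal graphs\<close>

lemma isomorphic_image:
  assumes G: "simple_graph G" and f: "inj_on f (verts G)" "verts H = f ` verts G" "edges H = (`) f ` edges G"
  shows "isomorphic G H"
  unfolding isomorphic_def
proof (intro exI conjI ballI)
  show "bij_betw f (verts G) (verts H)" using f by (simp add: bij_betw_def)
  fix u v assume uv: "u \<in> verts G" "v \<in> verts G"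
  show "{u, v} \<in> edges G \<longleftrightarrow> {f u, f v} \<in> edges H"
  proof
    assume "{f u, f v} \<in> edges H"
    then obtain e where e: "e \<in> edges G" "f ` e = f ` {u, v}" using f(3) by auto
    then have "e = {u, v}" using inj_on_image_eq_iff[OF f(1), of e "{u, v}"] edge_subset[OF G] uv by auto
    then show "{u, v} \<in> edges G" using e by simp
  next
    assume "{u, v} \<in> edges G"
    then have "f ` {u, v} \<in> edges H" unfolding f(3) by (rule imageI)
    then show "{f u, f v} \<in> edges H" by simp
  qed
qed

lemma image_complete_bipartite:
  "(`) f ` edges (complete_bipartite P Q) = edges (complete_bipartite (f ` P) (f ` Q))"
proof (intro subset_antisym subsetI)
  fix d assume "d \<in> (`) f ` edges (complete_bipartite P Q)"
  then obtain x y where "x \<in> P" "y \<in> Q" "d = {f x, f y}" by (auto simp: complete_bipartite_def)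
  then show "d \<in> edges (complete_bipartite (f ` P) (f ` Q))" by (auto simp: complete_bipartite_def)
next
  fix d assume "d \<in> edges (complete_bipartite (f ` P) (f ` Q))"
  then obtain x y where xy: "x \<in> P" "y \<in> Q" "d = {f x, f y}" by (auto simp: complete_bipartite_def)
  then have "{x, y} \<in> edges (complete_bipartite P Q)" by (auto simp: complete_bipartite_def)
  then have "f ` {x, y} \<in> (`) f ` edges (complete_bipartite P Q)" by (rule imageI)
  then show "d \<in> (`) f ` edges (complete_bipartite P Q)" using xy by simp
qed

lemma inj_on_UnI: "inj_on h A \<Longrightarrow> inj_on h B \<Longrightarrow> h ` A \<inter> h ` B = {} \<Longrightarrow> inj_on h (A \<union> B)"
  unfolding inj_on_Un by blast

lemma image_triangle: "(`) f ` edges (Defs.triangle x y z) = edges (Defs.triangle (f x) (f y) (f z))"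
  by (simp add: Defs.triangle_def)

lemma bij_betw_with_point:
  assumes "finite P" "finite T" "card P = card T" "x \<in> P" "t \<in> T"
  obtains f where "bij_betw f P T" "f x = t"
proof -
  have "card (P - {x}) = card (T - {t})" using assms by simp
  then obtain g where g: "bij_betw g (P - {x}) (T - {t})"
    using finite_same_card_bij[of "P - {x}" "T - {t}"] assms by auto
  have "bij_betw (g(x := t)) (P - {x}) (T - {t})"
    using g bij_betw_cong[of "P - {x}" "g(x := t)" g "T - {t}"] by simp
  then have "bij_betw (g(x := t)) ((P - {x}) \<union> {x}) ((T - {t}) \<union> {(g(x := t)) x})"
    by (rule notIn_Un_bij_betw[rotated 2]) auto
  then show ?thesis using that[of "g(x := t)"] assms by (simp add: insert_absorb)
qed

lemma edges_of_complete_parts: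
  assumes G: "simple_graph G" and p: "parts (del G R) P Q"
    and full: "\<And>x y. x \<in> P \<Longrightarrow> y \<in> Q \<Longrightarrow> {x, y} \<in> edges G"
  shows "edges (del G R) = edges (complete_bipartite P Q)"
proof -
  have "P \<inter> R = {}" "Q \<inter> R = {}" using p by (auto simp: parts_def)
  then have "{x, y} \<in> edges (del G R)" if "x \<in> P" "y \<in> Q" for x y
    using full[OF that] that by (auto simp: del_def)
  moreover have "\<exists>x y. e = {x, y} \<and> x \<in> P \<and> y \<in> Q" if e: "e \<in> edges (del G R)" for e
  proof -
    obtain u v where uv: "e = {u, v}" using simple_edgeE[OF simple_del[OF G] e] by metis
    then have "u \<in> P \<and> v \<in> Q \<or> u \<in> Q \<and> v \<in> P" using parts_edge[OF simple_del[OF G] p] e by blast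
    then show ?thesis using uv by (metis insert_commute)
  qed
  ultimately show ?thesis by (fastforce simp: complete_bipartite_def)
qed

lemma edges_split: "edges G = edges (del G R) \<union> {e \<in> edges G. e \<inter> R \<noteq> {}}"
  by (auto simp: del_def)

lemma edges_at: "simple_graph G \<Longrightarrow> {e \<in> edges G. e \<inter> {z} \<noteq> {}} = (\<lambda>u. {z, u}) ` nbr G z"
proof (intro subset_antisym subsetI)
  fix e assume G: "simple_graph G" and e: "e \<in> {e \<in> edges G. e \<inter> {z} \<noteq> {}}"
  then obtain u v where "e = {u, v}" using simple_edgeE[OF G, of e] by (metis (no_types, lifting) mem_Collect_eq)
  then obtain w where "e = {z, w}" using e by (auto simp: insert_commute)
  then show "e \<in> (\<lambda>u. {z, u}) ` nbr G z" using e by (auto simp: nbr_def)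
qed (auto simp: nbr_def)

text \<open>Reproduces the numbering of \<open>K_circ_K3\<close> and \<open>K_bullet_K3\<close>: the
  triangle is attached at \<open>card P\<close>, and for \<open>K_bullet_K3\<close> also at 0; the
  vertices of \<open>Z\<close> come after both parts. The claim on \<open>x\<close> is conditional
  because \<open>K_circ_K3\<close> has no marked vertex in \<open>P\<close>.\<close>

lemma parts_numbering:
  fixes k :: "'a \<Rightarrow> nat"
  assumes fin: "finite P" "finite Q" and disj: "P \<inter> Q = {}" "Z \<inter> (P \<union> Q) = {}"
    and k: "inj_on k Z" "\<forall>z\<in>Z. card P + card Q \<le> k z" and y: "y \<in> Q"
  obtains h where "h ` P = {..<card P}" "h ` Q = {card P..<card P + card Q}" "inj_on h (P \<union> Q \<union> Z)"
    "x \<in> P \<longrightarrow> h x = 0" "h y = card P" "\<forall>z\<in>Z. h z = k z"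
proof -
  let ?a = "card P" and ?b = "card Q"
  have "?b > 0" using fin y by (auto simp: card_gt_0_iff)
  obtain f where f: "bij_betw f P {..<?a}" "x \<in> P \<Longrightarrow> f x = 0"
  proof (cases "x \<in> P")
    case True
    then have "?a > 0" using fin by (auto simp: card_gt_0_iff)
    then show ?thesis using bij_betw_with_point[of P "{..<?a}" x 0] fin True that by auto
  next
    case False
    then show ?thesis using finite_same_card_bij[of P "{..<?a}"] fin that by auto
  qed
  obtain g where g: "bij_betw g Q {?a..<?a + ?b}" "g y = ?a"
    using bij_betw_with_point[of Q "{?a..<?a + ?b}" y ?a] fin y \<open>?b > 0\<close> by auto
  define h where "h v = (if v \<in> P then f v else if v \<in> Q then g v else k v)" for v
  have hf: "h v = f v" if "v \<in> P" for v using that by (simp add: h_def)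
  have hg: "h v = g v" if "v \<in> Q" for v using that disj by (auto simp: h_def)
  have hk: "h v = k v" if "v \<in> Z" for v using that disj by (auto simp: h_def)
  have hP: "h ` P = {..<?a}" "inj_on h P"
    using f inj_on_cong[of P h f] image_cong[of P P h f] hf by (auto simp: bij_betw_def)
  have hQ: "h ` Q = {?a..<?a + ?b}" "inj_on h Q"
    using g inj_on_cong[of Q h g] image_cong[of Q Q h g] hg by (auto simp: bij_betw_def)
  have hZ: "inj_on h Z" using k(1) inj_on_cong[of Z h k] hk by simp
  have "h ` (P \<union> Q) \<inter> h ` Z = {}"
  proof -
    have "h ` (P \<union> Q) \<subseteq> {..<?a + ?b}" unfolding image_Un hP(1) hQ(1) by auto
    moreover have "h ` Z \<inter> {..<?a + ?b} = {}" using hk k(2) by force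
    ultimately show ?thesis by blast
  qed
  moreover have "h ` P \<inter> h ` Q = {}" unfolding hP(1) hQ(1) by auto
  ultimately have "inj_on h (P \<union> Q \<union> Z)" by (intro inj_on_UnI hP(2) hQ(2) hZ)
  then show ?thesis
    by (rule that[OF hP(1) hQ(1)]) (use hf hg hk f(2) g(2) y in simp_all)
qed

lemma isomorphic_K_bullet:
  assumes G: "simple_graph G" and p: "parts (del G {z}) P Q" and z: "z \<in> verts G"
    and full: "\<And>x y. x \<in> P \<Longrightarrow> y \<in> Q \<Longrightarrow> {x, y} \<in> edges G"
    and N: "nbr G z = {x, y}" "x \<in> P" "y \<in> Q"
  shows "isomorphic G (K_bullet_K3 (card P) (card Q))"
proof -
  have fin: "finite P" "finite Q" using parts_finite[OF simple_del[OF G] p] by auto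
  have V: "verts G = P \<union> Q \<union> {z}" "P \<inter> Q = {}" "z \<notin> P" "z \<notin> Q" using p z by (auto simp: parts_def)
  let ?a = "card P" and ?b = "card Q"
  have "?a > 0" "?b > 0" using fin N by (auto simp: card_gt_0_iff)
  obtain h where hP: "h ` P = {..<?a}" and hQ: "h ` Q = {?a..<?a + ?b}" and inj: "inj_on h (verts G)"
    and hx: "h x = 0" "h y = ?a" and hz: "h z = ?a + ?b"
    using parts_numbering[OF fin V(2), of "{z}" "\<lambda>_. ?a + ?b" y x] V N by auto
  have "{e \<in> edges G. e \<inter> {z} \<noteq> {}} = {{z, x}, {z, y}}"
    using edges_at[OF G, of z] N by simp
  then have "edges G = edges (complete_bipartite P Q) \<union> {{z, x}, {z, y}}"
    using edges_split[of G "{z}"] edges_of_complete_parts[OF G p full] by simp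
  moreover have "{x, y} \<in> edges (complete_bipartite P Q)" using N by (auto simp: complete_bipartite_def)
  ultimately have E: "edges G = edges (complete_bipartite P Q) \<union> edges (Defs.triangle x y z)"
    by (auto simp: Defs.triangle_def insert_commute)
  show ?thesis
  proof (rule isomorphic_image[OF G inj])
    show "verts (K_bullet_K3 ?a ?b) = h ` verts G"
      unfolding V image_Un hP hQ using hz \<open>?a > 0\<close> \<open>?b > 0\<close>
      by (auto simp: K_bullet_K3_def graph_union_def complete_bipartite_def Defs.triangle_def)
    show "edges (K_bullet_K3 ?a ?b) = (`) h ` edges G"
      unfolding E image_Un image_complete_bipartite image_triangle hP hQ hx hz
      by (simp add: K_bullet_K3_def graph_union_def)
  qed
qed

lemma isomorphic_K_circ:
  assumes G: "simple_graph G" and p: "parts (del G {z1, z2}) P Q" and z: "z1 \<in> verts G" "z2 \<in> verts G" "z1 \<noteq> z2"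
    and full: "\<And>x y. x \<in> P \<Longrightarrow> y \<in> Q \<Longrightarrow> {x, y} \<in> edges G"
    and N: "nbr G z1 = {z2, y}" "nbr G z2 = {z1, y}" "y \<in> Q"
  shows "isomorphic G (K_circ_K3 (card P) (card Q))"
proof -
  have fin: "finite P" "finite Q" using parts_finite[OF simple_del[OF G] p] by auto
  have V: "verts G = P \<union> Q \<union> {z1, z2}" "P \<inter> Q = {}" "z1 \<notin> P" "z1 \<notin> Q" "z2 \<notin> P" "z2 \<notin> Q"
    using p z by (auto simp: parts_def)
  let ?a = "card P" and ?b = "card Q"
  have "?b > 0" using fin N by (auto simp: card_gt_0_iff)
  define k where "k v = (if v = z1 then ?a + ?b else ?a + ?b + 1)" for v
  have k: "{z1, z2} \<inter> (P \<union> Q) = {}" "inj_on k {z1, z2}" "\<forall>v\<in>{z1, z2}. ?a + ?b \<le> k v"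
    using V z(3) by (auto simp: k_def)
  obtain h where hP: "h ` P = {..<?a}" and hQ: "h ` Q = {?a..<?a + ?b}" and inj: "inj_on h (verts G)"
    and hx: "h y = ?a" and hk: "\<forall>v\<in>{z1, z2}. h v = k v"
    unfolding V(1) using parts_numbering[OF fin V(2) k N(3), of y] by metis
  have hz: "h z1 = ?a + ?b" "h z2 = ?a + ?b + 1" using hk z(3) by (simp_all add: k_def)
  have "{e \<in> edges G. e \<inter> {z1, z2} \<noteq> {}} = {{z1, z2}, {z1, y}, {z2, y}}"
  proof -
    have "{e \<in> edges G. e \<inter> {z1, z2} \<noteq> {}} = {e \<in> edges G. e \<inter> {z1} \<noteq> {}} \<union> {e \<in> edges G. e \<inter> {z2} \<noteq> {}}"
      by blast
    then show ?thesis unfolding edges_at[OF G] N by (auto simp: insert_commute)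
  qed
  then have E: "edges G = edges (complete_bipartite P Q) \<union> edges (Defs.triangle y z1 z2)"
    using edges_split[of G "{z1, z2}"] edges_of_complete_parts[OF G p full]
    by (auto simp: Defs.triangle_def insert_commute)
  show ?thesis
  proof (rule isomorphic_image[OF G inj])
    show "verts (K_circ_K3 ?a ?b) = h ` verts G"
      unfolding V image_Un hP hQ using hz \<open>?b > 0\<close>
      by (auto simp: K_circ_K3_def graph_union_def complete_bipartite_def Defs.triangle_def)
    show "edges (K_circ_K3 ?a ?b) = (`) h ` edges G"
      unfolding E image_Un image_complete_bipartite image_triangle hP hQ hx hz
      by (simp add: K_circ_K3_def graph_union_def)
  qed
qed

section \<open>Upper bounds\<close>

lemma eventually_extremal_even:
  assumes q: "even q" "q \<ge> 2" and r: "even r" "r \<ge> 4"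
  shows "eventually_extremal q r 2 8 (\<lambda>n. {K_bullet_K3 (n div 2) ((n - 1) div 2)})"
proof (rule eventually_extremalI[OF q])
  fix G :: "nat ugraph" and A B n
  assume "near_bipartite G q r (4 * (q + r) + 20) A B" and nb: "\<not> bipartite G" and n0: "order G = n"
    and e0: "n * n + 8 \<le> 4 * esize G + 2 * n"
  then interpret nb: near_bipartite G q r "4 * (q + r) + 20" A B by blast
  have "order G * order G + 4 \<le> 4 * esize G + 2 * order G" using e0 n0 by simp
  then obtain z where z: "z \<in> verts G" "parts (del G {z}) (side G A B - {z}) (side G B A - {z})"
    using nb.one_vertex[OF _ nb] by metis
  define P where "P = side G A B - {z}"
  define Q where "Q = side G B A - {z}"
  have p: "parts (del G {z}) P Q" using z by (simp add: P_def Q_def)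
  have n: "n = card P + card Q + 1" using apex_card_verts[OF nb.G p z(1)] n0 by simp
  \<comment> \<open>Without a triangle at \<open>z\<close> there are at most
    \<open>|P||Q| + 1\<close> edges, which is short of the assumed bound: \<open>l = 8\<close>
    corresponds to \<open>|P||Q| + 2\<close>.\<close>
  have "\<exists>x y. x \<in> nbr G z \<inter> P \<and> y \<in> nbr G z \<inter> Q \<and> {x, y} \<in> edges G"
  proof (rule ccontr)
    assume "\<not> ?thesis"
    then have tf: "{x, y} \<notin> edges G" if "x \<in> nbr G z \<inter> P" "y \<in> nbr G z \<inter> Q" for x y
      using that by blast
    have "esize G \<le> card P * card Q + 1" by (rule apex_triangle_free_le[OF nb.G p z(1) nb tf])
    from edge_bound_of_parts[OF n this] show False using e0 by simp
  qed
  then obtain x y where x: "x \<in> nbr G z" "x \<in> P" and y: "y \<in> nbr G z" "y \<in> Q" and xy: "{x, y} \<in> edges G" by blast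
  have "y' = y" if "y' \<in> nbr G z \<inter> Q" for y'
    using nb.no_triangle_even[OF r, of x y y' z] x y xy that by (auto simp: P_def Q_def nbr_def)
  then have NQ: "nbr G z \<inter> Q = {y}" using y by blast
  have "x' = x" if "x' \<in> nbr G z \<inter> P" for x'
    using near_bipartite.no_triangle_even[OF nb.swap r, of y x x' z] x y xy that
    by (auto simp: P_def Q_def nbr_def insert_commute)
  then have NP: "nbr G z \<inter> P = {x}" using x by blast
  have Nz: "nbr G z = {x, y}" using apex_nbr(1)[OF nb.G p] NP NQ by auto
  have e: "esize G = esize (del G {z}) + 2"
    using apex_card_edges[OF nb.G p] NP NQ by simp
  have le: "esize (del G {z}) \<le> card P * card Q"
    by (rule card_edges_parts_le[OF simple_del[OF nb.G] p])
  have "esize G \<le> card P * card Q + 2" using e le by simp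
  from edge_bound_of_parts[OF n this] have 1: "4 * esize G + 2 * n \<le> n * n + 8 + 1" by simp
  have sq: "(card P + card Q) * (card P + card Q) \<le> 4 * esize (del G {z}) + 1"
    using e0 e unfolding n by (simp add: algebra_simps)
  then have ge: "card P * card Q \<le> esize (del G {z})" using four_mult_le[of "card P" "card Q"] by simp
  have full: "{u, v} \<in> edges G" if "u \<in> P" "v \<in> Q" for u v
    using edges_eq_of_card[OF simple_del[OF nb.G] p ge that] edges_del_subset by blast
  have bal: "card P = card Q \<or> card P = Suc (card Q) \<or> card Q = Suc (card P)"
    by (rule balanced) (use sq le in simp)
  have "isomorphic G (K_bullet_K3 (n div 2) ((n - 1) div 2))"
  proof (cases "card Q \<le> card P")
    case True
    then have "card P = n div 2" "card Q = (n - 1) div 2" using bal n by auto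
    then show ?thesis using isomorphic_K_bullet[OF nb.G p z(1) full Nz x(2) y(2)] by simp
  next
    case False
    then have "card Q = n div 2" "card P = (n - 1) div 2" using bal n by auto
    moreover have "{u, v} \<in> edges G" if "u \<in> Q" "v \<in> P" for u v
      using full[OF that(2,1)] by (simp add: insert_commute)
    moreover have "nbr G z = {y, x}" using Nz by (simp add: insert_commute)
    ultimately show ?thesis
      using isomorphic_K_bullet[OF nb.G p[unfolded parts_sym[of _ P Q]] z(1) _ _ y(2) x(2)] by simp
  qed
  then show "4 * esize G + 2 * n \<le> n * n + 8 + 1 \<and>
      (\<exists>H\<in>{K_bullet_K3 (n div 2) ((n - 1) div 2)}. isomorphic G H)" using 1 by blast
qed (use r in simp_all)

text \<open>The constants come from \<open>n = |P| + |Q| + 2\<close> and \<open>|P||Q| + 3\<close>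
  edges: \<open>(n - 2)^2 = n^2 - 4 n + 4\<close>, and \<open>4 * 3 + 4\<close> less the slack of 1
  is 15.\<close>

lemma eventually_extremal_odd:
  assumes q: "even q" "q \<ge> 4" and r: "odd r" "r \<ge> 2"
  shows "eventually_extremal q r 4 15
    (\<lambda>n. {K_circ_K3 ((n - 1) div 2) ((n - 2) div 2), K_circ_K3 ((n - 2) div 2) ((n - 1) div 2)})"
    (is "eventually_extremal _ _ _ _ ?\<F>")
proof (rule eventually_extremalI[OF q(1) _ r(2)])
  fix G :: "nat ugraph" and A B n
  assume "near_bipartite G q r (4 * (q + r) + 20) A B" and nb: "\<not> bipartite G" and n0: "order G = n"
    and e0: "n * n + 15 \<le> 4 * esize G + 4 * n"
  then interpret nb: near_bipartite G q r "4 * (q + r) + 20" A B by blast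
  have "order G * order G + 8 \<le> 4 * esize G + 4 * order G" using e0 n0 by simp
  from nb.two_vertices[OF q(2) r(1) this nb] obtain z1 z2 y where
    z: "z1 \<in> verts G" "z2 \<in> verts G" "z1 \<noteq> z2" and
    p0: "parts (del G {z1, z2}) (side G A B - {z1, z2}) (side G B A - {z1, z2})" and
    y: "y \<in> side G A B \<union> side G B A" "y \<noteq> z1" "y \<noteq> z2" and
    Nz: "nbr G z1 = {z2, y}" "nbr G z2 = {z1, y}" by metis
  obtain P Q where p: "parts (del G {z1, z2}) P Q" "y \<in> Q"
    using p0 y parts_sym[of "del G {z1, z2}" "side G A B - {z1, z2}"] by blast
  have n: "n = card P + card Q + 2"
    using parts_card[OF simple_del[OF nb.G] p(1)] card_Diff_subset[of "{z1, z2}" "verts G"] z n0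
      card_mono[OF simple_finite[OF nb.G], of "{z1, z2}"] by simp
  have "esize G = esize (del G {z1}) + 2"
    using card_edges_del_vertex[OF nb.G, of z1] Nz y by simp
  moreover have "nbr (del G {z1}) z2 = {y}" using nbr_del[of z2 "{z1}" G] Nz z y by auto
  then have "esize (del G {z1}) = esize (del G {z1, z2}) + 1"
    using card_edges_del_vertex[OF simple_del[OF nb.G], of "{z1}" z2] by (simp add: del_del insert_commute)
  ultimately have e: "esize G = esize (del G {z1, z2}) + 3" by simp
  have le: "esize (del G {z1, z2}) \<le> card P * card Q"
    by (rule card_edges_parts_le[OF simple_del[OF nb.G] p(1)])
  have 1: "4 * esize G + 4 * n \<le> n * n + 15 + 1"
    using e le four_mult_le[of "card P" "card Q"] unfolding n by (simp add: algebra_simps)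
  have sq: "(card P + card Q) * (card P + card Q) \<le> 4 * esize (del G {z1, z2}) + 1"
    using e0 e unfolding n by (simp add: algebra_simps)
  then have ge: "card P * card Q \<le> esize (del G {z1, z2})" using four_mult_le[of "card P" "card Q"] by simp
  have full: "{u, v} \<in> edges G" if "u \<in> P" "v \<in> Q" for u v
    using edges_eq_of_card[OF simple_del[OF nb.G] p(1) ge that] edges_del_subset by blast
  have bal: "card P = card Q \<or> card P = Suc (card Q) \<or> card Q = Suc (card P)"
    by (rule balanced) (use sq le in simp)
  have "isomorphic G (K_circ_K3 (card P) (card Q))"
    by (rule isomorphic_K_circ[OF nb.G p(1) z full Nz p(2)])
  moreover have "card P = (n - 1) div 2 \<and> card Q = (n - 2) div 2 \<or> card P = (n - 2) div 2 \<and> card Q = (n - 1) div 2"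
    using bal n by auto
  ultimately show "4 * esize G + 4 * n \<le> n * n + 15 + 1 \<and> (\<exists>H\<in>?\<F> n. isomorphic G H)"
    using 1 by auto
qed (use q in simp_all)

section \<open>The case \<open>q = r = 2\<close>\<close>

lemma has_theta_two_two:
  assumes G: "simple_graph G" and "{u, v} \<in> edges G" "{u, x} \<in> edges G" "{v, x} \<in> edges G" "{u, y} \<in> edges G" "{v, y} \<in> edges G" "x \<noteq> y"
  shows "has_theta G 2 2"
proof -
  have "is_path G (u # [x] @ [v])" "is_path G (u # [y] @ [v])"
    using assms simple_edge(3)[OF G] by (fastforce simp: is_path_Cons insert_commute)+
  then show ?thesis unfolding has_theta_def using assms
    by (intro exI[of _ u] exI[of _ v] exI[of _ "[x]"] exI[of _ "[y]"]) auto
qed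

lemma nat_half_minus:
  assumes "n \<ge> k"
  shows "nat \<lceil>(real n - real k) / 2\<rceil> = (n - k + 1) div 2" "nat \<lfloor>(real n - real k) / 2\<rfloor> = (n - k) div 2"
  using nat_half[of "n - k"] assms by (simp_all add: of_nat_diff)

lemma family_G_I:
  assumes "finite X" "finite Y" "X \<inter> Y = {}"
    "card X = nat \<lceil>(real n - 3) / 2\<rceil>" "card Y = nat \<lfloor>(real n - 3) / 2\<rfloor>"
    "distinct [w1, w2, w3]" "{w1, w2, w3} \<inter> (X \<union> Y) = {}" "X1 \<subseteq> X" "Y1 \<subseteq> Y" "card X1 * card Y1 \<le> 1"
  shows "\<lparr>verts = X \<union> Y \<union> {w1, w2, w3},
       edges = edges (complete_bipartite X Y) \<union> edges (Defs.triangle w1 w2 w3)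
                 \<union> {{w1, x} | x. x \<in> X - X1} \<union> {{w2, y} | y. y \<in> Y - Y1}
                 \<union> {{w3, z} | z. z \<in> X1 \<union> Y1}\<rparr> \<in> family_G n"
  unfolding family_G_def mem_Collect_eq
  by (rule exI[of _ X], rule exI[of _ Y], rule exI[of _ X1], rule exI[of _ Y1], rule exI[of _ w1],
      rule exI[of _ w2], rule exI[of _ w3]) (use assms in simp)

text \<open>The triangle vertices \<open>a\<close>, \<open>b\<close>, \<open>c\<close> are
  \<open>w1\<close>, \<open>w2\<close>, \<open>w3\<close> of the family, and the neighbours of
  \<open>c\<close> in \<open>X\<close> and \<open>Y\<close> are the sets \<open>X1\<close> and
  \<open>Y1\<close>.\<close>

lemma family_G_intro:
  assumes G: "simple_graph G" and V: "verts G = X \<union> Y \<union> {a, b, c}" "X \<inter> Y = {}" and d: "distinct [a, b, c]" "{a, b, c} \<inter> (X \<union> Y) = {}"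
    and E: "edges (del G {a, b, c}) = edges (complete_bipartite X Y)"
    and T: "{a, b} \<in> edges G" "{b, c} \<in> edges G" "{a, c} \<in> edges G"
    and N: "nbr G a \<inter> Y = {}" "nbr G b \<inter> X = {}" "\<And>x. x \<in> X \<Longrightarrow> x \<in> nbr G a \<longleftrightarrow> x \<notin> nbr G c"
      "\<And>y. y \<in> Y \<Longrightarrow> y \<in> nbr G b \<longleftrightarrow> y \<notin> nbr G c"
    and c1: "card (nbr G c \<inter> X) * card (nbr G c \<inter> Y) \<le> 1"
    and cX: "card Y \<le> card X" "card X \<le> Suc (card Y)"
  shows "G \<in> family_G (order G)"
proof -
  let ?X1 = "nbr G c \<inter> X" and ?Y1 = "nbr G c \<inter> Y" and ?n = "order G"
  have fin: "finite X" "finite Y" using simple_finite[OF G] V by auto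
  have "card {a, b, c} = 3" using d by simp
  then have n: "?n = card X + card Y + 3"
    unfolding V(1) using fin d V(2) by (simp add: card_Un_disjoint Int_commute)
  have nb: "nbr G v \<subseteq> X \<union> Y \<union> {a, b, c}" for v using nbr_subset[OF G] V by blast
  have irr: "v \<notin> nbr G v" for v by (rule nbr_irrefl[OF G])
  have na: "nbr G a = {b, c} \<union> (X - ?X1)"
    using nb[of a] irr[of a] N T by (auto simp: nbr_iff[of _ _ a] insert_commute)
  have nbb: "nbr G b = {a, c} \<union> (Y - ?Y1)"
    using nb[of b] irr[of b] N T by (auto simp: nbr_iff[of _ _ b] insert_commute)
  have nc: "nbr G c = {a, b} \<union> (?X1 \<union> ?Y1)"
    using nb[of c] irr[of c] T by (auto simp: nbr_iff[of _ _ c] insert_commute)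
  let ?E = "edges (complete_bipartite X Y) \<union> edges (Defs.triangle a b c)
                 \<union> {{a, x} | x. x \<in> X - ?X1} \<union> {{b, y} | y. y \<in> Y - ?Y1} \<union> {{c, z} | z. z \<in> ?X1 \<union> ?Y1}"
  have ia: "(\<lambda>u. {a, u}) ` nbr G a = {{a, b}, {a, c}} \<union> (\<lambda>x. {a, x}) ` (X - ?X1)"
    by (subst na) (simp add: image_Un)
  have ib: "(\<lambda>u. {b, u}) ` nbr G b = {{b, a}, {b, c}} \<union> (\<lambda>y. {b, y}) ` (Y - ?Y1)"
    by (subst nbb) (simp add: image_Un)
  have ic: "(\<lambda>u. {c, u}) ` nbr G c = {{c, a}, {c, b}} \<union> (\<lambda>z. {c, z}) ` (?X1 \<union> ?Y1)"
    by (subst nc) (simp only: image_Un image_insert image_empty)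
  have un: "{{a, b}, {a, c}} \<union> S1 \<union> ({{b, a}, {b, c}} \<union> S2) \<union> ({{c, a}, {c, b}} \<union> S3)
      = edges (Defs.triangle a b c) \<union> S1 \<union> S2 \<union> S3" for S1 S2 S3
    by (auto simp: Defs.triangle_def insert_commute)
  have "{e \<in> edges G. e \<inter> {a, b, c} \<noteq> {}} = (\<lambda>u. {a, u}) ` nbr G a \<union> (\<lambda>u. {b, u}) ` nbr G b \<union> (\<lambda>u. {c, u}) ` nbr G c"
    unfolding edges_at[OF G, symmetric] by blast
  also have "\<dots> = edges (Defs.triangle a b c)
                 \<union> (\<lambda>x. {a, x}) ` (X - ?X1) \<union> (\<lambda>y. {b, y}) ` (Y - ?Y1) \<union> (\<lambda>z. {c, z}) ` (?X1 \<union> ?Y1)"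
    unfolding ia ib ic by (rule un)
  finally have "edges G = ?E" unfolding Setcompr_eq_image E[symmetric] Un_assoc
    using edges_split[of G "{a, b, c}"] by simp
  then have eq: "G = \<lparr>verts = X \<union> Y \<union> {a, b, c}, edges = ?E\<rparr>"
    using V(1) by (intro ugraph.equality) simp_all
  have h: "card X = nat \<lceil>(real ?n - 3) / 2\<rceil>" "card Y = nat \<lfloor>(real ?n - 3) / 2\<rfloor>"
    using nat_half_minus[of 3 ?n] cX n by auto
  have "\<lparr>verts = X \<union> Y \<union> {a, b, c}, edges = ?E\<rparr> \<in> family_G ?n"
    by (rule family_G_I[OF fin V(2) h d _ _ c1]) auto
  then show ?thesis by (rule back_subst[OF _ eq[symmetric]])
qed


text \<open>A graph that is also free of \<open>\<theta>(1,2,3)\<close> obeys the smaller bound with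
  \<open>l = 4\<close>, so only graphs containing \<open>\<theta>(1,2,3)\<close>, and hence a
  triangle, remain. Their edges split into 3 inside the triangle, at most \<open>n - 3\<close>
  leaving it and at most \<open>(n - 3)^2/4\<close> off it; reaching the lower bound makes the last
  two numbers maximal.\<close>

lemma eventually_extremal_two_two: "eventually_extremal 2 2 2 8 family_G"
proof -
  obtain N1 where N1: "\<And>G :: nat ugraph. simple_graph G \<Longrightarrow> \<not> has_theta G 2 3 \<Longrightarrow> \<not> bipartite G \<Longrightarrow> N1 \<le> order G \<Longrightarrow>
    4 * esize G + 2 * order G \<le> order G * order G + 4 + 1"
    using eventually_extremalD[OF eventually_extremal_two_odd[of 3]] by auto
  obtain N2 where N2: "\<And>G :: nat ugraph. simple_graph G \<Longrightarrow> \<not> has_theta G 2 2 \<Longrightarrow> N2 \<le> order G \<Longrightarrow>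
     4 * esize G \<le> order G * order G \<and>
     (order G * order G \<le> 4 * esize G + 1 \<longrightarrow> bipartite G)"
    using extremal_number[of 2 2, where 'a = nat] by auto
  have "4 * esize G + 2 * n \<le> n * n + 8 + 1 \<and>
      (n * n + 8 \<le> 4 * esize G + 2 * n \<longrightarrow> (\<exists>H\<in>family_G n. isomorphic G H))"
    if G: "simple_graph G" "\<not> has_theta G 2 2" "\<not> bipartite G" "N1 + N2 + 20 \<le> n" and n: "order G = n"
    for G :: "nat ugraph" and n
  proof (cases "has_theta G 2 3")
    case False
    then show ?thesis using N1[OF G(1) False G(3)] G(4) n by simp
  next
    case True
    then obtain a v p where "{a, v} \<in> edges G" "is_path G (a # p @ [v])" "Suc (length p) = 2"
      unfolding has_theta_def by blast
    moreover from this obtain b where "p = [b]" by (cases p) auto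
    ultimately have "\<exists>a b c. {a, b} \<in> edges G \<and> {b, c} \<in> edges G \<and> {a, c} \<in> edges G"
      by (auto simp: is_path_Cons)
    then obtain a b c where T: "{a, b} \<in> edges G" "{b, c} \<in> edges G" "{a, c} \<in> edges G" by blast
    define T3 where "T3 = {a, b, c}"
    have d: "distinct [a, b, c]" using T simple_edge(3)[OF G(1)] by auto
    have T3: "T3 \<subseteq> verts G" "card T3 = 3" "finite T3"
      using T d simple_edge[OF G(1)] by (auto simp: T3_def)
    have adj: "{u, w} \<in> edges G" if "u \<in> T3" "w \<in> T3" "u \<noteq> w" for u w
      using that T by (auto simp: T3_def insert_commute)
    have at_most: "u = w" if v: "v \<notin> T3" and u: "u \<in> T3" "w \<in> T3" "v \<in> nbr G u" "v \<in> nbr G w" for u w v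
    proof (rule ccontr)
      assume ne: "u \<noteq> w"
      have "\<not> T3 \<subseteq> {u, w}" using T3(2) card_mono[of "{u, w}" T3] by (auto simp: card_insert_if split: if_splits)
      then obtain t where t: "t \<in> T3" "t \<noteq> u" "t \<noteq> w" by blast
      have "has_theta G 2 2"
        by (rule has_theta_two_two[OF G(1), of u w t v]) (use u v ne t adj in \<open>auto simp: nbr_def\<close>)
      then show False using G(2) by simp
    qed
    define M where "M w = nbr G w - T3" for w
    have fM: "finite (M w)" for w using finite_nbr[OF G(1)] by (simp add: M_def)
    have disj: "M u \<inter> M w = {}" if "u \<in> T3" "w \<in> T3" "u \<noteq> w" for u w
      using at_most[of _ u w] that by (auto simp: M_def)
    have cU: "card (M a \<union> M b \<union> M c) = card (M a) + card (M b) + card (M c)"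
      using disj[of a b] disj[of a c] disj[of b c] fM d
      by (subst card_Un_disjoint; (subst card_Un_disjoint)?) (auto simp: T3_def Int_Un_distrib2)
    have sub: "M a \<union> M b \<union> M c \<subseteq> verts G - T3" using nbr_subset[OF G(1)] by (auto simp: M_def)
    have cV: "card (verts G - T3) = n - 3" using T3 n card_Diff_subset[of T3 "verts G"] by simp
    have s: "card (M a) + card (M b) + card (M c) \<le> n - 3"
      using card_mono[OF _ sub] simple_finite[OF G(1)] cU cV by simp
    have "nbr G a = {b, c} \<union> M a" "nbr (del G {a}) b = {c} \<union> M b" "nbr (del G {a, b}) c = M c"
      using T d nbr_irrefl[OF G(1)] nbr_del[of b "{a}" G] nbr_del[of c "{a, b}" G]
      by (auto simp: M_def T3_def nbr_def insert_commute)
    moreover have "card ({b, c} \<union> M a) = 2 + card (M a)" "card ({c} \<union> M b) = 1 + card (M b)"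
      using fM d by (auto simp: M_def T3_def card_insert_if)
    ultimately have nb: "deg G a = 2 + card (M a)" "deg (del G {a}) b = 1 + card (M b)"
        "deg (del G {a, b}) c = card (M c)" by simp_all
    have d2: "del (del G {a}) {b} = del G {a, b}" "del (del G {a, b}) {c} = del G T3"
      by (simp_all add: del_del T3_def insert_commute)
    have e: "esize G = esize (del G T3) + 3 + (card (M a) + card (M b) + card (M c))"
      using card_edges_del_vertex[OF G(1), of a] card_edges_del_vertex[OF simple_del[OF G(1)], of "{a}" b]
        card_edges_del_vertex[OF simple_del[OF G(1)], of "{a, b}" c] unfolding nb d2 by linarith
    define k where "k = n - 3"
    have k: "n = k + 3" using G(4) by (simp add: k_def)
    have ck: "order (del G T3) = k" using cV k by simp
    have ex: "4 * esize (del G T3) \<le> k * k" "k * k \<le> 4 * esize (del G T3) + 1 \<Longrightarrow> bipartite (del G T3)"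
      using N2[OF simple_del[OF G(1)] del_free[OF G(2)], of T3] ck k G(4) by auto
    have 1: "4 * esize G + 2 * n \<le> n * n + 9"
      using ex(1) s e unfolding k by (simp add: algebra_simps)
    have "G \<in> family_G n" if ge: "n * n + 8 \<le> 4 * esize G + 2 * n"
    proof -
      have sq: "k * k \<le> 4 * esize (del G T3) + 1"
        using ge s e unfolding k by (simp add: algebra_simps)
      have "k \<le> card (M a) + card (M b) + card (M c)"
        using ge ex(1) e unfolding k by (simp add: algebra_simps)
      then have "M a \<union> M b \<union> M c = verts G - T3"
        by (intro card_seteq[OF _ sub]) (use simple_finite[OF G(1)] cU cV k in simp_all)
      then have some: "\<exists>w\<in>T3. v \<in> nbr G w" if "v \<in> verts G - T3" for v
        using that by (fastforce simp: M_def T3_def)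
      obtain X Y where p: "parts (del G T3) X Y" using ex(2)[OF sq] bipartite_iff_parts[OF simple_del[OF G(1)]] by blast
      have main: "G \<in> family_G n" if p: "parts (del G T3) X Y" and cXY: "card Y \<le> card X" for X Y
      proof -
        have XY: "X \<union> Y = verts G - T3" "X \<inter> Y = {}" using p by (auto simp: parts_def)
        have cx: "card X + card Y = k" using parts_card[OF simple_del[OF G(1)] p] ck by simp
        have le: "esize (del G T3) \<le> card X * card Y" by (rule card_edges_parts_le[OF simple_del[OF G(1)] p])
        have fin: "finite X" "finite Y" using parts_finite[OF simple_del[OF G(1)] p] by auto
        have full: "{x, y} \<in> edges G" if "x \<in> X" "y \<in> Y" for x y
        proof -
          have "card X * card Y \<le> esize (del G T3)"
            using sq four_mult_le[of "card X" "card Y"] unfolding cx[symmetric] by simp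
          from edges_eq_of_card[OF simple_del[OF G(1)] p this that] show ?thesis
            using edges_del_subset by blast
        qed
        have bal: "card X \<le> Suc (card Y)"
          using balanced[of "card X" "card Y"] sq le unfolding cx by auto
        \<comment> \<open>Two such vertices would both be common neighbours of the adjacent
          \<open>w\<close> and \<open>x\<close>.\<close>
        have le1: "card (nbr G w \<inter> S) \<le> 1"
          if w: "w \<in> T3" "x \<in> nbr G w" "\<And>y. y \<in> S \<Longrightarrow> {x, y} \<in> edges G" "finite S" for w x S
        proof -
          have "y = y'" if y: "y \<in> nbr G w \<inter> S" "y' \<in> nbr G w \<inter> S" for y y'
          proof (rule ccontr)
            assume "y \<noteq> y'"
            then have "has_theta G 2 2"
              by (intro has_theta_two_two[OF G(1), of w x y y']) (use w y in \<open>auto simp: nbr_def\<close>)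
            then show False using G(2) by simp
          qed
          then show ?thesis using w(4) by (auto simp: card_le_Suc0_iff_eq)
        qed
        have leX: "card (nbr G w \<inter> X) \<le> 1" if w: "w \<in> T3" "nbr G w \<inter> Y \<noteq> {}" for w
        proof -
          obtain y where "y \<in> nbr G w" "y \<in> Y" using w(2) by blast
          then show ?thesis using le1[of w y X] w(1) full fin by (simp add: insert_commute)
        qed
        have leY: "card (nbr G w \<inter> Y) \<le> 1" if w: "w \<in> T3" "nbr G w \<inter> X \<noteq> {}" for w
        proof -
          obtain x where "x \<in> nbr G w" "x \<in> X" using w(2) by blast
          then show ?thesis using le1[of w x Y] w(1) full fin by simp
        qed
        have prod: "card (nbr G w \<inter> X) * card (nbr G w \<inter> Y) \<le> 1" if w: "w \<in> T3" for w
        proof (cases "nbr G w \<inter> X = {} \<or> nbr G w \<inter> Y = {}")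
          case False
          then show ?thesis using leX[OF w] leY[OF w] by (metis mult_le_mono nat_mult_1)
        qed auto
        \<comment> \<open>Every vertex of \<open>S\<close> has a neighbour in \<open>T3\<close>;
          with at most one each, the three triangle vertices could not reach four vertices.\<close>
        have big: "\<exists>w\<in>T3. 2 \<le> card (nbr G w \<inter> S)" if S: "S \<subseteq> verts G - T3" "4 \<le> card S" for S
        proof (rule ccontr)
          assume no: "\<not> ?thesis"
          have "S = (\<Union>w\<in>T3. nbr G w \<inter> S)" using some S(1) by blast
          then have "card S \<le> (\<Sum>w\<in>T3. card (nbr G w \<inter> S))" by (metis T3(3) card_UN_le)
          also have "\<dots> \<le> (\<Sum>w\<in>T3. 1)" by (rule sum_mono) (use no in \<open>auto simp: not_le\<close>)
          finally show False using S(2) T3(2) by simp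
        qed
        have "4 \<le> card X" "4 \<le> card Y" using cx cXY bal k G(4) by auto
        \<comment> \<open>Having two neighbours in one part excludes any in the other, by
          \<open>leX\<close> and \<open>leY\<close>. So \<open>a'\<close> and \<open>b'\<close>
          differ and play \<open>w1\<close> and \<open>w2\<close>; the third triangle vertex is
          \<open>w3\<close>.\<close>
        then obtain a' b' where a': "a' \<in> T3" "2 \<le> card (nbr G a' \<inter> X)" and b': "b' \<in> T3" "2 \<le> card (nbr G b' \<inter> Y)"
          using big[of X] big[of Y] XY by auto
        have aY: "nbr G a' \<inter> Y = {}" by (rule ccontr) (use leX[OF a'(1)] a'(2) in simp)
        have bX: "nbr G b' \<inter> X = {}" by (rule ccontr) (use leY[OF b'(1)] b'(2) in simp)
        have ab: "a' \<noteq> b'" using aY b'(2) by auto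
        have "\<not> T3 \<subseteq> {a', b'}" using T3(2) card_mono[of "{a', b'}" T3] by (auto simp: card_insert_if split: if_splits)
        then obtain c' where c': "c' \<in> T3" "c' \<noteq> a'" "c' \<noteq> b'" by blast
        have d': "distinct [a', b', c']" using ab c' by auto
        have T3': "T3 = {a', b', c'}"
          using card_seteq[of T3 "{a', b', c'}"] T3 a' b' c' ab by auto
        have nT: "v \<notin> T3" if "v \<in> X \<union> Y" for v using that XY by blast
        show ?thesis unfolding n[symmetric]
        proof (rule family_G_intro[OF G(1) _ XY(2) d'])
          show "verts G = X \<union> Y \<union> {a', b', c'}" using XY T3(1) T3' by blast
          show "{a', b', c'} \<inter> (X \<union> Y) = {}" using XY T3' by blast
          show "edges (del G {a', b', c'}) = edges (complete_bipartite X Y)"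
            using edges_of_complete_parts[OF G(1) p full] T3' by simp
          show "{a', b'} \<in> edges G" "{b', c'} \<in> edges G" "{a', c'} \<in> edges G"
            using adj a' b' c' ab by auto
          show "x \<in> nbr G a' \<longleftrightarrow> x \<notin> nbr G c'" if x: "x \<in> X" for x
            using some[of x] at_most[of x a' c'] x bX nT[of x] XY T3' c' a' by auto
          show "y \<in> nbr G b' \<longleftrightarrow> y \<notin> nbr G c'" if y: "y \<in> Y" for y
            using some[of y] at_most[of y b' c'] y aY nT[of y] XY T3' c' b' by auto
        qed (use aY bX prod c' cXY bal in auto)
      qed
      show ?thesis
      proof (cases "card Y \<le> card X")
        case True then show ?thesis using main[OF p] by blast
      next
        case False
        moreover have "parts (del G T3) Y X" using p parts_sym by blast
        ultimately show ?thesis using main[of Y X] by simp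
      qed
    qed
    then show ?thesis using 1 isomorphic_refl by auto
  qed
  then show ?thesis unfolding eventually_extremal_def by (intro exI[of _ "N1 + N2 + 20"]) auto
qed

section \<open>The extremal graphs are theta-free and non-bipartite\<close>

lemma not_bipartite_triangle:
  assumes "simple_graph G" "{a, b} \<in> edges G" "{b, c} \<in> edges G" "{a, c} \<in> edges G"
  shows "\<not> bipartite G"
proof
  assume "bipartite G"
  then obtain A B where p: "parts G A B" using bipartite_iff_parts[OF assms(1)] by blast
  have "A \<inter> B = {}" using p by (simp add: parts_def)
  then show False
    using parts_edge[OF assms(1) p assms(2)] parts_edge[OF assms(1) p assms(3)] parts_edge[OF assms(1) p assms(4)] by blast
qed

lemma not_bipartite_pentagon:
  assumes "simple_graph G" "{a, b} \<in> edges G" "{b, c} \<in> edges G" "{c, d} \<in> edges G" "{d, e} \<in> edges G" "{e, a} \<in> edges G"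
  shows "\<not> bipartite G"
proof
  assume "bipartite G"
  then obtain A B where p: "parts G A B" using bipartite_iff_parts[OF assms(1)] by blast
  have "A \<inter> B = {}" using p by (simp add: parts_def)
  then show False
    using parts_edge[OF assms(1) p assms(2)] parts_edge[OF assms(1) p assms(3)] parts_edge[OF assms(1) p assms(4)]
      parts_edge[OF assms(1) p assms(5)] parts_edge[OF assms(1) p assms(6)] by blast
qed

lemma is_path_nth: "is_path G w \<Longrightarrow> Suc i < length w \<Longrightarrow> {w ! i, w ! Suc i} \<in> edges G"
  by (simp add: is_path_def successively_conv_nth)

section \<open>Theta-freeness from odd cycles\<close>

lemma parts_path:
  assumes G: "simple_graph G" and p: "parts G A B" and w: "is_path G w" "i < length w" "w ! 0 \<in> A"
    "length w \<ge> 2"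
  shows "w ! i \<in> (if even i then A else B)"
  using w(2)
proof (induction i)
  case 0
  then show ?case using w by simp
next
  case (Suc i)
  have "A \<inter> B = {}" using p by (simp add: parts_def)
  then show ?case using Suc parts_edge[OF G p is_path_nth[OF w(1), of i]] by auto
qed

lemma path_del:
  assumes "is_path G w" "set w \<inter> R = {}"
  shows "is_path (del G R) w"
proof -
  have "{w ! i, w ! Suc i} \<in> edges (del G R)" if "Suc i < length w" for i
  proof -
    have "w ! i \<in> set w" "w ! Suc i \<in> set w" using that by auto
    then show ?thesis using is_path_nth[OF assms(1) that] assms(2) by (auto simp: del_def)
  qed
  then show ?thesis using assms(1) by (simp add: is_path_def successively_conv_nth)
qed

text \<open>The edge \<open>{u, v}\<close> closes the path to a cycle on \<open>length w + 2\<close>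
  vertices, an odd number, which cannot lie in the bipartite graph \<open>del G R\<close>.\<close>

lemma odd_cycle_meets:
  assumes G: "simple_graph G" and p: "parts (del G R) A B" and w: "is_path G (u # w @ [v])" "odd (length w)"
    and uv: "{u, v} \<in> edges G"
  shows "set (u # w @ [v]) \<inter> R \<noteq> {}"
proof
  assume d: "set (u # w @ [v]) \<inter> R = {}"
  have path: "is_path (del G R) (u # w @ [v])" by (rule path_del[OF w(1) d])
  have e: "{u, v} \<in> edges (del G R)" using d uv by (auto simp: del_def)
  have last: "(u # w @ [v]) ! Suc (length w) = v" by simp
  have "False" if p': "parts (del G R) C D" "u \<in> C" "v \<in> D" for C D
  proof -
    have "v \<in> C"
      using parts_path[OF simple_del[OF G] p'(1) path, of "Suc (length w)"] p'(2) w(2) last by simp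
    then show False using p' by (auto simp: parts_def)
  qed
  then show False using parts_edge[OF simple_del[OF G] p e] p parts_sym by blast
qed

lemma theta_branch_degree:
  assumes G: "simple_graph G" and uv: "{u, v} \<in> edges G" and p: "is_path G (u # p @ [v])" "is_path G (u # p' @ [v])"
    and ne: "p \<noteq> []" "p' \<noteq> []" "set p \<inter> set p' = {}"
  shows "3 \<le> deg G u" "3 \<le> deg G v"
proof -
  have main: "3 \<le> deg G u" if uv: "{u, v} \<in> edges G" and p: "is_path G (u # p @ [v])" "is_path G (u # p' @ [v])"
    and ne: "p \<noteq> []" "p' \<noteq> []" "set p \<inter> set p' = {}" for u v p p'
  proof -
    have "hd p \<in> set p" "hd p' \<in> set p'" using ne by auto
    then have "hd p \<noteq> hd p'" "hd p \<noteq> v" "hd p' \<noteq> v" using ne(3) p by (auto simp: is_path_def)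
    then have c: "card {v, hd p, hd p'} = 3" by simp
    have "{v, hd p, hd p'} \<subseteq> nbr G u"
      using uv p ne by (auto simp: nbr_def is_path_Cons_hd)
    then show ?thesis using card_mono[OF finite_nbr[OF G], of "{v, hd p, hd p'}" u] c by simp
  qed
  show "3 \<le> deg G u" by (rule main[OF uv p ne])
  show "3 \<le> deg G v"
    by (rule main[of v u "rev p" "rev p'"])
      (use uv p ne is_path_rev[of G "u # p @ [v]"] is_path_rev[of G "u # p' @ [v]"] in \<open>auto simp: insert_commute\<close>)
qed

text \<open>Each even arc closes with the chord to an odd cycle, which must pass through
  \<open>z\<close>. The two cycles share only \<open>u\<close> and \<open>v\<close>, so
  \<open>z\<close> would be one of these and have degree at least 3.\<close>

lemma apex_degree_two_theta_free:
  assumes G: "simple_graph G" and p: "parts (del G {z}) A B" and d: "deg G z \<le> 2"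
    and q: "even q" "q \<ge> 2" and r: "even r" "r \<ge> 2"
  shows "\<not> has_theta G q r"
proof
  assume "has_theta G q r"
  then obtain u v w w' where uv: "{u, v} \<in> edges G" and w: "is_path G (u # w @ [v])" "is_path G (u # w' @ [v])"
    and l: "Suc (length w) = q" "Suc (length w') = r" and disj: "set w \<inter> set w' = {}"
    unfolding has_theta_def by blast
  have ne: "w \<noteq> []" "w' \<noteq> []" using l q r by auto
  have "odd (length w)" "odd (length w')" using l q r by auto
  then have "z \<in> set (u # w @ [v])" "z \<in> set (u # w' @ [v])"
    using odd_cycle_meets[OF G p w(1) _ uv] odd_cycle_meets[OF G p w(2) _ uv] by auto
  then have "z = u \<or> z = v" using disj by auto
  then show False using theta_branch_degree[OF G uv w ne disj] d by auto
qed

text \<open>The arc of even length \<open>q\<close> closes with the chord to an odd cycle, which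
  must meet \<open>z1\<close> or \<open>z2\<close>. Having degree 2, neither is an end of the chord;
  but a path with one of them inside runs through both and \<open>y\<close>, and gets stuck in the
  triangle.\<close>

lemma pendant_triangle_theta_free:
  assumes G: "simple_graph G" and p: "parts (del G {z1, z2}) A B"
    and N: "nbr G z1 = {z2, y}" "nbr G z2 = {z1, y}" and q: "even q" "q \<ge> 2" and r: "r \<ge> 2"
  shows "\<not> has_theta G q r"
proof
  assume "has_theta G q r"
  then obtain u v p p' where uv: "{u, v} \<in> edges G" and w: "is_path G (u # p @ [v])" "is_path G (u # p' @ [v])"
    and l: "Suc (length p) = q" "Suc (length p') = r" and disj: "set p \<inter> set p' = {}"
    unfolding has_theta_def by blast
  have ne: "p \<noteq> []" "p' \<noteq> []" using l q r by auto
  have "deg G z1 \<le> 2" "deg G z2 \<le> 2" unfolding N by (simp_all add: card_insert_if)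
  then have uz: "u \<noteq> z1" "u \<noteq> z2" "v \<noteq> z1" "v \<noteq> z2"
    using theta_branch_degree[OF G uv w ne disj] by auto
  have main: "z1 \<notin> set p" if N: "nbr G z1 = {z2, y}" "nbr G z2 = {z1, y}" and uz: "u \<noteq> z2" "v \<noteq> z2" for z1 z2
  proof
    assume "z1 \<in> set p"
    then obtain j where j: "j < length p" "p ! j = z1" by (auto simp: in_set_conv_nth)
    define W where "W = u # p @ [v]"
    have W: "is_path G W" "length W = length p + 2" "W ! 0 = u" "W ! Suc (length p) = v" "W ! Suc j = z1"
      using w(1) j by (simp_all add: W_def nth_append)
    have idx: "W ! a = W ! b \<longleftrightarrow> a = b" if "a < length W" "b < length W" for a b
      using nth_eq_iff_index_eq[OF _ that] W(1) by (simp add: is_path_def)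
    have step: "W ! Suc i \<in> nbr G (W ! i)" "W ! i \<in> nbr G (W ! Suc i)" if "Suc i < length W" for i
      using is_path_nth[OF W(1) that] by (simp_all add: nbr_def insert_commute)
    have nx: "W ! Suc (Suc j) \<in> {z2, y}" "W ! j \<in> {z2, y}"
      using step(1)[of "Suc j"] step(2)[of j] W(2,5) j N(1) by simp_all
    have "W ! Suc (Suc j) \<noteq> W ! j" using idx[of "Suc (Suc j)" j] j W(2) by simp
    then consider "W ! Suc (Suc j) = z2" "W ! j = y" | "W ! j = z2" "W ! Suc (Suc j) = y" using nx by auto
    \<comment> \<open>Next to \<open>z1\<close> the path has \<open>z2\<close> on one side and
      \<open>y\<close> on the other. As \<open>z2\<close> is not an end it needs one more neighbour
      on the path, but only \<open>z1\<close> and \<open>y\<close> are available and both are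
      used.\<close>
    then show False
    proof cases
      case 1
      have "Suc j \<noteq> length p" using 1(1) W(4) uz by auto
      then have l3: "Suc (Suc (Suc j)) < length W" using j W(2) by simp
      have "W ! Suc (Suc (Suc j)) \<in> {z1, y}" using step(1)[OF l3] 1 N(2) by simp
      then have "W ! Suc (Suc (Suc j)) = W ! Suc j \<or> W ! Suc (Suc (Suc j)) = W ! j" using 1 W(5) by auto
      then show False using idx[of "Suc (Suc (Suc j))" "Suc j"] idx[of "Suc (Suc (Suc j))" j] l3 by simp
    next
      case 2
      have "j \<noteq> 0" using 2(1) uz(1) W(3) by metis
      then obtain i where i: "j = Suc i" by (cases j) auto
      have "W ! i \<in> {z1, y}" using step(2)[of i] j i 2 N(2) W(2) by simp
      then have "W ! i = W ! Suc j \<or> W ! i = W ! Suc (Suc j)" using 2 W(5) by auto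
      then show False using idx[of i "Suc j"] idx[of i "Suc (Suc j)"] j i W(2) by simp
    qed
  qed
  have "z1 \<notin> set p" "z2 \<notin> set p" using main[OF N uz(2,4)] main[OF N(2,1) uz(1,3)] by auto
  moreover have "odd (length p)" using l q by auto
  ultimately show False using odd_cycle_meets[OF G p w(1) _ uv] uz by auto
qed

section \<open>Properties of the four extremal families\<close>

lemma card_complete_bipartite:
  assumes "finite X" "finite Y" "X \<inter> Y = {}"
  shows "card (edges (complete_bipartite X Y)) = card X * card Y" "finite (edges (complete_bipartite X Y))"
proof -
  have eq: "edges (complete_bipartite X Y) = (\<lambda>(x, y). {x, y}) ` (X \<times> Y)"
    by (auto simp: complete_bipartite_def)
  have "inj_on (\<lambda>(x, y). {x, y}) (X \<times> Y)" using assms(3) by (auto simp: inj_on_def doubleton_eq_iff)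
  then show "card (edges (complete_bipartite X Y)) = card X * card Y"
    unfolding eq by (simp add: card_image card_cartesian_product)
  show "finite (edges (complete_bipartite X Y))" unfolding eq using assms by simp
qed

lemma complete_bipartite_edge_iff:
  "{u, v} \<in> edges (complete_bipartite X Y) \<longleftrightarrow> u \<in> X \<and> v \<in> Y \<or> u \<in> Y \<and> v \<in> X"
  by (auto simp: complete_bipartite_def doubleton_eq_iff)

lemma edge_form: "s \<in> V \<Longrightarrow> t \<in> V \<Longrightarrow> s \<noteq> t \<Longrightarrow> {s, t} \<in> {{u, v} |u v. u \<in> V \<and> v \<in> V \<and> u \<noteq> v}"
  by blast

lemma complete_bipartite_edges_subset:
  assumes "X \<inter> Y = {}" "X \<union> Y \<subseteq> V"
  shows "edges (complete_bipartite X Y) \<subseteq> {{u, v} |u v. u \<in> V \<and> v \<in> V \<and> u \<noteq> v}"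
proof
  fix e assume "e \<in> edges (complete_bipartite X Y)"
  then obtain x y where xy: "e = {x, y}" "x \<in> X" "y \<in> Y" by (auto simp: complete_bipartite_def)
  show "e \<in> {{u, v} |u v. u \<in> V \<and> v \<in> V \<and> u \<noteq> v}"
    unfolding xy(1) by (rule edge_form) (use xy assms in auto)
qed

text \<open>These graphs are triangle-free, while \<open>\<theta>(1,2,r)\<close> contains a
  triangle; a pentagon through the edge \<open>{u1, u2}\<close> shows that they are not
  bipartite.\<close>

lemma family_H_properties:
  assumes H: "H \<in> family_H n" and n: "n \<ge> 6"
  shows "simple_graph H" "order H = n" "\<not> has_theta H 2 r" "\<not> bipartite H"
    "n * n + 4 \<le> 4 * esize H + 2 * n"
proof -
  obtain b X Y X1 u1 u2 where b: "b = 0 \<or> even n \<and> b = 1" and fin: "finite X" "finite Y" and XY: "X \<inter> Y = {}"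
    and cY: "card Y = nat \<lceil>real n / 2\<rceil> + b" and cX: "card X = nat \<lfloor>real n / 2\<rfloor> - b"
    and u: "u1 \<in> Y" "u2 \<in> Y" "u1 \<noteq> u2" and X1: "X1 \<noteq> {}" "X1 \<subset> X"
    and V: "verts H = X \<union> Y"
    and E: "edges H = (edges (complete_bipartite X Y) \<union> {{u1, u2}}) - ({{u1, x} | x. x \<in> X - X1} \<union> {{u2, x} | x. x \<in> X1})"
    using H unfolding family_H_def mem_Collect_eq by (elim exE conjE) simp
  have uX: "u1 \<notin> X" "u2 \<notin> X" using u XY by auto
  have adj: "{s, t} \<in> edges H \<longleftrightarrow> (s \<in> X \<and> t \<in> Y \<and> \<not> (t = u1 \<and> s \<notin> X1) \<and> \<not> (t = u2 \<and> s \<in> X1)) \<or>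
      (t \<in> X \<and> s \<in> Y \<and> \<not> (s = u1 \<and> t \<notin> X1) \<and> \<not> (s = u2 \<and> t \<in> X1)) \<or>
      (s = u1 \<and> t = u2) \<or> (s = u2 \<and> t = u1)" for s t
    unfolding E using u uX X1 XY by (auto simp: complete_bipartite_edge_iff doubleton_eq_iff)
  have "edges H \<subseteq> edges (complete_bipartite X Y) \<union> {{u1, u2}}" unfolding E by blast
  also have "\<dots> \<subseteq> {{u, v} |u v. u \<in> verts H \<and> v \<in> verts H \<and> u \<noteq> v}"
    by (intro Un_least complete_bipartite_edges_subset[OF XY] insert_subsetI empty_subsetI edge_form) (use V u in auto)
  finally show G: "simple_graph H" using fin V by (simp add: simple_graph_def)
  have cn: "card X + card Y = n" "card Y \<ge> 3"
    using cX cY b n unfolding nat_half by auto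
  then show "order H = n" using V fin XY by (simp add: card_Un_disjoint)
  have no3: False if "{s, t} \<in> edges H" "{t, w} \<in> edges H" "{s, w} \<in> edges H" for s t w
    using that unfolding adj using uX XY u by blast
  show "\<not> has_theta H 2 r"
  proof
    assume "has_theta H 2 r"
    then obtain s t p where "{s, t} \<in> edges H" "is_path H (s # p @ [t])" "Suc (length p) = 2"
      unfolding has_theta_def by blast
    moreover from this obtain w where "p = [w]" by (cases p) auto
    ultimately show False using no3[of s w t] by (auto simp: is_path_Cons)
  qed
  obtain x1 x2 where x: "x1 \<in> X1" "x2 \<in> X" "x2 \<notin> X1" using X1 by blast
  have "\<not> Y \<subseteq> {u1, u2}" using cn card_mono[of "{u1, u2}" Y] by (auto simp: card_insert_if split: if_splits)
  then obtain y where y: "y \<in> Y" "y \<noteq> u1" "y \<noteq> u2" by blast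
  show "\<not> bipartite H"
    by (rule not_bipartite_pentagon[OF G, of u1 x1 y x2 u2]) (use x y u X1 uX in \<open>auto simp: adj\<close>)
  let ?D = "{{u1, x} | x. x \<in> X - X1} \<union> {{u2, x} | x. x \<in> X1}"
  have "?D = (\<lambda>x. {u1, x}) ` (X - X1) \<union> (\<lambda>x. {u2, x}) ` X1" unfolding Setcompr_eq_image ..
  moreover have "finite X1" using fin X1 finite_subset by blast
  moreover have "card (X - X1) + card X1 = card X"
    using card_Diff_subset[of X1 X] card_mono[of X X1] X1 fin \<open>finite X1\<close> by auto
  ultimately have D: "card ?D \<le> card X" "finite ?D"
    using card_Un_le[of "(\<lambda>x. {u1, x}) ` (X - X1)" "(\<lambda>x. {u2, x}) ` X1"]
      card_image_le[of "X - X1" "\<lambda>x. {u1, x}"] card_image_le[of X1 "\<lambda>x. {u2, x}"] fin by simp_all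
  have "{u1, u2} \<notin> edges (complete_bipartite X Y)" using uX by (auto simp: complete_bipartite_edge_iff)
  then have "card (edges (complete_bipartite X Y) \<union> {{u1, u2}}) = card X * card Y + 1"
    using card_complete_bipartite[OF fin XY] by simp
  then have e: "card X * card Y + 1 \<le> esize H + card X"
    using diff_card_le_card_Diff[OF D(2), of "edges (complete_bipartite X Y) \<union> {{u1, u2}}"] D(1) unfolding E by simp
  \<comment> \<open>The edge count is \<open>|X| * d + 1\<close> with \<open>d = |Y| - 1\<close>, so
    that \<open>|X| + d = n - 1\<close> splits as evenly as possible for either value of
    \<open>b\<close>.\<close>
  obtain d where d: "card Y = Suc d" using cn by (cases "card Y") auto
  have "card X = d \<or> card X = Suc d \<or> d = Suc (card X)"
    using cX cY b n d unfolding nat_half by auto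
  then have "(card X + d) * (card X + d) \<le> 4 * (card X * d) + 1" by (auto simp: algebra_simps)
  then show "n * n + 4 \<le> 4 * esize H + 2 * n"
    using e unfolding cn(1)[symmetric] d by (simp add: algebra_simps)
qed

lemma family_H_nonempty:
  assumes "n \<ge> 6"
  shows "family_H n \<noteq> {}"
proof -
  have "\<lparr>verts = {..<n div 2} \<union> {n div 2..<n},
       edges = (edges (complete_bipartite {..<n div 2} {n div 2..<n}) \<union> {{n div 2, n div 2 + 1}})
                 - ({{n div 2, x} | x. x \<in> {..<n div 2} - {0}} \<union> {{n div 2 + 1, x} | x. x \<in> {0}})\<rparr> \<in> family_H n"
  proof (rule family_H_I[of 0])
    have "n - n div 2 = (n + 1) div 2" by presburger
    then show "card {n div 2..<n} = nat \<lceil>real n / 2\<rceil> + 0" unfolding nat_half by simp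
    show "card {..<n div 2} = nat \<lfloor>real n / 2\<rfloor> - 0" unfolding nat_half by simp
    have "n div 2 > 1" using assms by simp
    then have "0 \<in> {..<n div 2}" "1 \<in> {..<n div 2}" by auto
    then show "{0} \<subset> {..<n div 2}" by (metis insert_subset empty_subsetI psubsetI singletonD zero_neq_one)
    show "n div 2 + 1 \<in> {n div 2..<n}" "n div 2 \<in> {n div 2..<n}" using assms by auto
  qed auto
  then show ?thesis by blast
qed


lemma parts_del_of_edges:
  assumes "P \<inter> Q = {}" "verts H - R = P \<union> Q" "edges (del H R) \<subseteq> edges (complete_bipartite P Q)"
  shows "parts (del H R) P Q"
proof -
  have "u \<in> P \<and> v \<in> Q \<or> u \<in> Q \<and> v \<in> P" if "{u, v} \<in> edges (del H R)" for u v
    using assms(3) that complete_bipartite_edge_iff[of u v P Q] by blast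
  then show ?thesis using assms(1,2) unfolding parts_def nbr_def by auto
qed

lemma K_bullet_properties:
  assumes ab: "a \<ge> 1" "b \<ge> 1"
  shows "simple_graph (K_bullet_K3 a b)" "card (verts (K_bullet_K3 a b)) = a + b + 1" "\<not> bipartite (K_bullet_K3 a b)"
    "card (edges (K_bullet_K3 a b)) = a * b + 2"
    "even q \<Longrightarrow> q \<ge> 2 \<Longrightarrow> even r \<Longrightarrow> r \<ge> 2 \<Longrightarrow> \<not> has_theta (K_bullet_K3 a b) q r"
proof -
  let ?H = "K_bullet_K3 a b" and ?P = "{..<a}" and ?Q = "{a..<a + b}"
  have V: "verts ?H = {..<a + b + 1}"
    using ab by (auto simp: K_bullet_K3_def graph_union_def complete_bipartite_def Defs.triangle_def)
  have E: "edges ?H = edges (complete_bipartite ?P ?Q) \<union> {{0, a + b}, {a, a + b}}"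
    using ab complete_bipartite_edge_iff[of 0 a ?P ?Q]
    by (auto simp: K_bullet_K3_def graph_union_def Defs.triangle_def)
  have PQ: "?P \<inter> ?Q = {}" by auto
  have cb: "e \<subseteq> {..<a + b}" if "e \<in> edges (complete_bipartite ?P ?Q)" for e
    using that by (auto simp: complete_bipartite_def)
  have "edges ?H \<subseteq> {{u, v} |u v. u \<in> verts ?H \<and> v \<in> verts ?H \<and> u \<noteq> v}"
    unfolding E V
    by (intro Un_least complete_bipartite_edges_subset[OF PQ] insert_subsetI empty_subsetI edge_form) (use ab in auto)
  then have G: "simple_graph ?H" unfolding simple_graph_def by (simp add: V)
  then show "simple_graph ?H" .
  show "order ?H = a + b + 1" unfolding V by simp
  have "{0, a} \<in> edges (complete_bipartite ?P ?Q)" using ab by (simp add: complete_bipartite_edge_iff)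
  then show "\<not> bipartite ?H"
    by (intro not_bipartite_triangle[OF G, of 0 a "a + b"]) (auto simp: E)
  have "edges (complete_bipartite ?P ?Q) \<inter> {{0, a + b}, {a, a + b}} = {}" using cb by fastforce
  moreover have "card {{0, a + b}, {a, a + b}} = 2" using ab by (auto simp: doubleton_eq_iff)
  moreover have "card (edges (complete_bipartite ?P ?Q)) = a * b" "finite (edges (complete_bipartite ?P ?Q))"
    using card_complete_bipartite[of ?P ?Q] PQ by simp_all
  ultimately show "esize ?H = a * b + 2" unfolding E by (subst card_Un_disjoint) auto
  assume q: "even q" "q \<ge> 2" and r: "even r" "r \<ge> 2"
  have "nbr ?H (a + b) \<subseteq> {0, a}"
    using cb[of "{a + b, u}" for u] unfolding nbr_def E by (auto simp: doubleton_eq_iff)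
  then have d: "card (nbr ?H (a + b)) \<le> 2"
    using card_mono[of "{0, a}" "nbr ?H (a + b)"] ab by (simp add: card_insert_if)
  have p: "parts (del ?H {a + b}) ?P ?Q"
    by (rule parts_del_of_edges) (auto simp: V, auto simp: del_def E)
  show "\<not> has_theta ?H q r" by (rule apex_degree_two_theta_free[OF G p d q r])
qed

lemma K_circ_properties:
  assumes ab: "b \<ge> 1"
  shows "simple_graph (K_circ_K3 a b)" "card (verts (K_circ_K3 a b)) = a + b + 2" "\<not> bipartite (K_circ_K3 a b)"
    "card (edges (K_circ_K3 a b)) = a * b + 3"
    "even q \<Longrightarrow> q \<ge> 2 \<Longrightarrow> r \<ge> 2 \<Longrightarrow> \<not> has_theta (K_circ_K3 a b) q r"
proof -
  let ?H = "K_circ_K3 a b" and ?P = "{..<a}" and ?Q = "{a..<a + b}"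
  have V: "verts ?H = {..<a + b + 2}"
    using ab by (auto simp: K_circ_K3_def graph_union_def complete_bipartite_def Defs.triangle_def)
  have E: "edges ?H = edges (complete_bipartite ?P ?Q) \<union> {{a, a + b}, {a + b, a + b + 1}, {a, a + b + 1}}"
    by (simp add: K_circ_K3_def graph_union_def Defs.triangle_def)
  have PQ: "?P \<inter> ?Q = {}" by auto
  have cb: "e \<subseteq> {..<a + b}" if "e \<in> edges (complete_bipartite ?P ?Q)" for e
    using that by (auto simp: complete_bipartite_def)
  have "edges ?H \<subseteq> {{u, v} |u v. u \<in> verts ?H \<and> v \<in> verts ?H \<and> u \<noteq> v}"
    unfolding E V
    by (intro Un_least complete_bipartite_edges_subset[OF PQ] insert_subsetI empty_subsetI edge_form) (use ab in auto)
  then have G: "simple_graph ?H" unfolding simple_graph_def by (simp add: V)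
  then show "simple_graph ?H" .
  show "order ?H = a + b + 2" unfolding V by simp
  show "\<not> bipartite ?H"
    by (rule not_bipartite_triangle[OF G, of a "a + b" "a + b + 1"]) (auto simp: E)
  have "edges (complete_bipartite ?P ?Q) \<inter> {{a, a + b}, {a + b, a + b + 1}, {a, a + b + 1}} = {}" using cb by fastforce
  moreover have "card {{a, a + b}, {a + b, a + b + 1}, {a, a + b + 1}} = 3" using ab by (auto simp: doubleton_eq_iff)
  moreover have "card (edges (complete_bipartite ?P ?Q)) = a * b" "finite (edges (complete_bipartite ?P ?Q))"
    using card_complete_bipartite[of ?P ?Q] PQ by simp_all
  ultimately show "esize ?H = a * b + 3" unfolding E by (subst card_Un_disjoint) auto
  assume q: "even q" "q \<ge> 2" and r: "r \<ge> 2"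
  have N: "nbr ?H (a + b) = {a + b + 1, a}" "nbr ?H (a + b + 1) = {a + b, a}"
    using cb[of "{a + b, u}" for u] cb[of "{a + b + 1, u}" for u] unfolding nbr_def E
    by (auto simp: doubleton_eq_iff)
  have p: "parts (del ?H {a + b, a + b + 1}) ?P ?Q"
    by (rule parts_del_of_edges) (auto simp: V, auto simp: del_def E)
  show "\<not> has_theta ?H q r" by (rule pendant_triangle_theta_free[OF G p N q r])
qed

text \<open>\<open>\<theta>(1,2,2)\<close> consists of two triangles on a common edge. Apart from
  \<open>w1 w2 w3\<close> the only possible triangle is \<open>w3 x y\<close> with \<open>x\<close>
  in \<open>X1\<close> and \<open>y\<close> in \<open>Y1\<close>; the bound on
  \<open>card X1 * card Y1\<close> allows at most one, and it shares just \<open>w3\<close> with the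
  first.\<close>

lemma family_G_properties:
  assumes H: "H \<in> family_G n" and n: "n \<ge> 6"
  shows "simple_graph H" "order H = n" "\<not> has_theta H 2 2" "\<not> bipartite H"
    "n * n + 8 \<le> 4 * esize H + 2 * n"
proof -
  obtain X Y X1 Y1 w1 w2 w3 where fin: "finite X" "finite Y" and XY: "X \<inter> Y = {}"
    and cX: "card X = nat \<lceil>(real n - 3) / 2\<rceil>" and cY: "card Y = nat \<lfloor>(real n - 3) / 2\<rfloor>"
    and w: "distinct [w1, w2, w3]" "{w1, w2, w3} \<inter> (X \<union> Y) = {}"
    and X1: "X1 \<subseteq> X" "Y1 \<subseteq> Y" "card X1 * card Y1 \<le> 1"
    and V: "verts H = X \<union> Y \<union> {w1, w2, w3}"
    and E: "edges H = edges (complete_bipartite X Y) \<union> edges (Defs.triangle w1 w2 w3)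
                 \<union> {{w1, x} | x. x \<in> X - X1} \<union> {{w2, y} | y. y \<in> Y - Y1}
                 \<union> {{w3, z} | z. z \<in> X1 \<union> Y1}"
    using H unfolding family_G_def mem_Collect_eq by (elim exE conjE) simp
  have fin1: "finite X1" "finite Y1" using fin X1 finite_subset by auto
  have wn: "w1 \<noteq> w2" "w1 \<noteq> w3" "w2 \<noteq> w3" "w1 \<notin> X" "w1 \<notin> Y" "w2 \<notin> X" "w2 \<notin> Y" "w3 \<notin> X" "w3 \<notin> Y"
    using w by auto
  have T: "{w1, w2} \<in> edges H" "{w2, w3} \<in> edges H" "{w1, w3} \<in> edges H" unfolding E by (auto simp: Defs.triangle_def)
  have cn: "card X + card Y + 3 = n" "card X = card Y \<or> card X = Suc (card Y)"
  proof -
    have "card X = (n - 3 + 1) div 2" "card Y = (n - 3) div 2" using nat_half_minus[of 3 n] n cX cY by auto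
    then show "card X + card Y + 3 = n" "card X = card Y \<or> card X = Suc (card Y)" using n by presburger+
  qed
  show "order H = n"
  proof -
    have "card {w1, w2, w3} = 3" using w by simp
    then show ?thesis unfolding V using fin XY w cn by (simp add: card_Un_disjoint Int_commute)
  qed
  have "edges H \<subseteq> {{u, v} |u v. u \<in> verts H \<and> v \<in> verts H \<and> u \<noteq> v}"
    unfolding E Defs.triangle_def Setcompr_eq_image ugraph.simps
    by (intro Un_least complete_bipartite_edges_subset[OF XY] image_subsetI insert_subsetI empty_subsetI edge_form)
      (use wn V X1 in auto)
  then show G: "simple_graph H" using fin V by (simp add: simple_graph_def)
  show "\<not> bipartite H" by (rule not_bipartite_triangle[OF G T])
  have single: "X1 = {x} \<and> Y1 = {y}" if "x \<in> X1" "y \<in> Y1" for x y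
  proof -
    have "card X1 \<ge> 1" "card Y1 \<ge> 1" using that fin1 by (auto simp: Suc_le_eq card_gt_0_iff)
    then have "card X1 = 1" "card Y1 = 1" using X1(3)
      by (metis le_antisym mult.right_neutral mult_le_mono1 mult_le_mono2 mult.left_neutral order_trans)+
    then show ?thesis using that by (auto simp: card_1_singleton_iff)
  qed
  have adj: "{s, t} \<in> edges H \<longleftrightarrow> (s \<in> X \<and> t \<in> Y) \<or> (s \<in> Y \<and> t \<in> X) \<or> (s \<in> {w1, w2, w3} \<and> t \<in> {w1, w2, w3} \<and> s \<noteq> t)
     \<or> (s = w1 \<and> t \<in> X - X1) \<or> (t = w1 \<and> s \<in> X - X1) \<or> (s = w2 \<and> t \<in> Y - Y1) \<or> (t = w2 \<and> s \<in> Y - Y1)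
     \<or> (s = w3 \<and> t \<in> X1 \<union> Y1) \<or> (t = w3 \<and> s \<in> X1 \<union> Y1)" for s t
  proof -
    have t: "{s, t} \<in> edges (Defs.triangle w1 w2 w3) \<longleftrightarrow> s \<in> {w1, w2, w3} \<and> t \<in> {w1, w2, w3} \<and> s \<noteq> t"
      using wn(1-3) by (auto simp: Defs.triangle_def doubleton_eq_iff)
    have i: "{s, t} \<in> {{w, x} |x. x \<in> S} \<longleftrightarrow> s = w \<and> t \<in> S \<or> t = w \<and> s \<in> S" for w and S :: "nat set"
      by (auto simp: doubleton_eq_iff)
    show ?thesis unfolding E ugraph.simps Un_iff[of "{s, t}"] t i complete_bipartite_edge_iff
      by (intro iffI; elim disjE conjE; simp)
  qed
  have XYd: "u \<in> X \<Longrightarrow> u \<notin> Y" for u using XY by blast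
  have n1: "{w1, v} \<in> edges H \<longleftrightarrow> v \<in> X - X1" if "v \<in> X \<union> Y" for v
    using that wn X1 unfolding adj by auto
  have n2: "{w2, v} \<in> edges H \<longleftrightarrow> v \<in> Y - Y1" if "v \<in> X \<union> Y" for v
    using that wn X1 unfolding adj by auto
  have n3: "{w3, v} \<in> edges H \<longleftrightarrow> v \<in> X1 \<union> Y1" if "v \<in> X \<union> Y" for v
    using that wn X1 unfolding adj by auto
  have nXY: "{u, v} \<in> edges H \<longleftrightarrow> (u \<in> X \<and> v \<in> Y) \<or> (u \<in> Y \<and> v \<in> X)" if "u \<in> X \<union> Y" "v \<in> X \<union> Y" for u v
    using that wn X1 unfolding adj by auto
  let ?W = "{w1, w2, w3}"
  have two: False if "s \<in> ?W" "t \<in> ?W" "s \<noteq> t" and v: "v \<in> X \<union> Y" and e: "{t, v} \<in> edges H" "{s, v} \<in> edges H" for s t v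
  proof -
    have "\<not> ({w1, v} \<in> edges H \<and> {w2, v} \<in> edges H)" "\<not> ({w1, v} \<in> edges H \<and> {w3, v} \<in> edges H)"
      "\<not> ({w2, v} \<in> edges H \<and> {w3, v} \<in> edges H)"
      unfolding n1[OF v] n2[OF v] n3[OF v] using X1 XYd by blast+
    then show False using that by auto
  qed
  have one: "\<exists>x\<in>X. \<exists>y\<in>Y. X1 = {x} \<and> Y1 = {y} \<and> {s, t, v} = {w3, x, y}"
    if s: "s \<in> ?W" and tv: "t \<in> X \<union> Y" "v \<in> X \<union> Y" and e: "{s, t} \<in> edges H" "{t, v} \<in> edges H" "{s, v} \<in> edges H" for s t v
  proof -
    have a: "t \<in> X \<and> v \<in> Y \<or> t \<in> Y \<and> v \<in> X" using e(2) nXY[OF tv] by simp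
    have "s \<noteq> w1" using a e(1,3) n1[OF tv(1)] n1[OF tv(2)] XYd by auto
    moreover have "s \<noteq> w2" using a e(1,3) n2[OF tv(1)] n2[OF tv(2)] XYd by auto
    ultimately have s3: "s = w3" using s by auto
    then have "t \<in> X1 \<union> Y1" "v \<in> X1 \<union> Y1" using e(1,3) n3[OF tv(1)] n3[OF tv(2)] by auto
    then have "t \<in> X1 \<and> v \<in> Y1 \<or> t \<in> Y1 \<and> v \<in> X1" using a X1 XYd by blast
    then show ?thesis
    proof
      assume h: "t \<in> X1 \<and> v \<in> Y1"
      then have "X1 = {t} \<and> Y1 = {v}" "t \<in> X" "v \<in> Y" using single[of t v] X1 by auto
      then show ?thesis using s3 by blast
    next
      assume h: "t \<in> Y1 \<and> v \<in> X1"
      then have "X1 = {v} \<and> Y1 = {t}" "t \<in> Y" "v \<in> X" using single[of v t] X1 by auto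
      moreover have "{s, t, v} = {w3, v, t}" using s3 by blast
      ultimately show ?thesis by blast
    qed
  qed
  have zero: False if "s \<in> X \<union> Y" "t \<in> X \<union> Y" "v \<in> X \<union> Y" "{s, t} \<in> edges H" "{t, v} \<in> edges H" "{s, v} \<in> edges H" for s t v
    using nXY[of s t] nXY[of t v] nXY[of s v] that XYd by blast
  have tri: "{s, t, v} = {w1, w2, w3} \<or> (\<exists>x\<in>X. \<exists>y\<in>Y. X1 = {x} \<and> Y1 = {y} \<and> {s, t, v} = {w3, x, y})"
    if "{s, t} \<in> edges H" "{t, v} \<in> edges H" "{s, v} \<in> edges H" for s t v
  proof -
    have st: "s \<noteq> t" "t \<noteq> v" "s \<noteq> v" using that simple_edge(3)[OF G] by auto
    have sV: "u \<notin> ?W \<Longrightarrow> u \<in> {s, t, v} \<Longrightarrow> u \<in> X \<union> Y" for u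
      using that simple_edge[OF G] V by auto
    have sym: "{t, s} \<in> edges H" "{v, t} \<in> edges H" "{v, s} \<in> edges H" using that by (simp_all add: insert_commute)
    show ?thesis
    proof (cases "s \<in> ?W"; cases "t \<in> ?W"; cases "v \<in> ?W")
      assume "s \<in> ?W" "t \<in> ?W" "v \<in> ?W"
      then have "{s, t, v} \<subseteq> ?W" by blast
      moreover have "card {s, t, v} = 3" "card ?W = 3" using st w by simp_all
      ultimately show ?thesis using card_subset_eq[of ?W "{s, t, v}"] by simp
    next
      assume "s \<in> ?W" "t \<in> ?W" "v \<notin> ?W"
      then show ?thesis using two[of s t v] that st sV[of v] by simp
    next
      assume "s \<in> ?W" "t \<notin> ?W" "v \<in> ?W"
      then show ?thesis using two[of s v t] that sym st sV[of t] by simp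
    next
      assume "s \<notin> ?W" "t \<in> ?W" "v \<in> ?W"
      then show ?thesis using two[of t v s] that sym st sV[of s] by simp
    next
      assume "s \<in> ?W" "t \<notin> ?W" "v \<notin> ?W"
      then show ?thesis using one[of s t v] that sV[of t] sV[of v] by simp
    next
      assume "s \<notin> ?W" "t \<in> ?W" "v \<notin> ?W"
      then have "\<exists>x\<in>X. \<exists>y\<in>Y. X1 = {x} \<and> Y1 = {y} \<and> {t, s, v} = {w3, x, y}"
        using one[of t s v] that sym sV[of s] sV[of v] by simp
      moreover have "{t, s, v} = {s, t, v}" by blast
      ultimately show ?thesis by simp
    next
      assume "s \<notin> ?W" "t \<notin> ?W" "v \<in> ?W"
      then have "\<exists>x\<in>X. \<exists>y\<in>Y. X1 = {x} \<and> Y1 = {y} \<and> {v, s, t} = {w3, x, y}"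
        using one[of v s t] that sym sV[of s] sV[of t] by simp
      moreover have "{v, s, t} = {s, t, v}" by blast
      ultimately show ?thesis by simp
    next
      assume "s \<notin> ?W" "t \<notin> ?W" "v \<notin> ?W"
      then show ?thesis using zero[of s t v] that sV[of s] sV[of t] sV[of v] by simp
    qed
  qed
  show "\<not> has_theta H 2 2"
  proof
    assume "has_theta H 2 2"
    then obtain u v p p' where uv: "{u, v} \<in> edges H" and p: "is_path H (u # p @ [v])" "is_path H (u # p' @ [v])"
      "Suc (length p) = 2" "Suc (length p') = 2" "set p \<inter> set p' = {}"
      unfolding has_theta_def by blast
    obtain x y where xy: "p = [x]" "p' = [y]" using p(3,4) by (cases p; cases p') auto
    have ne: "x \<noteq> y" "x \<notin> {u, v}" "y \<notin> {u, v}" "u \<noteq> v" using p xy by (auto simp: is_path_Cons)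
    have e: "{u, x} \<in> edges H" "{v, x} \<in> edges H" "{u, y} \<in> edges H" "{v, y} \<in> edges H"
      using p xy by (auto simp: is_path_Cons insert_commute)
    have "{u, v, x} \<noteq> {u, v, y}" using ne by auto
    moreover have "{u, v} \<subseteq> {u, v, x} \<inter> {u, v, y}" by blast
    ultimately obtain a b where ab: "a \<in> X" "b \<in> Y" "{u, v} \<subseteq> {w1, w2, w3} \<inter> {w3, a, b}"
      using tri[OF uv e(2,1)] tri[OF uv e(4,3)] by (metis (no_types, lifting) inf_commute singleton_inject)
    then have "{u, v} \<subseteq> {w3}" using wn by blast
    then show False using ne by auto
  qed
  show "n * n + 8 \<le> 4 * esize H + 2 * n"
  proof -
    have inj: "inj_on (\<lambda>x. {w, x}) S" for w :: nat and S by (auto simp: inj_on_def doubleton_eq_iff)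
    let ?A = "edges (complete_bipartite X Y)" and ?B = "edges (Defs.triangle w1 w2 w3)"
      and ?C = "(\<lambda>x. {w1, x}) ` (X - X1)" and ?D = "(\<lambda>x. {w2, x}) ` (Y - Y1)" and ?F = "(\<lambda>x. {w3, x}) ` (X1 \<union> Y1)"
    have X1Y1: "X1 \<inter> Y1 = {}" using X1 XY by blast
    have c: "card ?A = card X * card Y" "card ?B = 3" "card ?C = card (X - X1)" "card ?D = card (Y - Y1)"
        "card ?F = card X1 + card Y1"
      using card_complete_bipartite[OF fin XY] wn(1-3) card_image[OF inj] fin1 X1 XY
        card_Un_disjoint[OF fin1 X1Y1] by (auto simp: Defs.triangle_def doubleton_eq_iff)
    have A: "e \<subseteq> X \<union> Y" if "e \<in> ?A" for e using that by (auto simp: complete_bipartite_def)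
    have A': "e \<inter> ?W = {}" if "e \<in> ?A" for e using A[OF that] wn by blast
    have B': "e \<inter> ?W \<noteq> {}" if "e \<in> ?B \<union> ?C \<union> ?D \<union> ?F" for e using that by (auto simp: Defs.triangle_def)
    have d: "?A \<inter> ?B = {}" "?A \<inter> ?C = {}" "?A \<inter> ?D = {}" "?A \<inter> ?F = {}"
      using A' B' by blast+
    have d': "?B \<inter> ?C = {}" "?B \<inter> ?D = {}" "?B \<inter> ?F = {}" "?C \<inter> ?D = {}" "?C \<inter> ?F = {}" "?D \<inter> ?F = {}"
      using wn X1 by (auto simp: Defs.triangle_def doubleton_eq_iff)
    have f: "finite ?A" "finite ?B" "finite ?C" "finite ?D" "finite ?F"
      using card_complete_bipartite[OF fin XY] fin fin1 by (auto simp: Defs.triangle_def)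
    have "card (?A \<union> ?B \<union> ?C \<union> ?D \<union> ?F) = card ?A + card ?B + card ?C + card ?D + card ?F"
      using f d d' by (simp add: card_Un_disjoint Int_Un_distrib2)
    moreover have "card (X - X1) + card X1 = card X" "card (Y - Y1) + card Y1 = card Y"
      using X1 fin fin1 card_mono[of X X1] card_mono[of Y Y1] by (auto simp: card_Diff_subset)
    ultimately have e: "esize H = card X * card Y + 3 + card X + card Y"
      unfolding E Setcompr_eq_image c by simp
    show ?thesis using cn(2) unfolding e cn(1)[symmetric] by (auto simp: algebra_simps)
  qed
qed

lemma family_G_nonempty:
  assumes "n \<ge> 6"
  shows "family_G n \<noteq> {}"
proof -
  let ?k = "(n - 2) div 2"
  have h: "nat \<lceil>(real n - 3) / 2\<rceil> = ?k" "nat \<lfloor>(real n - 3) / 2\<rfloor> = n - 3 - ?k"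
  proof -
    have "nat \<lceil>(real n - 3) / 2\<rceil> = (n - 3 + 1) div 2" "nat \<lfloor>(real n - 3) / 2\<rfloor> = (n - 3) div 2"
      using nat_half_minus[of 3 n] assms by auto
    moreover have "n - 3 + 1 = n - 2" using assms by simp
    moreover have "m div 2 = m - (m + 1) div 2" for m :: nat by presburger
    from this[of "n - 3"] have "(n - 3) div 2 = n - 3 - ?k" using \<open>n - 3 + 1 = n - 2\<close> by simp
    ultimately show "nat \<lceil>(real n - 3) / 2\<rceil> = ?k" "nat \<lfloor>(real n - 3) / 2\<rfloor> = n - 3 - ?k" by simp_all
  qed
  have "\<lparr>verts = {..<?k} \<union> {?k..<n - 3} \<union> {n, n + 1, n + 2},
       edges = edges (complete_bipartite {..<?k} {?k..<n - 3}) \<union> edges (Defs.triangle n (n + 1) (n + 2))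
                 \<union> {{n, x} | x. x \<in> {..<?k} - {}} \<union> {{n + 1, y} | y. y \<in> {?k..<n - 3} - {}}
                 \<union> {{n + 2, z} | z. z \<in> {} \<union> {}}\<rparr> \<in> family_G n"
  proof (rule family_G_I[where ?X1.0 = "{}" and ?Y1.0 = "{}"])
    show "card {..<?k} = nat \<lceil>(real n - 3) / 2\<rceil>" "card {?k..<n - 3} = nat \<lfloor>(real n - 3) / 2\<rfloor>"
      unfolding h by simp_all
    have "?k \<le> n" by simp
    then show "{n, n + 1, n + 2} \<inter> ({..<?k} \<union> {?k..<n - 3}) = {}" by (auto simp del: div_le_dividend)
  qed (auto simp: disjoint_iff)
  then show ?thesis by blast
qed

section \<open>Matching the bounds\<close>

lemma free_nonbipartite_theta_iff:
  assumes "q \<ge> 2" "r \<ge> 2"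
  shows "free_nonbipartite n (theta [1, q, r]) G \<longleftrightarrow>
    simple_graph G \<and> order G = n \<and> \<not> has_theta G q r \<and> \<not> bipartite G"
  using graph_free_theta_iff[OF _ assms] by (auto simp: free_nonbipartite_def)

text \<open>Members of the family have \<open>4 * esize H + k * n\<close> at least
  \<open>n * n + l\<close>, and no competitor exceeds \<open>n * n + l + 1\<close>. Two multiples of
  4 cannot differ by exactly 1, so every member is extremal; conversely an extremal graph reaches
  the lower bound and is isomorphic to a member.\<close>

lemma EX3_eqI:
  assumes qr: "q \<ge> 2" "r \<ge> 2" and ex: "eventually_extremal q r k l \<F>"
    and ne: "\<And>n. n \<ge> 6 \<Longrightarrow> \<F> n \<noteq> {}"
    and mem: "\<And>n H. n \<ge> 6 \<Longrightarrow> H \<in> \<F> n \<Longrightarrow> simple_graph H \<and> order H = n \<and> \<not> has_theta H q r \<and>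
      \<not> bipartite H \<and> n * n + l \<le> 4 * esize H + k * n"
  shows "\<exists>n0. \<forall>n\<ge>n0. equal_up_to_iso (EX3 n (theta [1, q, r])) (\<F> n)"
proof -
  obtain N where N: "\<forall>(G :: nat ugraph) n. simple_graph G \<and> order G = n \<and> \<not> has_theta G q r \<and> \<not> bipartite G \<and> N \<le> n \<longrightarrow>
       4 * esize G + k * n \<le> n * n + l + 1 \<and>
       (n * n + l \<le> 4 * esize G + k * n \<longrightarrow> (\<exists>H\<in>\<F> n. isomorphic G H))"
    using ex unfolding eventually_extremal_def by (elim exE) (rule that)
  have "equal_up_to_iso (EX3 n (theta [1, q, r])) (\<F> n)" if n: "N + 6 \<le> n" for n
  proof -
    have upper: "4 * esize G + k * n \<le> n * n + l + 1"
      "n * n + l \<le> 4 * esize G + k * n \<Longrightarrow> \<exists>H\<in>\<F> n. isomorphic G H"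
      if "free_nonbipartite n (theta [1, q, r]) G" for G :: "nat ugraph"
      using N[rule_format, of G n] n that unfolding free_nonbipartite_theta_iff[OF qr] by auto
    have lower: "free_nonbipartite n (theta [1, q, r]) H" "n * n + l \<le> 4 * esize H + k * n"
      if "H \<in> \<F> n" for H
      using mem[of n H] that n unfolding free_nonbipartite_theta_iff[OF qr] by auto
    show ?thesis
      unfolding equal_up_to_iso_def
    proof (intro conjI ballI)
      fix G assume G: "G \<in> EX3 n (theta [1, q, r])"
      obtain H where H: "H \<in> \<F> n" using ne[of n] n by auto
      have "esize H \<le> esize G" using G lower(1)[OF H] by (simp add: EX3_def)
      then have "n * n + l \<le> 4 * esize G + k * n" using lower(2)[OF H] by linarith
      then show "\<exists>H\<in>\<F> n. isomorphic G H" using upper(2) G by (simp add: EX3_def)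
    next
      fix H assume H: "H \<in> \<F> n"
      have "esize G \<le> esize H" if "free_nonbipartite n (theta [1, q, r]) G" for G :: "nat ugraph"
        using upper(1)[OF that] lower(2)[OF H] by linarith
      then have "H \<in> EX3 n (theta [1, q, r])" using lower(1)[OF H] by (simp add: EX3_def)
      then show "\<exists>G\<in>EX3 n (theta [1, q, r]). isomorphic G H" using isomorphic_refl by blast
    qed
  qed
  then show ?thesis by blast
qed

lemma EX3_theta_two_two:
  "\<exists>n0. \<forall>n\<ge>n0. equal_up_to_iso (EX3 n (theta [1, 2, 2])) (family_G n)"
  by (rule EX3_eqI[OF _ _ eventually_extremal_two_two])
    (use family_G_properties family_G_nonempty in auto)

lemma EX3_theta_two_odd:
  assumes r: "odd r" "r \<ge> 2"
  shows "\<exists>n0. \<forall>n\<ge>n0. equal_up_to_iso (EX3 n (theta [1, 2, r])) (family_H n)"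
  by (rule EX3_eqI[OF _ r(2) eventually_extremal_two_odd[OF r]])
    (use family_H_properties family_H_nonempty in auto)

lemma EX3_theta_even:
  assumes q: "even q" "q \<ge> 2" and r: "even r" "r \<ge> 4"
  shows "\<exists>n0. \<forall>n\<ge>n0. equal_up_to_iso (EX3 n (theta [1, q, r])) {K_bullet_K3 (n div 2) ((n - 1) div 2)}"
proof (rule EX3_eqI[OF q(2) _ eventually_extremal_even[OF q r]])
  show r2: "r \<ge> 2" using r by simp
  fix n :: nat and H
  assume n: "n \<ge> 6" and H: "H \<in> {K_bullet_K3 (n div 2) ((n - 1) div 2)}"
  obtain a b where ab: "H = K_bullet_K3 a b" "a \<ge> 1" "b \<ge> 1" "n = a + b + 1" "a = b \<or> a = Suc b"
  proof -
    have "n div 2 \<ge> 1" "(n - 1) div 2 \<ge> 1" "n = n div 2 + (n - 1) div 2 + 1"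
      "n div 2 = (n - 1) div 2 \<or> n div 2 = Suc ((n - 1) div 2)" using n by auto
    then show ?thesis using H that[of "n div 2" "(n - 1) div 2"] by blast
  qed
  have "(a + b) * (a + b) \<le> 4 * (a * b) + 1" using ab(5) by (auto simp: algebra_simps)
  then have "n * n + 8 \<le> 4 * (a * b + 2) + 2 * n" unfolding ab(4) by (simp add: algebra_simps)
  then show "simple_graph H \<and> order H = n \<and> \<not> has_theta H q r \<and> \<not> bipartite H \<and>
      n * n + 8 \<le> 4 * esize H + 2 * n"
    using K_bullet_properties[OF ab(2,3)] q r(1) r2 ab(1,4) by simp
qed simp

lemma EX3_theta_odd:
  assumes q: "even q" "q \<ge> 4" and r: "odd r" "r \<ge> 2"
  shows "\<exists>n0. \<forall>n\<ge>n0. equal_up_to_iso (EX3 n (theta [1, q, r]))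
    {K_circ_K3 ((n - 1) div 2) ((n - 2) div 2), K_circ_K3 ((n - 2) div 2) ((n - 1) div 2)}"
proof (rule EX3_eqI[OF _ r(2) eventually_extremal_odd[OF q r]])
  show q2: "q \<ge> 2" using q by simp
  fix n :: nat and H
  assume n: "n \<ge> 6"
    and H: "H \<in> {K_circ_K3 ((n - 1) div 2) ((n - 2) div 2), K_circ_K3 ((n - 2) div 2) ((n - 1) div 2)}"
  obtain a b where ab: "H = K_circ_K3 a b" "b \<ge> 1" "n = a + b + 2" "a = b \<or> a = Suc b \<or> b = Suc a"
  proof -
    have "(n - 1) div 2 \<ge> 1" "(n - 2) div 2 \<ge> 1" "n = (n - 1) div 2 + (n - 2) div 2 + 2"
      "(n - 1) div 2 = (n - 2) div 2 \<or> (n - 1) div 2 = Suc ((n - 2) div 2)" using n by auto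
    then show ?thesis using H that[of "(n - 1) div 2" "(n - 2) div 2"] that[of "(n - 2) div 2" "(n - 1) div 2"] by auto
  qed
  have "(a + b) * (a + b) \<le> 4 * (a * b) + 1" using ab(4) by (auto simp: algebra_simps)
  then have "n * n + 15 \<le> 4 * (a * b + 3) + 4 * n" unfolding ab(3) by (simp add: algebra_simps)
  then show "simple_graph H \<and> order H = n \<and> \<not> has_theta H q r \<and> \<not> bipartite H \<and>
      n * n + 15 \<le> 4 * esize H + 4 * n"
    using K_circ_properties[OF ab(2)] q(1) q2 r(2) ab(1,3) by simp
qed simp

theorem theorem1p2:
  fixes q r :: nat
  assumes "q \<ge> 2" and "r \<ge> 2" and "even q"
  shows "\<exists>n0. \<forall>n \<ge> n0.
     (q = 2 \<and> r = 2 \<longrightarrow>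
        equal_up_to_iso (EX3 n (theta [1, q, r])) (family_G n)) \<and>
     (r \<ge> 4 \<and> even r \<longrightarrow>
        equal_up_to_iso (EX3 n (theta [1, q, r]))
          {K_bullet_K3 (nat \<lceil>(real n - 1) / 2\<rceil>) (nat \<lfloor>(real n - 1) / 2\<rfloor>)}) \<and>
     (q = 2 \<and> odd r \<longrightarrow>
        equal_up_to_iso (EX3 n (theta [1, q, r])) (family_H n)) \<and>
     (q \<ge> 4 \<and> odd r \<longrightarrow>
        equal_up_to_iso (EX3 n (theta [1, q, r]))
          {K_circ_K3 (nat \<lceil>(real n - 2) / 2\<rceil>) (nat \<lfloor>(real n - 2) / 2\<rfloor>),
           K_circ_K3 (nat \<lfloor>(real n - 2) / 2\<rfloor>) (nat \<lceil>(real n - 2) / 2\<rceil>)})"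
proof -
  have h1: "nat \<lceil>(real n - 1) / 2\<rceil> = n div 2" "nat \<lfloor>(real n - 1) / 2\<rfloor> = (n - 1) div 2" if "n \<ge> 2" for n
    using nat_half_minus[of 1 n] that by simp_all
  have h2: "nat \<lceil>(real n - 2) / 2\<rceil> = (n - 1) div 2" "nat \<lfloor>(real n - 2) / 2\<rfloor> = (n - 2) div 2" if "n \<ge> 2" for n
  proof -
    have "n - 2 + 1 = n - 1" using that by simp
    then show "nat \<lceil>(real n - 2) / 2\<rceil> = (n - 1) div 2" "nat \<lfloor>(real n - 2) / 2\<rfloor> = (n - 2) div 2"
      using nat_half_minus[of 2 n] that by simp_all
  qed
  consider "q = 2" "r = 2" | "even r" "r \<ge> 4" | "q = 2" "odd r" | "q \<ge> 4" "odd r" | "q \<ge> 4" "r = 2"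
  proof -
    have "q = 2 \<or> q \<ge> 4" using assms(1,3) by presburger
    moreover have "r = 2 \<or> odd r \<or> even r \<and> r \<ge> 4" using assms(2) by presburger
    ultimately show ?thesis using that by blast
  qed
  then show ?thesis
  proof cases
    case 1
    then show ?thesis using EX3_theta_two_two by simp
  next
    case 2
    obtain n0 where "\<And>n. n \<ge> n0 \<Longrightarrow>
        equal_up_to_iso (EX3 n (theta [1, q, r])) {K_bullet_K3 (n div 2) ((n - 1) div 2)}"
      using EX3_theta_even[OF assms(3,1) 2] by auto
    then show ?thesis using 2 h1 by (intro exI[of _ "n0 + 2"]) auto
  next
    case 3
    then have "r \<noteq> 2" by auto
    then show ?thesis using 3 EX3_theta_two_odd[OF 3(2) assms(2)] by simp
  next
    case 4
    obtain n0 where "\<And>n. n \<ge> n0 \<Longrightarrow> equal_up_to_iso (EX3 n (theta [1, q, r]))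
        {K_circ_K3 ((n - 1) div 2) ((n - 2) div 2), K_circ_K3 ((n - 2) div 2) ((n - 1) div 2)}"
      using EX3_theta_odd[OF assms(3) 4 assms(2)] by auto
    then show ?thesis using 4 h2 by (intro exI[of _ "n0 + 2"]) auto
  next
    \<comment> \<open>Here the premises of all four implications fail. The graph
      \<open>\<theta>(1,q,2)\<close> is covered as \<open>\<theta>(1,2,q)\<close>, with the two
      lengths exchanged.\<close>
    case 5
    then show ?thesis by simp
  qed
qed

end
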